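(* Let $(X,\lambda)$ be a weighted polyhedron. For any two divisibly weighted triangulations $(K,\mu)$ and $(K',\mu')$ of $(X,\lambda)$, the weighted simplicial homology groups $H_*(K,\partial^{\mu})$ and $H_*(K',\partial^{\mu'})$ are isomorphic.
   Context: An ascending weight on a simplicial complex $K$ is a function $\mu$ assigning a positive integer to each simplex such that $\mu(\sigma')\mid\mu(\sigma)$ whenever $\sigma'$ is a face of $\sigma$; a descending weight satisfies instead $\mu(\sigma)\mid\mu(\sigma')$ whenever $\sigma'$ is a face of $\sigma$. A weighted simplicial complex $(K,\mu)$ is a simplicial complex with a weight $\mu$ that is either ascending or descending (its type). $C_n(K)$ is the free abelian group generated by the oriented $n$-simplices of $K$ (usual simplicial chains), $\partial_j[v_0,\dots,v_n]=[v_0,\dots,\widehat{v_j},\dots,v_n]$, and $\partial^{\mu}:C_n(K)\to C_{n-1}(K)$ is $\partial^{\mu}\sigma=\sum_{j=0}^n(-1)^jc^{\mu}_j(\sigma)\,\partial_j\sigma$, where $c^{\mu}_j(\sigma)=\mu(\sigma)/\mu(\partial_j\sigma)$ if $\mu$ is ascending and $c^{\mu}_j(\sigma)=\mu(\partial_j\sigma)/\mu(\sigma)$ if $\mu$ is descending. Then $\partial^\mu\circ\partial^\mu=0$, and $H_*(K,\partial^{\mu})$ denotes the homology of $(C_*(K),\partial^\mu)$. $|K|\subseteq\mathbb R^N$ is a geometric realization of $K$. For $x\in|K|$, $\mathrm{Car}_K(x)$ is the unique simplex of $K$ whose realization contains $x$ in its relative interior, and $\lambda_\mu:|K|\to\mathbb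 Z_+$ is $\lambda_\mu(x)=\mu(\mathrm{Car}_K(x))$. A weighted space is a pair $(X,\lambda)$ with $X$ a topological space and $\lambda:X\to\mathbb Z_+$ a function to the positive integers; $(X,\lambda)$ and $(X',\lambda')$ are isomorphic if there is a homeomorphism $f:X\to X'$ with $\lambda'(f(x))=\lambda(x)$ for all $x$. A weighted polyhedron is a weighted space isomorphic to $(|K|,\lambda_\mu)$ for some weighted simplicial complex $(K,\mu)$; such $(K,\mu)$ is called a weighted triangulation of $(X,\lambda)$. The polyhedron is of ascending (descending) type if its weighted triangulation is. A weighted simplicial complex $(K,\mu)$ is divisibly weighted if the vertices of every simplex can be ordered $v_0,\dots,v_k$ with $\mu(v_0)\mid\cdots\mid\mu(v_k)$ and, for such an ordering, the weight of the simplex is $\mu(v_k)$ if $\mu$ is ascending and $\mu(v_0)$ if $\mu$ is descending. A divisibly weighted triangulation is a weighted triangulation that is divisibly weighted. *)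

theory Defs
  imports
    "HOL-Analysis.Analysis"
    "HOL-Algebra.Free_Abelian_Groups"
    "HOL-Combinatorics.Combinatorics"
begin

section \<open>Simplicial complexes and their realizations\<close>

text \<open>The library predicate \<^const>\<open>Polytope.simplicial_complex\<close> is restricted to finite complexes.
  Here a complex is a family of finite vertex sets, possibly infinite; the empty set is not
  a simplex.\<close>

definition vertex_complex :: "'v set set \<Rightarrow> bool" where
  "vertex_complex K \<longleftrightarrow>
     (\<forall>s\<in>K. finite s \<and> s \<noteq> {}) \<and>
     (\<forall>s\<in>K. \<forall>t. t \<subseteq> s \<and> t \<noteq> {} \<longrightarrow> t \<in> K)"

definition geometric_realization :: "('v \<Rightarrow> 'a::euclidean_space) \<Rightarrow> 'v set set \<Rightarrow> bool" where
  "geometric_realization r K \<longleftrightarrow>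
     inj_on r (\<Union>K) \<and>
     (\<forall>s\<in>K. \<not> affine_dependent (r ` s)) \<and>
     (\<forall>s\<in>K. \<forall>t\<in>K. convex hull (r ` s) \<inter> convex hull (r ` t) = convex hull (r ` (s \<inter> t)))"

definition underlying_set :: "('v \<Rightarrow> 'a::euclidean_space) \<Rightarrow> 'v set set \<Rightarrow> 'a set" where
  "underlying_set r K = (\<Union>s\<in>K. convex hull (r ` s))"

text \<open>The polyhedron carries the topology coherent with its closed simplices. It is
  the subspace topology whenever the realization is locally finite (lemma
  \<open>polyhedron_topology_locally_finite\<close> below). In general the two differ: with the subspace topology
  the real line would also be triangulated by the complex whose simplices are its singletons.\<close>

definition polyhedron_open :: "('v \<Rightarrow> 'a::euclidean_space) \<Rightarrow> 'v set set \<Rightarrow> 'a set \<Rightarrow> bool" where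
  "polyhedron_open r K U \<longleftrightarrow>
     U \<subseteq> underlying_set r K \<and>
     (\<forall>s\<in>K. openin (top_of_set (convex hull (r ` s))) (U \<inter> convex hull (r ` s)))"

definition polyhedron_topology :: "('v \<Rightarrow> 'a::euclidean_space) \<Rightarrow> 'v set set \<Rightarrow> 'a topology" where
  "polyhedron_topology r K = topology (polyhedron_open r K)"

lemma openin_polyhedron_topology:
  fixes r :: "'v \<Rightarrow> 'b::euclidean_space"
  shows "openin (polyhedron_topology r K) U \<longleftrightarrow> polyhedron_open r K U"
proof -
  have "istopology (polyhedron_open r K)"
    unfolding istopology_def
  proof (intro conjI allI impI)
    fix S T assume S: "polyhedron_open r K S" and T: "polyhedron_open r K T"
    have "openin (top_of_set C) (S \<inter> T \<inter> C)"
      if "openin (top_of_set C) (S \<inter> C)" "openin (top_of_set C) (T \<inter> C)" for C :: "'b set"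
    proof -
      have "(S \<inter> C) \<inter> (T \<inter> C) = S \<inter> T \<inter> C"
        by blast
      then show ?thesis
        using openin_Int[OF that] by simp
    qed
    moreover have "S \<inter> T \<subseteq> underlying_set r K"
      using S unfolding polyhedron_open_def by blast
    ultimately show "polyhedron_open r K (S \<inter> T)"
      using S T unfolding polyhedron_open_def by simp
  next
    fix \<U> assume U: "\<forall>U\<in>\<U>. polyhedron_open r K U"
    have "openin (top_of_set (convex hull (r ` s))) (\<Union>\<U> \<inter> convex hull (r ` s))" if "s \<in> K" for s
    proof -
      have "openin (top_of_set (convex hull (r ` s))) (\<Union>U\<in>\<U>. U \<inter> convex hull (r ` s))"
        using U that unfolding polyhedron_open_def by (intro openin_Union) auto
      then show ?thesis
        by (simp only: Int_Union2)
    qed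
    moreover have "\<Union>\<U> \<subseteq> underlying_set r K"
      using U unfolding polyhedron_open_def by (simp add: Sup_least)
    ultimately show "polyhedron_open r K (\<Union>\<U>)"
      unfolding polyhedron_open_def by simp
  qed
  then show ?thesis
    by (simp add: polyhedron_topology_def topology_inverse')
qed

lemma topspace_polyhedron_topology: "topspace (polyhedron_topology r K) = underlying_set r K"
proof -
  have "underlying_set r K \<inter> convex hull (r ` s) = convex hull (r ` s)" if "s \<in> K" for s
    using that unfolding underlying_set_def by (intro Int_absorb1 UN_upper)
  then have "polyhedron_open r K (underlying_set r K)"
    unfolding polyhedron_open_def by simp
  then show ?thesis
    using openin_subset[of "polyhedron_topology r K" "underlying_set r K"]
      openin_topspace[of "polyhedron_topology r K"]
    unfolding openin_polyhedron_topology polyhedron_open_def by (intro subset_antisym) simp_all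
qed

lemma polyhedron_topology_locally_finite:
  assumes fin: "\<And>s. s \<in> K \<Longrightarrow> finite s"
    and lf: "\<And>x. x \<in> underlying_set r K \<Longrightarrow>
           \<exists>V. open V \<and> x \<in> V \<and> finite {s\<in>K. convex hull (r ` s) \<inter> V \<noteq> {}}"
  shows "polyhedron_topology r K = top_of_set (underlying_set r K)"
proof -
  have 1: "polyhedron_open r K U" if U: "openin (top_of_set (underlying_set r K)) U" for U
  proof -
    obtain T where "open T" and T: "U = underlying_set r K \<inter> T"
      using U unfolding openin_open by blast
    have "U \<inter> convex hull (r ` s) = convex hull (r ` s) \<inter> T" if "s \<in> K" for s
    proof -
      have "convex hull (r ` s) \<subseteq> underlying_set r K"
        using that unfolding underlying_set_def by (rule UN_upper)
      with T show ?thesis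
        by blast
    qed
    then show ?thesis
      unfolding polyhedron_open_def using T \<open>open T\<close> by (simp add: openin_open_Int)
  qed
  have 2: "openin (top_of_set (underlying_set r K)) U" if U: "polyhedron_open r K U" for U
  proof (subst openin_subopen, intro ballI)
    fix x assume x: "x \<in> U"
    then have xK: "x \<in> underlying_set r K"
      using U unfolding polyhedron_open_def by auto
    then obtain V where V: "open V" "x \<in> V" "finite {s\<in>K. convex hull (r ` s) \<inter> V \<noteq> {}}"
      using lf[of x] by auto
    define F where "F = {s\<in>K. convex hull (r ` s) \<inter> V \<noteq> {}}"
    define C where "C = (\<Union>s\<in>F. convex hull (r ` s) - U)"
    have cl: "closed (convex hull (r ` s) - U)" if "s \<in> F" for s
    proof -
      have s: "s \<in> K" using that F_def by blast
      have "compact (convex hull (r ` s))"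
        using fin[OF s] by (simp add: finite_imp_compact_convex_hull)
      moreover have "closedin (top_of_set (convex hull (r ` s)))
          (convex hull (r ` s) - U \<inter> convex hull (r ` s))"
        using U s unfolding polyhedron_open_def by (simp add: closedin_def Diff_Diff_Int Int_absorb1)
      moreover have "convex hull (r ` s) - U \<inter> convex hull (r ` s) = convex hull (r ` s) - U"
        by blast
      ultimately show ?thesis
        using closedin_closed_trans[OF _ compact_imp_closed] by simp
    qed
    have "closed C"
      unfolding C_def using V(3) cl by (intro closed_UN) (simp_all add: F_def)
    then have "open (V - C)"
      using V(1) by (intro open_Diff)
    moreover have "x \<in> V - C"
      using V(2) x C_def by blast
    moreover have "underlying_set r K \<inter> (V - C) \<subseteq> U"
      unfolding underlying_set_def C_def F_def by blast
    ultimately show "\<exists>T. openin (top_of_set (underlying_set r K)) T \<and> x \<in> T \<and> T \<subseteq> U"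
      using xK by (intro exI[of _ "underlying_set r K \<inter> (V - C)"]) (simp add: openin_open_Int)
  qed
  show ?thesis
    unfolding topology_eq openin_polyhedron_topology using 1 2 by (intro allI iffI)
qed

definition carrier_simplex :: "('v \<Rightarrow> 'a::euclidean_space) \<Rightarrow> 'v set set \<Rightarrow> 'a \<Rightarrow> 'v set" where
  "carrier_simplex r K x = (THE s. s \<in> K \<and> x \<in> rel_interior (convex hull (r ` s)))"

section \<open>Weights\<close>

definition ascending_weight :: "'v set set \<Rightarrow> ('v set \<Rightarrow> nat) \<Rightarrow> bool" where
  "ascending_weight K \<mu> \<longleftrightarrow>
     (\<forall>s\<in>K. 0 < \<mu> s) \<and> (\<forall>s\<in>K. \<forall>t\<in>K. t \<subseteq> s \<longrightarrow> \<mu> t dvd \<mu> s)"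

definition descending_weight :: "'v set set \<Rightarrow> ('v set \<Rightarrow> nat) \<Rightarrow> bool" where
  "descending_weight K \<mu> \<longleftrightarrow>
     (\<forall>s\<in>K. 0 < \<mu> s) \<and> (\<forall>s\<in>K. \<forall>t\<in>K. t \<subseteq> s \<longrightarrow> \<mu> s dvd \<mu> t)"

definition weighted_complex :: "'v set set \<Rightarrow> ('v set \<Rightarrow> nat) \<Rightarrow> bool" where
  "weighted_complex K \<mu> \<longleftrightarrow>
     vertex_complex K \<and> (ascending_weight K \<mu> \<or> descending_weight K \<mu>)"

definition divisibly_weighted :: "'v set set \<Rightarrow> ('v set \<Rightarrow> nat) \<Rightarrow> bool" where
  "divisibly_weighted K \<mu> \<longleftrightarrow>
     (\<forall>s\<in>K. \<exists>vs. distinct vs \<and> set vs = s \<and> sorted_wrt (dvd) (map (\<lambda>v. \<mu> {v}) vs) \<and>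
        (ascending_weight K \<mu> \<longrightarrow> \<mu> s = \<mu> {last vs}) \<and>
        (descending_weight K \<mu> \<longrightarrow> \<mu> s = \<mu> {hd vs}))"

definition point_weight ::
  "('v \<Rightarrow> 'a::euclidean_space) \<Rightarrow> 'v set set \<Rightarrow> ('v set \<Rightarrow> nat) \<Rightarrow> 'a \<Rightarrow> nat" where
  "point_weight r K \<mu> x = \<mu> (carrier_simplex r K x)"

section \<open>Weighted spaces and weighted triangulations\<close>

definition weighted_space :: "'x topology \<Rightarrow> ('x \<Rightarrow> nat) \<Rightarrow> bool" where
  "weighted_space X l \<longleftrightarrow> (\<forall>x\<in>topspace X. 0 < l x)"

definition weighted_isomorphic ::
  "'x topology \<Rightarrow> ('x \<Rightarrow> nat) \<Rightarrow> 'y topology \<Rightarrow> ('y \<Rightarrow> nat) \<Rightarrow> bool" where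
  "weighted_isomorphic X l X' l' \<longleftrightarrow>
     (\<exists>f. homeomorphic_map X X' f \<and> (\<forall>x\<in>topspace X. l' (f x) = l x))"

text \<open>A weighted polyhedron is a weighted space that has a weighted triangulation. There is no
  separate predicate for it, since it would have to quantify over the vertex type and the
  Euclidean space of the triangulation.\<close>

definition weighted_triangulation ::
  "('v \<Rightarrow> 'a::euclidean_space) \<Rightarrow> 'v set set \<Rightarrow> ('v set \<Rightarrow> nat) \<Rightarrow>
   'x topology \<Rightarrow> ('x \<Rightarrow> nat) \<Rightarrow> bool" where
  "weighted_triangulation r K \<mu> X l \<longleftrightarrow>
     weighted_complex K \<mu> \<and> geometric_realization r K \<and> weighted_space X l \<and>
     weighted_isomorphic X l (polyhedron_topology r K) (point_weight r K \<mu>)"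

section \<open>Weighted simplicial homology\<close>

text \<open>The group of oriented \<open>n\<close>-chains is the free abelian group on the orderings
  \<open>[v\<^sub>0, \<dots>, v\<^sub>n]\<close> of the \<open>n\<close>-simplices, modulo the relations identifying
  a permuted ordering with the sign of the permutation times the original one.\<close>

definition ordered_simplices :: "'v set set \<Rightarrow> nat \<Rightarrow> 'v list set" where
  "ordered_simplices K n = {vs. length vs = Suc n \<and> distinct vs \<and> set vs \<in> K}"

definition ordered_chain_group :: "'v set set \<Rightarrow> nat \<Rightarrow> ('v list \<Rightarrow>\<^sub>0 int) monoid" where
  "ordered_chain_group K n = free_Abelian_group (ordered_simplices K n)"

definition orientation_relations :: "'v set set \<Rightarrow> nat \<Rightarrow> ('v list \<Rightarrow>\<^sub>0 int) set" where
  "orientation_relations K n =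
     generate (ordered_chain_group K n)
       {frag_of (permute_list p vs) - frag_cmul (sign p) (frag_of vs) |p vs.
          vs \<in> ordered_simplices K n \<and> p permutes {..<Suc n}}"

definition oriented_chain_group :: "'v set set \<Rightarrow> nat \<Rightarrow> ('v list \<Rightarrow>\<^sub>0 int) set monoid" where
  "oriented_chain_group K n = ordered_chain_group K n Mod orientation_relations K n"

definition list_face :: "nat \<Rightarrow> 'v list \<Rightarrow> 'v list" where
  "list_face j vs = take j vs @ drop (Suc j) vs"

text \<open>If the weight is both ascending and descending, it takes equal values on a simplex and its
  faces, and both branches below give coefficient 1.\<close>

definition weight_coeff :: "'v set set \<Rightarrow> ('v set \<Rightarrow> nat) \<Rightarrow> nat \<Rightarrow> 'v list \<Rightarrow> nat" where
  "weight_coeff K \<mu> j vs =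
     (if ascending_weight K \<mu> then \<mu> (set vs) div \<mu> (set (list_face j vs))
      else \<mu> (set (list_face j vs)) div \<mu> (set vs))"

definition ordered_boundary ::
  "'v set set \<Rightarrow> ('v set \<Rightarrow> nat) \<Rightarrow> nat \<Rightarrow> ('v list \<Rightarrow>\<^sub>0 int) \<Rightarrow> ('v list \<Rightarrow>\<^sub>0 int)" where
  "ordered_boundary K \<mu> n =
     (if n = 0 then (\<lambda>c. 0)
      else frag_extend (\<lambda>vs. \<Sum>j\<le>n.
             frag_cmul ((-1) ^ j * int (weight_coeff K \<mu> j vs)) (frag_of (list_face j vs))))"

text \<open>The map induced on cosets: the union below is the single coset of
  \<open>ordered_boundary K \<mu> n c\<close>, for any representative \<open>c\<close> of \<open>A\<close>. In degree 0 the boundary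
  is the zero map, with \<open>n - 1 = 0\<close> as a dummy target degree.\<close>

definition weighted_boundary ::
  "'v set set \<Rightarrow> ('v set \<Rightarrow> nat) \<Rightarrow> nat \<Rightarrow> ('v list \<Rightarrow>\<^sub>0 int) set \<Rightarrow> ('v list \<Rightarrow>\<^sub>0 int) set" where
  "weighted_boundary K \<mu> n A =
     (\<Union>c\<in>A. orientation_relations K (n - 1) #>\<^bsub>ordered_chain_group K (n - 1)\<^esub>
        ordered_boundary K \<mu> n c)"

definition weighted_cycles :: "'v set set \<Rightarrow> ('v set \<Rightarrow> nat) \<Rightarrow> nat \<Rightarrow> ('v list \<Rightarrow>\<^sub>0 int) set set" where
  "weighted_cycles K \<mu> n =
     kernel (oriented_chain_group K n) (oriented_chain_group K (n - 1)) (weighted_boundary K \<mu> n)"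

definition weighted_homology ::
  "'v set set \<Rightarrow> ('v set \<Rightarrow> nat) \<Rightarrow> nat \<Rightarrow> ('v list \<Rightarrow>\<^sub>0 int) set set monoid" where
  "weighted_homology K \<mu> n =
     subgroup_generated (oriented_chain_group K n) (weighted_cycles K \<mu> n)
       Mod (weighted_boundary K \<mu> (Suc n) ` carrier (oriented_chain_group K (Suc n)))"

end

theory Submission
  imports Defs "HOL-Homology.Homology"
begin

text \<open>Rescaling the basis turns the weighted boundary into the usual one: for an ascending weight,
  \<open>\<sigma> \<mapsto> \<mu>(\<sigma>) \<sigma>\<close> identifies the weighted complex with the chains whose coefficient at
  \<open>\<sigma>\<close> is divisible by \<open>\<mu>(\<sigma>)\<close>; for a descending weight the coefficient lies in
  \<open>(1/\<mu>(\<sigma>)) \<int>\<close>. The same coefficient condition makes sense for a singular simplex \<open>f\<close> of the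
  polyhedron, with the least common multiple (or greatest common divisor) of \<open>\<lambda>\<close> over the image
  of \<open>f\<close> in place of \<open>\<mu>(\<sigma>)\<close>. The resulting weighted singular complex depends only on the
  weighted space, so it suffices to compare it with the simplicial one.

  Linear simplices map ordered simplicial chains to weighted singular chains. In the other direction
  send \<open>f\<close> to the tuple of those vertices of \<open>K\<close> whose barycentric coordinates are largest at
  the corners of \<open>f\<close>. If \<open>f\<close> is small, these vertices lie in the carrier of every point of the
  image of \<open>f\<close>, so the straight-line homotopy from \<open>f\<close> to the linear simplex on these
  vertices never leaves the carrier of a point and respects the weights. Subdivision makes
  chains small without enlarging images, and on ordered simplicial chains the composite is carried by
  simplices, hence homotopic to the identity by a cone construction. Finally, ordered and oriented
  chains are compared by signed sorting with respect to an arbitrary order of the vertices.\<close>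


text \<open>Coefficient conditions never appear on chains: a chain is an integer combination of
  basis elements that stand for weight multiples, and an operator is transported to that basis by
  multiplying its entries with rational weight ratios. Identities between unweighted chain maps and
  homotopies carry over as soon as all these ratios are integers. Hence each construction has to be
  controlled through images and carriers, and an abstract homotopy equivalence would not do. Tuples
  with repetitions mediate between the two theories because different corners of a singular simplex
  may select the same vertex. Compactness enters twice: a singular simplex meets only finitely many
  open simplices, so that its least common multiple is not 0, and the straight-line homotopy,
  plainly continuous for the Euclidean topology, is continuous for the coherent one because it can
  be pasted from finitely many cells. One comparison must serve both triangulations, so they must
  have the same type. That the type is visible in the weighted space follows from letting points of
  an open simplex converge to a point of a face.\<close>

lemma quotient_iso_criterion:
  assumes G: "comm_group G" and G': "comm_group G'"
    and N: "subgroup N G" and N': "subgroup N' G'"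
    and h: "h \<in> hom G G'"
    and ker: "\<And>x. x \<in> carrier G \<Longrightarrow> h x \<in> N' \<longleftrightarrow> x \<in> N"
    and surj: "\<And>y. y \<in> carrier G' \<Longrightarrow> \<exists>x\<in>carrier G. \<exists>b\<in>N'. y = b \<otimes>\<^bsub>G'\<^esub> h x"
  shows "G Mod N \<cong> G' Mod N'"
proof -
  interpret G: comm_group G by fact
  interpret G': comm_group G' by fact
  interpret N': normal N' G'
    using N' by (rule G'.subgroup_imp_normal)
  have Q: "group (G' Mod N')"
    by (rule N'.factorgroup_is_group)
  have q: "(\<lambda>x. N' #>\<^bsub>G'\<^esub> x) \<in> hom G' (G' Mod N')"
    by (rule N'.r_coset_hom_Mod)
  have hq: "(\<lambda>x. N' #>\<^bsub>G'\<^esub> h x) \<in> hom G (G' Mod N')"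
    using hom_compose[OF h q] by (simp add: o_def)
  interpret F: group_hom G "G' Mod N'" "\<lambda>x. N' #>\<^bsub>G'\<^esub> h x"
    by (simp add: group_hom_def group_hom_axioms_def G.is_group Q hq)
  have hc: "h x \<in> carrier G'" if "x \<in> carrier G" for x
    using h that by (rule hom_in_carrier)
  \<comment> \<open>First isomorphism theorem for \<open>h\<close> followed by the projection onto
    \<open>G' Mod N'\<close>: the kernel is \<open>N\<close>, and the composite is onto because
    \<open>h\<close> meets every coset of \<open>N'\<close>.\<close>
  have "kernel G (G' Mod N') (\<lambda>x. N' #>\<^bsub>G'\<^esub> h x) = N"
  proof -
    have "N' #>\<^bsub>G'\<^esub> h x = N' \<longleftrightarrow> x \<in> N" if "x \<in> carrier G" for x
      using ker[OF that] G'.coset_join2[OF hc[OF that] N'] G'.coset_join1[OF _ hc[OF that] N'] N'.subset by blast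
    then show ?thesis
      using subgroup.subset[OF N] by (auto simp: kernel_def)
  qed
  moreover have "(\<lambda>x. N' #>\<^bsub>G'\<^esub> h x) ` carrier G = carrier (G' Mod N')"
  proof (rule equalityI)
    show "carrier (G' Mod N') \<subseteq> (\<lambda>x. N' #>\<^bsub>G'\<^esub> h x) ` carrier G"
    proof
      fix A assume "A \<in> carrier (G' Mod N')"
      then obtain y where y: "y \<in> carrier G'" "A = N' #>\<^bsub>G'\<^esub> y"
        by (auto simp: carrier_FactGroup)
      then obtain x b where xb: "x \<in> carrier G" "b \<in> N'" "y = b \<otimes>\<^bsub>G'\<^esub> h x"
        using surj by blast
      have "A = N' #>\<^bsub>G'\<^esub> h x"
        using xb y G'.coset_mult_assoc[OF N'.subset, of b "h x"] hc N'.subset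
          G'.coset_join2[of b, OF _ N']
        by auto
      then show "A \<in> (\<lambda>x. N' #>\<^bsub>G'\<^esub> h x) ` carrier G"
        using xb by blast
    qed
  qed (use F.hom_closed in auto)
  ultimately show ?thesis
    using F.FactGroup_iso by simp
qed

section \<open>Additive groups of chains and linear extension\<close>

definition frag_group :: "('b \<Rightarrow>\<^sub>0 int) set \<Rightarrow> ('b \<Rightarrow>\<^sub>0 int) monoid" where
  "frag_group Z = \<lparr>carrier = Z, monoid.mult = (+), one = 0\<rparr>"

definition frag_subgroup :: "('b \<Rightarrow>\<^sub>0 int) set \<Rightarrow> bool" where
  "frag_subgroup Z \<longleftrightarrow> 0 \<in> Z \<and> (\<forall>x\<in>Z. \<forall>y\<in>Z. x - y \<in> Z)"

lemma frag_group_simps [simp]: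
  "carrier (frag_group Z) = Z" "x \<otimes>\<^bsub>frag_group Z\<^esub> y = x + y" "\<one>\<^bsub>frag_group Z\<^esub> = 0"
  by (simp_all add: frag_group_def)

lemma frag_subgroup_closed:
  assumes "frag_subgroup Z"
  shows "0 \<in> Z" "\<And>x y. x \<in> Z \<Longrightarrow> y \<in> Z \<Longrightarrow> x - y \<in> Z" "\<And>x. x \<in> Z \<Longrightarrow> - x \<in> Z"
    "\<And>x y. x \<in> Z \<Longrightarrow> y \<in> Z \<Longrightarrow> x + y \<in> Z"
proof -
  show 0: "0 \<in> Z" and d: "\<And>x y. x \<in> Z \<Longrightarrow> y \<in> Z \<Longrightarrow> x - y \<in> Z"
    using assms unfolding frag_subgroup_def by blast+
  show n: "\<And>x. x \<in> Z \<Longrightarrow> - x \<in> Z"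
    using d[OF 0] by simp
  show "x + y \<in> Z" if "x \<in> Z" "y \<in> Z" for x y
    using d[OF that(1) n[OF that(2)]] by simp
qed

lemma frag_subgroup_cmul:
  assumes Z: "frag_subgroup Z" and "x \<in> Z"
  shows "frag_cmul k x \<in> Z"
  by (rule frag_closure_minus_cmul) (use frag_subgroup_closed[OF Z] assms(2) in auto)

lemma frag_subgroup_sum:
  assumes Z: "frag_subgroup Z" and "\<And>i. i \<in> I \<Longrightarrow> g i \<in> Z"
  shows "sum g I \<in> Z"
  using assms(2) by (induction I rule: infinite_finite_induct) (auto intro: frag_subgroup_closed[OF Z])

lemma frag_subgroup_extend:
  assumes Z: "frag_subgroup Z" and "\<And>y. y \<in> Poly_Mapping.keys c \<Longrightarrow> F y \<in> Z"
  shows "frag_extend F c \<in> Z"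
  unfolding frag_extend_def by (intro frag_subgroup_sum frag_subgroup_cmul Z assms(2))

lemma keys_diff_subset:
  "Poly_Mapping.keys a \<subseteq> S \<Longrightarrow> Poly_Mapping.keys b \<subseteq> S \<Longrightarrow> Poly_Mapping.keys (a - b) \<subseteq> S"
  using keys_diff[of a b] by blast

lemma keys_extend_subset:
  "(\<And>y. y \<in> Poly_Mapping.keys c \<Longrightarrow> Poly_Mapping.keys (F y) \<subseteq> S) \<Longrightarrow> Poly_Mapping.keys (frag_extend F c) \<subseteq> S"
  using keys_frag_extend[of F c] by blast

lemma frag_extend_extend:
  "frag_extend G (frag_extend F c) = frag_extend (\<lambda>x. frag_extend G (F x)) c"
proof -
  have "Poly_Mapping.keys c \<subseteq> UNIV" by simp
  then show ?thesis
    by (induction c rule: frag_induction) (auto simp: frag_extend_diff)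
qed

lemma frag_cmul_diff_distrib2: "frag_cmul k (a - b) = frag_cmul k a - frag_cmul k b"
  by (rule poly_mapping_eqI) (simp add: lookup_minus right_diff_distrib)

lemma frag_extend_fun_diff:
  "frag_extend (\<lambda>x. F x - G x) c = frag_extend F c - frag_extend G c"
  by (simp add: frag_extend_def sum_subtractf frag_cmul_diff_distrib2)

lemma frag_extend_fun_add:
  "frag_extend (\<lambda>x. F x + G x) c = frag_extend F c + frag_extend G c"
  by (simp add: frag_extend_def sum.distrib frag_cmul_distrib2)

lemma comm_group_frag_group:
  assumes Z: "frag_subgroup Z"
  shows "comm_group (frag_group Z)"
proof (rule comm_groupI)
  show "\<exists>y\<in>carrier (frag_group Z). y \<otimes>\<^bsub>frag_group Z\<^esub> x = \<one>\<^bsub>frag_group Z\<^esub>"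
    if "x \<in> carrier (frag_group Z)" for x
    using that frag_subgroup_closed(3)[OF Z] by (intro bexI[of _ "- x"]) auto
qed (use frag_subgroup_closed[OF Z] in \<open>auto simp: algebra_simps\<close>)

lemma subgroup_frag_group:
  assumes Z: "frag_subgroup Z" and N: "frag_subgroup N" and "N \<subseteq> Z"
  shows "subgroup N (frag_group Z)"
proof -
  interpret comm_group "frag_group Z"
    by (rule comm_group_frag_group[OF Z])
  have inv: "inv\<^bsub>frag_group Z\<^esub> x = - x" if "x \<in> Z" for x
    using that frag_subgroup_closed(3)[OF Z] by (intro inv_equality) auto
  show ?thesis
    using frag_subgroup_closed[OF N] \<open>N \<subseteq> Z\<close> by (intro subgroupI) (auto simp: inv subset_iff)
qed

section \<open>Twisted operators on free abelian groups\<close>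

text \<open>\<open>rescale b k c\<close> is the element \<open>k c\<close> written in the basis of the multiples \<open>b(y) y\<close>. The floor
  is exact precisely when \<open>fits b k c\<close> holds.\<close>

definition rescale :: "('b \<Rightarrow> rat) \<Rightarrow> rat \<Rightarrow> ('b \<Rightarrow>\<^sub>0 int) \<Rightarrow> ('b \<Rightarrow>\<^sub>0 int)" where
  "rescale b k = frag_extend (\<lambda>y. frag_cmul \<lfloor>k / b y\<rfloor> (frag_of y))"

text \<open>The matrix of \<open>F\<close> after a change of basis: source elements stand for
  \<open>a x\<close> times \<open>x\<close>, target elements for \<open>b y\<close> times
  \<open>y\<close>. It is defined for arbitrary weights by rounding down and represents
  \<open>F\<close> faithfully where \<open>fits\<close> holds.\<close>

definition twist :: "('b \<Rightarrow> rat) \<Rightarrow> ('c \<Rightarrow> rat) \<Rightarrow> ('b \<Rightarrow> 'c \<Rightarrow>\<^sub>0 int) \<Rightarrow> ('b \<Rightarrow>\<^sub>0 int) \<Rightarrow> ('c \<Rightarrow>\<^sub>0 int)" where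
  "twist a b F = frag_extend (\<lambda>x. rescale b (a x) (F x))"

definition fits :: "('b \<Rightarrow> rat) \<Rightarrow> rat \<Rightarrow> ('b \<Rightarrow>\<^sub>0 int) \<Rightarrow> bool" where
  "fits b k c \<longleftrightarrow> (\<forall>y\<in>Poly_Mapping.keys c. b y \<noteq> 0 \<and> k / b y \<in> \<int>)"

lemma fits_frag_of [simp]: "fits b k (frag_of y) \<longleftrightarrow> b y \<noteq> 0 \<and> k / b y \<in> \<int>"
  by (simp add: fits_def)

lemma fits_0 [simp]: "fits b k 0"
  by (simp add: fits_def)

lemma fits_trans: "b y \<noteq> 0 \<Longrightarrow> k / b y \<in> \<int> \<Longrightarrow> fits c (b y) d \<Longrightarrow> fits c k d"
proof (unfold fits_def, intro ballI conjI)
  fix z assume "b y \<noteq> 0" "k / b y \<in> \<int>" and z: "z \<in> Poly_Mapping.keys d"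
    and d: "\<forall>z\<in>Poly_Mapping.keys d. c z \<noteq> 0 \<and> b y / c z \<in> \<int>"
  then have "k / c z = (k / b y) * (b y / c z)"
    by simp
  then show "k / c z \<in> \<int>"
    using d z \<open>k / b y \<in> \<int>\<close> by (simp only: Ints_mult)
qed auto

lemma rescale_diff: "rescale b k (c - d) = rescale b k c - rescale b k d"
  by (simp add: rescale_def frag_extend_diff)

lemma rescale_add: "rescale b k (c + d) = rescale b k c + rescale b k d"
  by (simp add: rescale_def frag_extend_add)

lemma rescale_0 [simp]: "rescale b k 0 = 0"
  by (simp add: rescale_def)

lemma rescale_cmul: "rescale b k (frag_cmul n c) = frag_cmul n (rescale b k c)"
  by (simp add: rescale_def frag_extend_cmul)

lemma rescale_of [simp]: "rescale b k (frag_of y) = frag_cmul \<lfloor>k / b y\<rfloor> (frag_of y)"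
  by (simp add: rescale_def)

lemma keys_rescale: "Poly_Mapping.keys (rescale b k c) \<subseteq> Poly_Mapping.keys c"
  using keys_frag_extend[of "\<lambda>y. frag_cmul \<lfloor>k / b y\<rfloor> (frag_of y)" c] by (auto simp: rescale_def)

lemma twist_of [simp]: "twist a b F (frag_of x) = rescale b (a x) (F x)"
  by (simp add: twist_def)

lemma twist_diff: "twist a b F (c - d) = twist a b F c - twist a b F d"
  by (simp add: twist_def frag_extend_diff)

lemma twist_add: "twist a b F (c + d) = twist a b F c + twist a b F d"
  by (simp add: twist_def frag_extend_add)

lemma twist_0 [simp]: "twist a b F 0 = 0"
  by (simp add: twist_def)

lemma twist_cmul: "twist a b F (frag_cmul n c) = frag_cmul n (twist a b F c)"
  by (simp add: twist_def frag_extend_cmul)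

lemma keys_twist:
  "Poly_Mapping.keys (twist a b F c) \<subseteq> (\<Union>x\<in>Poly_Mapping.keys c. Poly_Mapping.keys (F x))"
  unfolding twist_def by (intro keys_extend_subset order_trans[OF keys_rescale]) blast

lemma keys_twist_subset:
  "(\<And>x. x \<in> Poly_Mapping.keys c \<Longrightarrow> Poly_Mapping.keys (F x) \<subseteq> S) \<Longrightarrow> Poly_Mapping.keys (twist a b F c) \<subseteq> S"
  using keys_twist[of a b F c] by blast

lemma twist_cong:
  "(\<And>x. x \<in> Poly_Mapping.keys c \<Longrightarrow> F x = G x) \<Longrightarrow> twist a b F c = twist a b G c"
  unfolding twist_def by (intro frag_extend_eq) simp

lemma twist_fun_diff: "twist a b (\<lambda>x. F x - G x) c = twist a b F c - twist a b G c"
  by (simp add: twist_def rescale_diff frag_extend_fun_diff)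

lemma twist_fun_add: "twist a b (\<lambda>x. F x + G x) c = twist a b F c + twist a b G c"
  by (simp add: twist_def rescale_add frag_extend_fun_add)

lemma twist_frag_of:
  assumes "\<And>x. x \<in> Poly_Mapping.keys c \<Longrightarrow> a x \<noteq> 0"
  shows "twist a a frag_of c = c"
proof -
  have "twist a a frag_of c = frag_extend frag_of c"
    unfolding twist_def using assms by (intro frag_extend_eq) simp
  then show ?thesis
    using frag_expansion[of c] by simp
qed

lemma twist_zero_fun: "twist a b (\<lambda>x. 0) c = 0"
  by (simp add: twist_def frag_extend_eq_0)

lemma floor_mult_Ints:
  fixes x y :: rat
  assumes "x \<in> \<int>" "y \<in> \<int>"
  shows "\<lfloor>x\<rfloor> * \<lfloor>y\<rfloor> = \<lfloor>x * y\<rfloor>"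
  using assms by (metis Ints_cases floor_of_int of_int_mult)

text \<open>The factor \<open>b y\<close> cancels between the two ratios. Integrality matters
  because floors are multiplicative on integers only.\<close>

lemma rescale_rescale:
  assumes "b y \<noteq> 0" "k / b y \<in> \<int>" "fits c (b y) d"
  shows "frag_cmul \<lfloor>k / b y\<rfloor> (rescale c (b y) d) = rescale c k d"
proof -
  have "frag_cmul \<lfloor>k / b y\<rfloor> (rescale c (b y) d)
      = frag_extend (\<lambda>z. frag_cmul \<lfloor>k / b y\<rfloor> (frag_cmul \<lfloor>b y / c z\<rfloor> (frag_of z))) d"
    by (simp only: rescale_def frag_extend_def frag_cmul_sum frag_cmul_cmul mult.left_commute)
  also have "\<dots> = rescale c k d"
    unfolding rescale_def
  proof (rule frag_extend_eq)
    fix z assume z: "z \<in> Poly_Mapping.keys d"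
    then have "\<lfloor>k / b y\<rfloor> * \<lfloor>b y / c z\<rfloor> = \<lfloor>k / c z\<rfloor>"
      using assms by (simp add: floor_mult_Ints fits_def)
    then show "frag_cmul \<lfloor>k / b y\<rfloor> (frag_cmul \<lfloor>b y / c z\<rfloor> (frag_of z)) = frag_cmul \<lfloor>k / c z\<rfloor> (frag_of z)"
      by (simp only: frag_cmul_cmul)
  qed
  finally show ?thesis .
qed

lemma twist_rescale:
  assumes "fits b k c" and "\<And>y. y \<in> Poly_Mapping.keys c \<Longrightarrow> fits b' (b y) (G y)"
  shows "twist b b' G (rescale b k c) = rescale b' k (frag_extend G c)"
proof -
  have "Poly_Mapping.keys c \<subseteq> {y. b y \<noteq> 0 \<and> k / b y \<in> \<int> \<and> fits b' (b y) (G y)}"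
    using assms by (auto simp: fits_def)
  then show ?thesis
    by (induction c rule: frag_induction)
      (simp_all add: rescale_diff twist_diff frag_extend_diff twist_cmul rescale_rescale)
qed

text \<open>Functoriality of the change of basis. This is the device that turns every identity
  between unweighted operators into one between weighted operators: what remains to be shown each
  time is that the two factors fit.\<close>

lemma twist_twist:
  assumes "\<And>x. x \<in> Poly_Mapping.keys c \<Longrightarrow> fits b (a x) (F x)"
    and "\<And>x y. x \<in> Poly_Mapping.keys c \<Longrightarrow> y \<in> Poly_Mapping.keys (F x) \<Longrightarrow> fits b' (b y) (G y)"
  shows "twist b b' G (twist a b F c) = twist a b' (\<lambda>x. frag_extend G (F x)) c"
proof -
  have "Poly_Mapping.keys c \<subseteq> {x. fits b (a x) (F x) \<and> (\<forall>y\<in>Poly_Mapping.keys (F x). fits b' (b y) (G y))}"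
    using assms by auto
  then show ?thesis
    by (induction c rule: frag_induction) (simp_all add: twist_diff twist_rescale)
qed

section \<open>Complexes in a rescaled basis and their homology\<close>

text \<open>Truncated subtraction makes degree 0 its own predecessor. The last conjunct, vanishing
  of the differential in degree 0, makes this dummy target harmless.\<close>

definition based_complex ::
  "(nat \<Rightarrow> 'b set) \<Rightarrow> (nat \<Rightarrow> 'b \<Rightarrow> rat) \<Rightarrow> (nat \<Rightarrow> 'b \<Rightarrow> 'b \<Rightarrow>\<^sub>0 int) \<Rightarrow> bool" where
  "based_complex B a d \<longleftrightarrow>
     (\<forall>n. \<forall>x\<in>B n. a n x \<noteq> 0 \<and> Poly_Mapping.keys (d n x) \<subseteq> B (n - 1) \<and> fits (a (n - 1)) (a n x) (d n x)
        \<and> frag_extend (d (n - 1)) (d n x) = 0) \<and> (\<forall>x\<in>B 0. d 0 x = 0)"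

definition twisted_boundary ::
  "(nat \<Rightarrow> 'b \<Rightarrow> rat) \<Rightarrow> (nat \<Rightarrow> 'b \<Rightarrow> 'b \<Rightarrow>\<^sub>0 int) \<Rightarrow> nat \<Rightarrow> ('b \<Rightarrow>\<^sub>0 int) \<Rightarrow> 'b \<Rightarrow>\<^sub>0 int" where
  "twisted_boundary a d n = twist (a n) (a (n - 1)) (d n)"

definition twisted_cycles ::
  "(nat \<Rightarrow> 'b set) \<Rightarrow> (nat \<Rightarrow> 'b \<Rightarrow> rat) \<Rightarrow> (nat \<Rightarrow> 'b \<Rightarrow> 'b \<Rightarrow>\<^sub>0 int) \<Rightarrow> nat \<Rightarrow> ('b \<Rightarrow>\<^sub>0 int) set" where
  "twisted_cycles B a d n = {c. Poly_Mapping.keys c \<subseteq> B n \<and> twisted_boundary a d n c = 0}"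

definition twisted_boundaries ::
  "(nat \<Rightarrow> 'b set) \<Rightarrow> (nat \<Rightarrow> 'b \<Rightarrow> rat) \<Rightarrow> (nat \<Rightarrow> 'b \<Rightarrow> 'b \<Rightarrow>\<^sub>0 int) \<Rightarrow> nat \<Rightarrow> ('b \<Rightarrow>\<^sub>0 int) set" where
  "twisted_boundaries B a d n = twisted_boundary a d (Suc n) ` {c. Poly_Mapping.keys c \<subseteq> B (Suc n)}"

definition twisted_homology ::
  "(nat \<Rightarrow> 'b set) \<Rightarrow> (nat \<Rightarrow> 'b \<Rightarrow> rat) \<Rightarrow> (nat \<Rightarrow> 'b \<Rightarrow> 'b \<Rightarrow>\<^sub>0 int) \<Rightarrow> nat \<Rightarrow> ('b \<Rightarrow>\<^sub>0 int) set monoid" where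
  "twisted_homology B a d n = frag_group (twisted_cycles B a d n) Mod twisted_boundaries B a d n"

lemma twisted_boundary_diff:
  "twisted_boundary a d n (x - y) = twisted_boundary a d n x - twisted_boundary a d n y"
  by (simp add: twisted_boundary_def twist_diff)

lemma twisted_boundary_0 [simp]: "twisted_boundary a d n 0 = 0"
  by (simp add: twisted_boundary_def)

lemma frag_subgroup_twisted_cycles: "frag_subgroup (twisted_cycles B a d n)"
  by (simp add: frag_subgroup_def twisted_cycles_def twisted_boundary_diff keys_diff_subset)

lemma frag_subgroup_twisted_boundaries: "frag_subgroup (twisted_boundaries B a d n)"
  unfolding frag_subgroup_def twisted_boundaries_def
proof (intro conjI ballI)
  show "0 \<in> twisted_boundary a d (Suc n) ` {c. Poly_Mapping.keys c \<subseteq> B (Suc n)}"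
    by (rule image_eqI[of _ _ 0]) simp_all
  fix x y assume "x \<in> twisted_boundary a d (Suc n) ` {c. Poly_Mapping.keys c \<subseteq> B (Suc n)}"
    "y \<in> twisted_boundary a d (Suc n) ` {c. Poly_Mapping.keys c \<subseteq> B (Suc n)}"
  then obtain u v where "Poly_Mapping.keys u \<subseteq> B (Suc n)" "x = twisted_boundary a d (Suc n) u"
    "Poly_Mapping.keys v \<subseteq> B (Suc n)" "y = twisted_boundary a d (Suc n) v"
    by blast
  then show "x - y \<in> twisted_boundary a d (Suc n) ` {c. Poly_Mapping.keys c \<subseteq> B (Suc n)}"
    by (intro image_eqI[of _ _ "u - v"]) (simp_all add: twisted_boundary_diff keys_diff_subset)
qed

lemma based_complexD:
  assumes "based_complex B a d" "x \<in> B n"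
  shows "a n x \<noteq> 0" "Poly_Mapping.keys (d n x) \<subseteq> B (n - 1)" "fits (a (n - 1)) (a n x) (d n x)"
    "frag_extend (d (n - 1)) (d n x) = 0" "n = 0 \<Longrightarrow> d n x = 0"
  using assms unfolding based_complex_def by blast+

lemma keys_twisted_boundary:
  assumes "based_complex B a d" "Poly_Mapping.keys c \<subseteq> B n"
  shows "Poly_Mapping.keys (twisted_boundary a d n c) \<subseteq> B (n - 1)"
  unfolding twisted_boundary_def
  using assms(2) by (intro keys_twist_subset based_complexD(2)[OF assms(1)]) auto

lemma twisted_boundary_boundary:
  assumes C: "based_complex B a d" and "Poly_Mapping.keys c \<subseteq> B n"
  shows "twisted_boundary a d (n - 1) (twisted_boundary a d n c) = 0"
proof -
  have c: "x \<in> B n" if "x \<in> Poly_Mapping.keys c" for x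
    using assms(2) that by blast
  have "twisted_boundary a d (n - 1) (twisted_boundary a d n c)
      = twist (a n) (a (n - 1 - 1)) (\<lambda>x. frag_extend (d (n - 1)) (d n x)) c"
    unfolding twisted_boundary_def
  proof (rule twist_twist)
    show "fits (a (n - 1)) (a n x) (d n x)" if "x \<in> Poly_Mapping.keys c" for x
      using based_complexD(3)[OF C c[OF that]] .
    show "fits (a (n - 1 - 1)) (a (n - 1) y) (d (n - 1) y)"
      if "x \<in> Poly_Mapping.keys c" "y \<in> Poly_Mapping.keys (d n x)" for x y
      using based_complexD(3)[OF C] based_complexD(2)[OF C c[OF that(1)]] that(2) by blast
  qed
  also have "\<dots> = twist (a n) (a (n - 1 - 1)) (\<lambda>x. 0) c"
    using based_complexD(4)[OF C c] by (intro twist_cong)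
  finally show ?thesis
    by (simp add: twist_zero_fun)
qed

lemma twisted_boundaries_subset_cycles:
  assumes "based_complex B a d"
  shows "twisted_boundaries B a d n \<subseteq> twisted_cycles B a d n"
  using keys_twisted_boundary[OF assms, of _ "Suc n"] twisted_boundary_boundary[OF assms, of _ "Suc n"]
  by (auto simp: twisted_boundaries_def twisted_cycles_def)

text \<open>A statement about representatives in one fixed degree: \<open>h\<close> only has to be
  additive, with no companion maps in other degrees. The inverse need not be given by a map either;
  this matters because going from singular chains back to tuples is possible only after a
  subdivision that depends on the chain.\<close>

lemma twisted_homology_iso_criterion:
  assumes C: "based_complex B a d" and C': "based_complex B' a' d'"
    and add: "\<And>x y. h (x + y) = h x + h y"
    and cyc: "\<And>x. x \<in> twisted_cycles B a d n \<Longrightarrow> h x \<in> twisted_cycles B' a' d' n"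
    and bd: "\<And>x. x \<in> twisted_boundaries B a d n \<Longrightarrow> h x \<in> twisted_boundaries B' a' d' n"
    and inj: "\<And>x. x \<in> twisted_cycles B a d n \<Longrightarrow> h x \<in> twisted_boundaries B' a' d' n \<Longrightarrow> x \<in> twisted_boundaries B a d n"
    and surj: "\<And>y. y \<in> twisted_cycles B' a' d' n \<Longrightarrow> \<exists>x\<in>twisted_cycles B a d n. y - h x \<in> twisted_boundaries B' a' d' n"
  shows "twisted_homology B a d n \<cong> twisted_homology B' a' d' n"
  unfolding twisted_homology_def
proof (rule quotient_iso_criterion)
  show "h \<in> hom (frag_group (twisted_cycles B a d n)) (frag_group (twisted_cycles B' a' d' n))"
    using cyc add by (auto simp: hom_def)
  show "\<exists>x\<in>carrier (frag_group (twisted_cycles B a d n)). \<exists>b\<in>twisted_boundaries B' a' d' n.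
      y = b \<otimes>\<^bsub>frag_group (twisted_cycles B' a' d' n)\<^esub> h x"
    if "y \<in> carrier (frag_group (twisted_cycles B' a' d' n))" for y
  proof -
    obtain x where "x \<in> twisted_cycles B a d n" "y - h x \<in> twisted_boundaries B' a' d' n"
      using surj \<open>y \<in> carrier _\<close> by auto
    then show ?thesis
      by (intro bexI[of _ x] bexI[of _ "y - h x"]) simp_all
  qed
  show "h x \<in> twisted_boundaries B' a' d' n \<longleftrightarrow> x \<in> twisted_boundaries B a d n"
    if "x \<in> carrier (frag_group (twisted_cycles B a d n))" for x
    using inj bd that by (simp only: frag_group_simps) blast
qed (intro comm_group_frag_group subgroup_frag_group frag_subgroup_twisted_cycles
      frag_subgroup_twisted_boundaries twisted_boundaries_subset_cycles C C')+

section \<open>Ordered tuples\<close>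

definition vcone :: "'v \<Rightarrow> ('v list \<Rightarrow>\<^sub>0 int) \<Rightarrow> ('v list \<Rightarrow>\<^sub>0 int)" where
  "vcone v = frag_extend (\<lambda>t. frag_of (v # t))"

text \<open>The empty tuple sits in degree \<open>-1\<close> as an augmentation, so that \<open>\<partial>(v c) = c - v (\<partial>c)\<close> holds in
  all degrees; \<open>tuple_differential\<close> below drops it.\<close>

primrec tuple_boundary :: "'v list \<Rightarrow> ('v list \<Rightarrow>\<^sub>0 int)" where
  "tuple_boundary [] = 0"
| "tuple_boundary (v # t) = frag_of t - vcone v (tuple_boundary t)"

lemma vcone_diff: "vcone v (c - d) = vcone v c - vcone v d"
  by (simp add: vcone_def frag_extend_diff)

lemma vcone_0 [simp]: "vcone v 0 = 0"
  by (simp add: vcone_def)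

lemma vcone_minus: "vcone v (- c) = - vcone v c"
  by (simp add: vcone_def frag_extend_minus)

lemma vcone_of [simp]: "vcone v (frag_of t) = frag_of (v # t)"
  by (simp add: vcone_def)

lemma frag_extend_vcone: "frag_extend F (vcone v c) = frag_extend (\<lambda>t. F (v # t)) c"
  by (simp add: vcone_def frag_extend_extend)

lemma vcone_frag_extend: "vcone v (frag_extend F c) = frag_extend (\<lambda>t. vcone v (F t)) c"
  by (simp add: vcone_def frag_extend_extend)

lemma keys_vcone: "Poly_Mapping.keys (vcone v c) \<subseteq> (#) v ` Poly_Mapping.keys c"
  unfolding vcone_def by (intro keys_extend_subset) simp

lemma boundary_vcone:
  "frag_extend tuple_boundary (vcone v c) = c - vcone v (frag_extend tuple_boundary c)"
  using frag_expansion[of c]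
  by (simp add: frag_extend_vcone frag_extend_fun_diff vcone_frag_extend)

lemma tuple_boundary_boundary: "frag_extend tuple_boundary (tuple_boundary t) = 0"
  by (induction t) (simp_all add: frag_extend_diff boundary_vcone)

lemma list_face_Cons_0 [simp]: "list_face 0 (v # t) = t"
  by (simp add: list_face_def)

lemma list_face_Cons_Suc [simp]: "list_face (Suc j) (v # t) = v # list_face j t"
  by (simp add: list_face_def)

lemma vcone_sum: "vcone v (sum g I) = (\<Sum>i\<in>I. vcone v (g i))"
  by (induction I rule: infinite_finite_induct) (simp_all add: vcone_def frag_extend_add)

lemma vcone_cmul: "vcone v (frag_cmul k c) = frag_cmul k (vcone v c)"
  by (simp add: vcone_def frag_extend_cmul)

text \<open>The recursive form suits cone arguments; the alternating sum is the form shared by the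
  weighted boundary of the statement and the singular boundary.\<close>

lemma tuple_boundary_eq_sum:
  "tuple_boundary t = (\<Sum>j<length t. frag_cmul ((-1) ^ j) (frag_of (list_face j t)))"
proof (induction t)
  case (Cons v t)
  have "(\<Sum>j<length (v # t). frag_cmul ((-1) ^ j) (frag_of (list_face j (v # t))))
      = frag_of t + (\<Sum>j<length t. frag_cmul ((-1) ^ Suc j) (frag_of (v # list_face j t)))"
    by (simp only: list.size add_Suc_right add_0_right sum.lessThan_Suc_shift) simp
  also have "(\<Sum>j<length t. frag_cmul ((-1) ^ Suc j) (frag_of (v # list_face j t)))
      = - vcone v (tuple_boundary t)"
    by (simp add: Cons.IH vcone_sum vcone_cmul sum_negf[symmetric])
  finally show ?case by simp
qed simp

lemma length_list_face: "j < length t \<Longrightarrow> length (list_face j t) = length t - 1"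
  by (simp add: list_face_def)

lemma set_list_face: "set (list_face j t) \<subseteq> set t"
  using set_take_subset[of j t] set_drop_subset[of "Suc j" t] by (auto simp: list_face_def)

lemma keys_tuple_boundary: "Poly_Mapping.keys (tuple_boundary t) \<subseteq> (\<lambda>j. list_face j t) ` {..<length t}"
  unfolding tuple_boundary_eq_sum
  by (rule order_trans[OF keys_sum]) (auto simp: keys_frag_of)

text \<open>The homotopy of the acyclic carrier argument with an explicit contraction, the cone from
  the first vertex of the tuple. The index is the length of the tuple, one more than its degree, so
  the recursion starts at the empty tuple.\<close>

primrec cone_homotopy :: "('v list \<Rightarrow> ('v list \<Rightarrow>\<^sub>0 int)) \<Rightarrow> nat \<Rightarrow> 'v list \<Rightarrow> ('v list \<Rightarrow>\<^sub>0 int)" where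
  "cone_homotopy F 0 = (\<lambda>t. 0)"
| "cone_homotopy F (Suc n) =
     (\<lambda>t. vcone (hd t) (F t - frag_of t - frag_extend (cone_homotopy F n) (tuple_boundary t)))"

lemma cone_homotopy_boundary:
  assumes D: "\<And>t. t \<in> D \<Longrightarrow> Poly_Mapping.keys (tuple_boundary t) \<subseteq> D"
    and nil: "F [] = frag_of []"
    and chain: "\<And>t. t \<in> D \<Longrightarrow> frag_extend tuple_boundary (F t) = frag_extend F (tuple_boundary t)"
    and "t \<in> D" "length t = n"
  shows "frag_extend tuple_boundary (cone_homotopy F n t)
      + frag_extend (cone_homotopy F (n - 1)) (tuple_boundary t) = F t - frag_of t"
  using assms(4,5)
proof (induction n arbitrary: t)
  case 0
  then show ?case by (simp add: nil)
next
  case (Suc n)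
  define x where "x = F t - frag_of t - frag_extend (cone_homotopy F n) (tuple_boundary t)"
  have keys: "y \<in> D \<and> length y = n" if "y \<in> Poly_Mapping.keys (tuple_boundary t)" for y
    using that D[OF Suc.prems(1)] keys_tuple_boundary[of t] Suc.prems(2)
    by (auto simp: length_list_face subset_iff)
  have "frag_extend (\<lambda>y. frag_extend tuple_boundary (cone_homotopy F n y)) (tuple_boundary t)
     = frag_extend (\<lambda>y. F y - frag_of y - frag_extend (cone_homotopy F (n - 1)) (tuple_boundary y)) (tuple_boundary t)"
    using Suc.IH keys by (intro frag_extend_eq) (simp add: algebra_simps)
  also have "\<dots> = frag_extend F (tuple_boundary t) - tuple_boundary t
      - frag_extend (cone_homotopy F (n - 1)) (frag_extend tuple_boundary (tuple_boundary t))"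
    by (simp only: frag_extend_fun_diff frag_expansion[symmetric] frag_extend_extend)
  finally have "frag_extend tuple_boundary (frag_extend (cone_homotopy F n) (tuple_boundary t))
      = frag_extend F (tuple_boundary t) - tuple_boundary t"
    by (simp add: frag_extend_extend tuple_boundary_boundary)
  then have "frag_extend tuple_boundary x = 0"
    by (simp add: x_def frag_extend_diff chain[OF Suc.prems(1)])
  then have "frag_extend tuple_boundary (vcone (hd t) x) = x"
    by (simp add: boundary_vcone)
  then show ?case
    by (simp add: x_def)
qed

text \<open>The apex of each cone is a vertex of the tuple, so no new vertices arise. This is what
  makes the homotopy compatible with weights.\<close>

lemma keys_cone_homotopy:
  assumes D: "\<And>t. t \<in> D \<Longrightarrow> Poly_Mapping.keys (tuple_boundary t) \<subseteq> D"
    and F: "\<And>t. t \<in> D \<Longrightarrow> Poly_Mapping.keys (F t) \<subseteq> {u. set u \<subseteq> set t \<and> length u = length t}"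
    and "t \<in> D" "length t = n"
  shows "Poly_Mapping.keys (cone_homotopy F n t) \<subseteq> {u. set u \<subseteq> set t \<and> length u = Suc n}"
  using assms(3,4)
proof (induction n arbitrary: t)
  case (Suc n)
  let ?A = "{u. set u \<subseteq> set t \<and> length u = Suc n}"
  have "Poly_Mapping.keys (frag_extend (cone_homotopy F n) (tuple_boundary t)) \<subseteq> ?A"
  proof (rule keys_extend_subset)
    fix y assume y: "y \<in> Poly_Mapping.keys (tuple_boundary t)"
    then obtain j where "j < length t" "y = list_face j t"
      using keys_tuple_boundary[of t] by blast
    then have "y \<in> D" "length y = n" "set y \<subseteq> set t"
      using D[OF Suc.prems(1)] y Suc.prems(2) set_list_face[of j t] by (auto simp: length_list_face)
    then show "Poly_Mapping.keys (cone_homotopy F n y) \<subseteq> ?A"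
      using Suc.IH[of y] by auto
  qed
  then have keys: "Poly_Mapping.keys (F t - frag_of t - frag_extend (cone_homotopy F n) (tuple_boundary t)) \<subseteq> ?A"
    using F[OF Suc.prems(1)] Suc.prems(2) by (intro keys_diff_subset) auto
  show ?case
  proof
    fix u assume "u \<in> Poly_Mapping.keys (cone_homotopy F (Suc n) t)"
    then obtain y where y: "u = hd t # y"
      "y \<in> Poly_Mapping.keys (F t - frag_of t - frag_extend (cone_homotopy F n) (tuple_boundary t))"
      using keys_vcone[of "hd t" "F t - frag_of t - frag_extend (cone_homotopy F n) (tuple_boundary t)"]
      by (simp only: cone_homotopy.simps) blast
    moreover have "hd t \<in> set t"
      using Suc.prems(2) by (cases t) auto
    ultimately show "u \<in> {u. set u \<subseteq> set t \<and> length u = Suc (Suc n)}"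
      using keys by auto
  qed
qed simp

section \<open>The weighted complex of ordered tuples\<close>

text \<open>Repeated vertices are allowed, so that vertices can be assigned to the corners of a
  singular simplex independently of each other.\<close>

definition tuples :: "'v set set \<Rightarrow> nat \<Rightarrow> 'v list set" where
  "tuples K n = {vs. length vs = Suc n \<and> set vs \<in> K}"

definition tuple_differential :: "nat \<Rightarrow> 'v list \<Rightarrow> ('v list \<Rightarrow>\<^sub>0 int)" where
  "tuple_differential n t = (if n = 0 then 0 else tuple_boundary t)"

text \<open>Inverting descending weights unifies the two types: in both, the quotient of the weight
  of a simplex by that of a face is an integer.\<close>

definition rat_weight :: "bool \<Rightarrow> nat \<Rightarrow> rat" where
  "rat_weight asc m = (if asc then of_nat m else 1 / of_nat m)"

definition typed_weight :: "bool \<Rightarrow> 'v set set \<Rightarrow> ('v set \<Rightarrow> nat) \<Rightarrow> bool" where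
  "typed_weight asc K \<mu> \<longleftrightarrow> vertex_complex K \<and>
     (if asc then ascending_weight K \<mu> else descending_weight K \<mu>)"

lemma rat_weight_ratio:
  assumes "0 < m" "0 < m'" "if asc then m' dvd m else m dvd m'"
  shows "rat_weight asc m' \<noteq> 0" "rat_weight asc m / rat_weight asc m' \<in> \<int>"
proof -
  show "rat_weight asc m' \<noteq> 0"
    using assms by (simp add: rat_weight_def)
  have "(of_nat p :: rat) / of_nat q \<in> \<int>" if "q dvd p" "0 < q" for p q :: nat
    using that by (elim dvdE) (simp add: Ints_of_nat)
  then show "rat_weight asc m / rat_weight asc m' \<in> \<int>"
    using assms by (auto simp: rat_weight_def)
qed

definition tuple_weight :: "bool \<Rightarrow> ('v set \<Rightarrow> nat) \<Rightarrow> 'v list \<Rightarrow> rat" where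
  "tuple_weight asc \<mu> t = rat_weight asc (\<mu> (set t))"

lemma typed_weightD:
  assumes "typed_weight asc K \<mu>" "s \<in> K" "t \<in> K" "t \<subseteq> s"
  shows "0 < \<mu> s" "if asc then \<mu> t dvd \<mu> s else \<mu> s dvd \<mu> t"
  using assms unfolding typed_weight_def ascending_weight_def descending_weight_def
  by (auto split: if_splits)

lemma vertex_complex_subset:
  "vertex_complex K \<Longrightarrow> s \<in> K \<Longrightarrow> t \<subseteq> s \<Longrightarrow> t \<noteq> {} \<Longrightarrow> t \<in> K"
  unfolding vertex_complex_def by blast

lemma tuples_subset:
  assumes "vertex_complex K" "set t \<in> K" "set u \<subseteq> set t" "length u = Suc n"
  shows "u \<in> tuples K n"
proof -
  have "set u \<noteq> {}"
    using assms(4) by auto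
  then show ?thesis
    using vertex_complex_subset[OF assms(1,2,3)] assms(4) by (simp add: tuples_def)
qed

text \<open>Any chain on nonempty tuples of vertices of \<open>t\<close> consists of faces of one
  simplex, and the ascending or descending condition is exactly the integrality of the
  ratios.\<close>

lemma fits_carried:
  assumes w: "typed_weight asc K \<mu>" and "set t \<in> K"
    and "\<And>u. u \<in> Poly_Mapping.keys c \<Longrightarrow> u \<noteq> [] \<and> set u \<subseteq> set t"
  shows "fits (tuple_weight asc \<mu>) (tuple_weight asc \<mu> t) c"
  unfolding fits_def tuple_weight_def
proof
  fix u assume "u \<in> Poly_Mapping.keys c"
  then have sub: "set u \<subseteq> set t" and "set u \<noteq> {}"
    using assms(3) by auto
  then have u: "set u \<in> K"
    using w \<open>set t \<in> K\<close> by (auto simp: typed_weight_def intro: vertex_complex_subset)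
  show "rat_weight asc (\<mu> (set u)) \<noteq> 0 \<and> rat_weight asc (\<mu> (set t)) / rat_weight asc (\<mu> (set u)) \<in> \<int>"
    using rat_weight_ratio[OF typed_weightD(1)[OF w assms(2,2) order_refl]
        typed_weightD(1)[OF w u u order_refl] typed_weightD(2)[OF w assms(2) u sub]] by simp
qed

lemma keys_tuple_differential:
  assumes "vertex_complex K" "t \<in> tuples K n"
  shows "Poly_Mapping.keys (tuple_differential n t) \<subseteq> {u \<in> tuples K (n - 1). set u \<subseteq> set t}"
proof (cases n)
  case (Suc m)
  show ?thesis
  proof
    fix u assume "u \<in> Poly_Mapping.keys (tuple_differential n t)"
    then obtain j where "j < length t" "u = list_face j t"
      using keys_tuple_boundary[of t] Suc by (auto simp: tuple_differential_def)
    then have "length u = Suc m" "set u \<subseteq> set t"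
      using assms(2) Suc set_list_face[of j t] by (auto simp: length_list_face tuples_def)
    then show "u \<in> {u \<in> tuples K (n - 1). set u \<subseteq> set t}"
      using Suc assms tuples_subset[of K t u m] by (simp add: tuples_def)
  qed
qed (simp add: tuple_differential_def)

lemma based_complex_tuples:
  assumes w: "typed_weight asc K \<mu>"
  shows "based_complex (tuples K) (\<lambda>n. tuple_weight asc \<mu>) tuple_differential"
  unfolding based_complex_def
proof (intro conjI allI ballI)
  fix n t assume t: "t \<in> tuples K n"
  have K: "vertex_complex K"
    using w by (simp add: typed_weight_def)
  show "tuple_weight asc \<mu> t \<noteq> 0"
    using typed_weightD[OF w] t by (auto simp: tuple_weight_def tuples_def rat_weight_def)
  show "Poly_Mapping.keys (tuple_differential n t) \<subseteq> tuples K (n - 1)"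
    using keys_tuple_differential[OF K t] by blast
  show "fits (tuple_weight asc \<mu>) (tuple_weight asc \<mu> t) (tuple_differential n t)"
    using keys_tuple_differential[OF K t] t by (intro fits_carried[OF w]) (auto simp: tuples_def)
  show "frag_extend (tuple_differential (n - 1)) (tuple_differential n t) = 0"
  proof (cases "n - 1 = 0")
    case False
    then have "frag_extend (tuple_differential (n - 1)) c = frag_extend tuple_boundary c" for c :: "'a list \<Rightarrow>\<^sub>0 int"
      by (intro frag_extend_eq) (simp add: tuple_differential_def)
    with False show ?thesis by (simp add: tuple_boundary_boundary tuple_differential_def)
  qed (simp add: tuple_differential_def frag_extend_eq_0)
qed (simp add: tuple_differential_def)

text \<open>Acyclic carriers with weights: the cone homotopy between \<open>F\<close> and the
  identity stays on the vertices of each tuple, hence fits. It is applied to signed sorting and to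
  the round trip through subdivided linear simplices.\<close>

lemma carried_chain_map_homotopic:
  assumes w: "typed_weight asc K \<mu>"
    and nil: "F [] = frag_of []"
    and chain: "\<And>t. set t \<in> K \<Longrightarrow> frag_extend tuple_boundary (F t) = frag_extend F (tuple_boundary t)"
    and carried: "\<And>t. set t \<in> K \<Longrightarrow> Poly_Mapping.keys (F t) \<subseteq> {u. set u \<subseteq> set t \<and> length u = length t}"
    and z: "z \<in> twisted_cycles (tuples K) (\<lambda>n. tuple_weight asc \<mu>) tuple_differential n"
  shows "twist (tuple_weight asc \<mu>) (tuple_weight asc \<mu>) F z - z
      \<in> twisted_boundaries (tuples K) (\<lambda>n. tuple_weight asc \<mu>) tuple_differential n"
proof -
  \<comment> \<open>The empty tuple is added to make the domain closed under faces in the augmented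
    complex.\<close>
  let ?w = "tuple_weight asc \<mu>" and ?D = "insert [] {t. set t \<in> K}"
  \<comment> \<open>Tuples of degree \<open>n\<close> have length \<open>Suc n\<close>, which is the
    index of the homotopy; \<open>h'\<close> is the homotopy one degree lower.\<close>
  define h where "h = cone_homotopy F (Suc n)"
  define h' where "h' = (if n = 0 then (\<lambda>t. 0) else cone_homotopy F n)"
  have K: "vertex_complex K"
    using w by (simp add: typed_weight_def)
  have zt: "t \<in> tuples K n" if "t \<in> Poly_Mapping.keys z" for t
    using z that by (auto simp: twisted_cycles_def)
  have D: "Poly_Mapping.keys (tuple_boundary t) \<subseteq> ?D" if "t \<in> ?D" for t
  proof
    fix u assume "u \<in> Poly_Mapping.keys (tuple_boundary t)"
    then obtain j where "u = list_face j t"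
      using keys_tuple_boundary[of t] by blast
    then show "u \<in> ?D"
      using that set_list_face[of j t] vertex_complex_subset[OF K, of "set t" "set u"]
      by (cases "u = []") (auto simp: list_face_def)
  qed
  have chain': "frag_extend tuple_boundary (F t) = frag_extend F (tuple_boundary t)" if "t \<in> ?D" for t
    using that chain nil by auto
  have carried': "Poly_Mapping.keys (F t) \<subseteq> {u. set u \<subseteq> set t \<and> length u = length t}" if "t \<in> ?D" for t
    using that carried nil by auto
  have kh: "Poly_Mapping.keys (h t) \<subseteq> {u. set u \<subseteq> set t \<and> length u = Suc (Suc n)}" if "t \<in> tuples K n" for t
    unfolding h_def using that by (intro keys_cone_homotopy[OF D carried']) (auto simp: tuples_def)
  have kh': "Poly_Mapping.keys (h' t) \<subseteq> {u. set u \<subseteq> set t \<and> length u = Suc n}" if "t \<in> tuples K (n - 1)" for t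
  proof (cases n)
    case (Suc m)
    then show ?thesis
      using that keys_cone_homotopy[OF D carried', of t n] by (simp add: h'_def tuples_def)
  qed (simp add: h'_def)
  have "twisted_boundary (\<lambda>n. ?w) tuple_differential (Suc n) (twist ?w ?w h z)
      = twist ?w ?w (\<lambda>t. frag_extend (tuple_differential (Suc n)) (h t)) z"
    unfolding twisted_boundary_def
  proof (rule twist_twist)
    fix t u assume t: "t \<in> Poly_Mapping.keys z"
    show "fits ?w (?w t) (h t)"
      using kh[OF zt[OF t]] zt[OF t] by (intro fits_carried[OF w]) (auto simp: tuples_def)
    assume "u \<in> Poly_Mapping.keys (h t)"
    then have "u \<in> tuples K (Suc n)"
      using kh[OF zt[OF t]] zt[OF t] tuples_subset[OF K, of t u "Suc n"] by (auto simp: tuples_def)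
    then show "fits ?w (?w u) (tuple_differential (Suc n) u)"
      using based_complexD(3)[OF based_complex_tuples[OF w]] by blast
  qed
  moreover have "twist ?w ?w h' (twisted_boundary (\<lambda>n. ?w) tuple_differential n z)
      = twist ?w ?w (\<lambda>t. frag_extend h' (tuple_differential n t)) z"
    unfolding twisted_boundary_def
  proof (rule twist_twist)
    fix t u assume t: "t \<in> Poly_Mapping.keys z"
    show "fits ?w (?w t) (tuple_differential n t)"
      using based_complexD(3)[OF based_complex_tuples[OF w] zt[OF t]] .
    assume "u \<in> Poly_Mapping.keys (tuple_differential n t)"
    then have "u \<in> tuples K (n - 1)"
      using keys_tuple_differential[OF K zt[OF t]] by blast
    then show "fits ?w (?w u) (h' u)"
      using kh'[of u] by (intro fits_carried[OF w]) (auto simp: tuples_def)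
  qed
  moreover have "twisted_boundary (\<lambda>n. ?w) tuple_differential n z = 0"
    using z by (simp add: twisted_cycles_def)
  moreover
  have "frag_extend (tuple_differential (Suc n)) (h t) + frag_extend h' (tuple_differential n t)
      = F t - frag_of t" if "t \<in> Poly_Mapping.keys z" for t
  proof -
    have t: "length t = Suc n" "t \<in> ?D"
      using zt[OF that] by (auto simp: tuples_def)
    \<comment> \<open>Dropping the augmentation loses nothing, since the homotopy vanishes on the
      empty tuple.\<close>
    have "frag_extend h' (tuple_differential n t) = frag_extend (cone_homotopy F n) (tuple_boundary t)"
    proof (cases n)
      case 0
      then have "cone_homotopy F n = (\<lambda>t. 0)" "tuple_differential n t = 0"
        by (simp_all add: tuple_differential_def)
      then show ?thesis
        by (simp add: frag_extend_eq_0)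
    qed (simp add: h'_def tuple_differential_def)
    moreover have "frag_extend (tuple_differential (Suc n)) (h t) = frag_extend tuple_boundary (h t)"
      by (intro frag_extend_eq) (simp add: tuple_differential_def)
    ultimately show ?thesis
      using cone_homotopy_boundary[OF D nil chain' t(2,1)]
      by (simp add: h_def del: cone_homotopy.simps)
  qed
  then have "twist ?w ?w (\<lambda>t. F t - frag_of t) z
      = twist ?w ?w (\<lambda>t. frag_extend (tuple_differential (Suc n)) (h t) + frag_extend h' (tuple_differential n t)) z"
    by (intro twist_cong) simp
  ultimately have "twisted_boundary (\<lambda>n. ?w) tuple_differential (Suc n) (twist ?w ?w h z)
      = twist ?w ?w (\<lambda>t. F t - frag_of t) z"
    by (simp add: twist_fun_add)
  also have "\<dots> = twist ?w ?w F z - z"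
    using based_complexD(1)[OF based_complex_tuples[OF w] zt]
    by (simp add: twist_fun_diff twist_frag_of)
  finally have eq: "twisted_boundary (\<lambda>n. ?w) tuple_differential (Suc n) (twist ?w ?w h z)
      = twist ?w ?w F z - z" .
  have "Poly_Mapping.keys (twist ?w ?w h z) \<subseteq> tuples K (Suc n)"
  proof (rule keys_twist_subset, rule subsetI)
    fix t u assume "t \<in> Poly_Mapping.keys z" "u \<in> Poly_Mapping.keys (h t)"
    then show "u \<in> tuples K (Suc n)"
      using kh[OF zt, of t] zt[of t] tuples_subset[OF K, of t u "Suc n"] by (auto simp: tuples_def)
  qed
  then show ?thesis
    unfolding twisted_boundaries_def eq[symmetric] by blast
qed

section \<open>Signed sorting and oriented chains\<close>

definition vertex_less :: "'v \<Rightarrow> 'v \<Rightarrow> bool" where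
  "vertex_less = (SOME r. irreflp r \<and> transp r \<and> totalp r)"

lemma vertex_less_linear:
  "irreflp (vertex_less :: 'v \<Rightarrow> 'v \<Rightarrow> bool) \<and> transp (vertex_less :: 'v \<Rightarrow> 'v \<Rightarrow> bool)
    \<and> totalp (vertex_less :: 'v \<Rightarrow> 'v \<Rightarrow> bool)"
proof -
  obtain r :: "'v rel" where r: "well_order_on UNIV r"
    using well_order_on by blast
  define lt where "lt = (\<lambda>x y. (x, y) \<in> r \<and> x \<noteq> y)"
  have "trans r" "antisym r" "total_on UNIV r"
    using r by (auto simp: well_order_on_def linear_order_on_def partial_order_on_def preorder_on_def)
  then have "irreflp lt \<and> transp lt \<and> totalp lt"
    unfolding lt_def irreflp_def transp_def totalp_on_def trans_def antisym_def total_on_def by blast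
  then show ?thesis
    unfolding vertex_less_def by (rule someI[of "\<lambda>r. irreflp r \<and> transp r \<and> totalp r"])
qed

lemma vertex_less_irrefl: "\<not> vertex_less x x"
  by (meson vertex_less_linear irreflpD)

lemma vertex_less_trans: "vertex_less x y \<Longrightarrow> vertex_less y z \<Longrightarrow> vertex_less x z"
  by (meson vertex_less_linear transpD)

lemma vertex_less_total: "x \<noteq> y \<Longrightarrow> \<not> vertex_less x y \<Longrightarrow> vertex_less y x"
  using totalpD[OF vertex_less_linear[THEN conjunct2, THEN conjunct2], of x y] by blast

primrec signed_insert :: "'v \<Rightarrow> 'v list \<Rightarrow> ('v list \<Rightarrow>\<^sub>0 int)" where
  "signed_insert x [] = frag_of [x]"
| "signed_insert x (y # ys) =
     (if x = y then 0 else if vertex_less x y then frag_of (x # y # ys) else - vcone y (signed_insert x ys))"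

text \<open>Insertion sort that records the sign of the permutation and sends tuples with a
  repetition to 0. It is a projection of ordered chains onto chains of strictly increasing tuples, a
  model of oriented chains.\<close>

primrec signed_sort :: "'v list \<Rightarrow> ('v list \<Rightarrow>\<^sub>0 int)" where
  "signed_sort [] = frag_of []"
| "signed_sort (x # t) = frag_extend (signed_insert x) (signed_sort t)"

text \<open>Only adjacent entries are exchanged, which is convenient for induction on lists;
  arbitrary permutations are recovered later. Vanishing on repeated entries is a consequence, as
  free abelian groups have no 2-torsion.\<close>

definition alternating :: "('v list \<Rightarrow> ('w \<Rightarrow>\<^sub>0 int)) \<Rightarrow> bool" where
  "alternating P \<longleftrightarrow> (\<forall>xs a b ys. P (xs @ a # b # ys) = - P (xs @ b # a # ys))"

lemma frag_eq_minus_self: "(c :: 'b \<Rightarrow>\<^sub>0 int) = - c \<Longrightarrow> c = 0"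
proof (rule poly_mapping_eqI)
  fix x assume "c = - c"
  then have "poly_mapping.lookup c x = - poly_mapping.lookup c x"
    by (metis lookup_uminus)
  then show "poly_mapping.lookup c x = poly_mapping.lookup 0 x"
    by simp
qed

lemma alternatingD: "alternating P \<Longrightarrow> P (xs @ a # b # ys) = - P (xs @ b # a # ys)"
  unfolding alternating_def by blast

lemma alternating_same: "alternating P \<Longrightarrow> P (xs @ a # a # ys) = 0"
  using alternatingD[of P xs a a ys] by (rule frag_eq_minus_self)

lemma alternating_Cons:
  assumes "alternating P"
  shows "alternating (\<lambda>t. P (x # t))"
  unfolding alternating_def
proof (intro allI)
  fix xs a b ys
  show "P (x # xs @ a # b # ys) = - P (x # xs @ b # a # ys)"
    using alternatingD[OF assms, of "x # xs" a b ys] by (simp only: append_Cons)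
qed

lemma alternating_signed_insert:
  assumes "alternating P"
  shows "frag_extend P (signed_insert x s) = P (x # s)"
  using assms
proof (induction s arbitrary: P)
  case (Cons y ys)
  have "frag_extend P (- vcone y (signed_insert x ys)) = - P (y # x # ys)"
    using Cons.IH[OF alternating_Cons[OF Cons.prems, of y]]
    by (simp add: frag_extend_minus frag_extend_vcone)
  also have "\<dots> = P (x # y # ys)"
    using alternatingD[OF Cons.prems, of "[]" x y ys] by simp
  finally show ?case
    using alternating_same[OF Cons.prems, of "[]" y ys] by simp
qed simp

text \<open>Universal property of sorting: every alternating map factors through it. Each step of
  the insertion is an adjacent exchange, whose sign the map reproduces, or meets a repetition, on
  which the map vanishes.\<close>

lemma alternating_signed_sort:
  assumes "alternating P"
  shows "frag_extend P (signed_sort t) = P t"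
  using assms
proof (induction t arbitrary: P)
  case (Cons x t)
  have "frag_extend P (signed_sort (x # t)) = frag_extend (\<lambda>s. P (x # s)) (signed_sort t)"
    by (simp add: frag_extend_extend alternating_signed_insert[OF Cons.prems])
  then show ?case
    using Cons.IH[OF alternating_Cons[OF Cons.prems, of x]] by simp
qed simp

lemma frag_extend_fun_minus: "frag_extend (\<lambda>x. - F x) c = - frag_extend F c"
  using frag_extend_fun_diff[of "\<lambda>x. 0" F c] by (simp add: frag_extend_eq_0)

lemma vertex_less_asym: "vertex_less x y \<Longrightarrow> x \<noteq> y \<and> \<not> vertex_less y x"
  by (metis vertex_less_irrefl vertex_less_trans)

lemma signed_insert_vcone_greater:
  "vertex_less y x \<Longrightarrow> frag_extend (signed_insert x) (vcone y c) = - vcone y (frag_extend (signed_insert x) c)"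
  using vertex_less_asym[of y x] by (auto simp: frag_extend_vcone vcone_frag_extend frag_extend_fun_minus)

lemma signed_insert_vcone_less:
  "vertex_less x y \<Longrightarrow> frag_extend (signed_insert x) (vcone y c) = vcone x (vcone y c)"
  using vertex_less_asym[of x y] by (auto simp: frag_extend_vcone vcone_def frag_extend_extend)

lemma signed_insert_vcone_same: "frag_extend (signed_insert x) (vcone x c) = 0"
  by (simp add: frag_extend_vcone frag_extend_eq_0)

text \<open>The head \<open>y\<close> of the list has five possible positions relative to
  \<open>a\<close> and \<open>b\<close>. In all but the last the insertions are settled at the head;
  if \<open>y\<close> precedes both, each insertion passes it with one sign and the induction
  hypothesis applies to the tail.\<close>

lemma signed_insert_insert_less:
  assumes "vertex_less a b"
  shows "frag_extend (signed_insert a) (signed_insert b s) = - frag_extend (signed_insert b) (signed_insert a s)"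
proof (induction s)
  case Nil
  show ?case
    using assms vertex_less_asym[OF assms] by auto
next
  case (Cons y ys)
  have ba: "a \<noteq> b" "\<not> vertex_less b a"
    using vertex_less_asym[OF assms] by auto
  consider "vertex_less b y" | "b = y" | "vertex_less a y" "vertex_less y b" | "a = y" | "vertex_less y a"
    using vertex_less_total by metis
  then show ?case
  proof cases
    case 1
    then have "vertex_less a y" "a \<noteq> y" "b \<noteq> y"
      using vertex_less_trans[OF assms 1] vertex_less_asym[OF 1] vertex_less_asym[of a y] by auto
    then show ?thesis
      using 1 ba assms by simp
  next
    case 2
    then show ?thesis
      using assms ba by auto
  next
    case 3
    then have "a \<noteq> y" "b \<noteq> y" "\<not> vertex_less b y"
      using vertex_less_asym[OF 3(1)] vertex_less_asym[OF 3(2)] by auto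
    then show ?thesis
      using 3 ba assms by (simp add: frag_extend_minus signed_insert_vcone_less vcone_minus)
  next
    case 4
    then have "b \<noteq> y" "\<not> vertex_less b y"
      using ba by auto
    then show ?thesis
      using 4 by (simp add: frag_extend_minus signed_insert_vcone_same)
  next
    case 5
    then have "vertex_less y b" "a \<noteq> y" "b \<noteq> y" "\<not> vertex_less a y" "\<not> vertex_less b y"
      using vertex_less_trans[OF 5 assms] vertex_less_asym[OF 5] vertex_less_asym[of y b] by auto
    then show ?thesis
      using 5 Cons.IH by (simp add: frag_extend_minus signed_insert_vcone_greater vcone_minus)
  qed
qed

lemma signed_insert_insert_same: "frag_extend (signed_insert a) (signed_insert a s) = 0"
proof (induction s)
  case (Cons y ys)
  consider "a = y" | "a \<noteq> y" "vertex_less a y" | "a \<noteq> y" "\<not> vertex_less a y" "vertex_less y a"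
    using vertex_less_total by metis
  then show ?case
    using Cons.IH by cases (simp_all add: frag_extend_minus signed_insert_vcone_greater)
qed simp

lemma signed_insert_insert:
  "frag_extend (signed_insert a) (signed_insert b s) = - frag_extend (signed_insert b) (signed_insert a s)"
proof (cases "a = b")
  case True
  then show ?thesis by (simp add: signed_insert_insert_same)
next
  case False
  then consider "vertex_less a b" | "vertex_less b a"
    using vertex_less_total by metis
  then show ?thesis
    using signed_insert_insert_less[of a b s] signed_insert_insert_less[of b a s] by cases simp_all
qed

lemma alternating_signed_sort_self: "alternating signed_sort"
  unfolding alternating_def
proof (intro allI)
  fix xs ys :: "'v list" and a b
  show "signed_sort (xs @ a # b # ys) = - signed_sort (xs @ b # a # ys)"
  proof (induction xs)
    case Nil
    have "signed_sort (a # b # ys)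
        = frag_extend (\<lambda>s. - frag_extend (signed_insert b) (signed_insert a s)) (signed_sort ys)"
      by (simp add: frag_extend_extend signed_insert_insert[of a b])
    then show ?case
      by (simp add: frag_extend_extend frag_extend_fun_minus)
  qed (simp add: frag_extend_minus)
qed

text \<open>Exchanging two adjacent entries interchanges the two faces that omit one of them, and
  these occur with opposite signs. In every other face the two entries are still adjacent.\<close>

lemma alternating_boundary:
  assumes "alternating P"
  shows "alternating (\<lambda>t. frag_extend P (tuple_boundary t))"
  unfolding alternating_def
proof (intro allI)
  fix xs ys a b
  show "frag_extend P (tuple_boundary (xs @ a # b # ys)) = - frag_extend P (tuple_boundary (xs @ b # a # ys))"
    using assms
  proof (induction xs arbitrary: P)
    case Nil
    have "frag_extend (\<lambda>t. P (a # b # t)) (tuple_boundary ys) = frag_extend (\<lambda>t. - P (b # a # t)) (tuple_boundary ys)"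
      using alternatingD[OF Nil, of "[]" a b] by (intro frag_extend_eq) simp
    then show ?case
      by (simp add: frag_extend_diff frag_extend_vcone vcone_diff frag_extend_fun_minus)
  next
    case (Cons x xs)
    then show ?case
      using Cons.IH[OF alternating_Cons[OF Cons.prems, of x]] alternatingD[OF Cons.prems, of xs a b ys]
      by (simp add: frag_extend_diff frag_extend_vcone)
  qed
qed

lemma keys_signed_insert:
  assumes "u \<in> Poly_Mapping.keys (signed_insert x s)" "sorted_wrt vertex_less s"
  shows "sorted_wrt vertex_less u \<and> set u = insert x (set s) \<and> length u = Suc (length s)"
  using assms
proof (induction s arbitrary: u)
  case (Cons y ys)
  consider "x = y" | "x \<noteq> y" "vertex_less x y" | "x \<noteq> y" "\<not> vertex_less x y" "vertex_less y x"
    using vertex_less_total by metis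
  then show ?case
  proof cases
    case 2
    then have "u = x # y # ys"
      using Cons.prems by (simp add: keys_frag_of)
    then show ?thesis
      using 2 Cons.prems vertex_less_trans[of x y] by auto
  next
    case 3
    then have "u \<in> Poly_Mapping.keys (vcone y (signed_insert x ys))"
      using Cons.prems by (simp add: keys_minus)
    then obtain v where v: "u = y # v" "v \<in> Poly_Mapping.keys (signed_insert x ys)"
      using keys_vcone[of y "signed_insert x ys"] by blast
    then show ?thesis
      using Cons.IH[OF v(2)] Cons.prems(2) 3 by auto
  qed (use Cons.prems in simp)
qed (simp add: keys_frag_of)

lemma keys_signed_sort:
  "u \<in> Poly_Mapping.keys (signed_sort t) \<Longrightarrow> sorted_wrt vertex_less u \<and> set u = set t \<and> length u = length t"
proof (induction t arbitrary: u)
  case (Cons x t)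
  then obtain s where s: "s \<in> Poly_Mapping.keys (signed_sort t)" "u \<in> Poly_Mapping.keys (signed_insert x s)"
    using keys_frag_extend[of "signed_insert x" "signed_sort t"] by auto
  then show ?case
    using keys_signed_insert[OF s(2)] Cons.IH[OF s(1)] by simp
qed (simp add: keys_frag_of)

lemma sorted_imp_distinct: "sorted_wrt vertex_less u \<Longrightarrow> distinct u"
  by (induction u) (use vertex_less_irrefl in fastforce)+

lemma signed_sort_sorted: "sorted_wrt vertex_less t \<Longrightarrow> signed_sort t = frag_of t"
proof (induction t)
  case (Cons x t)
  then show ?case
    using vertex_less_asym[of x "hd t"] by (cases t) auto
qed simp

lemma frag_extend_signed_sort_sorted:
  assumes "\<And>u. u \<in> Poly_Mapping.keys c \<Longrightarrow> sorted_wrt vertex_less u"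
  shows "frag_extend signed_sort c = c"
proof -
  have "frag_extend signed_sort c = frag_extend frag_of c"
    using assms by (intro frag_extend_eq) (simp add: signed_sort_sorted)
  then show ?thesis
    using frag_expansion[of c] by simp
qed

lemma signed_sort_idem: "frag_extend signed_sort (signed_sort t) = signed_sort t"
  by (rule frag_extend_signed_sort_sorted) (simp add: keys_signed_sort)

lemma sorted_wrt_list_face: "sorted_wrt r t \<Longrightarrow> sorted_wrt r (list_face j t)"
  unfolding list_face_def
  using sorted_wrt_append[of r "take j t" "drop j t"] set_drop_subset_set_drop[of j "Suc j" t]
  by (auto simp: sorted_wrt_append sorted_wrt_drop dest: in_set_dropD)

text \<open>Both sides are alternating in \<open>t\<close>, so by the universal property of sorting
  they need to agree on increasing tuples only. There \<open>t\<close> and all its faces are already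
  sorted.\<close>

lemma boundary_signed_sort:
  "frag_extend tuple_boundary (signed_sort t) = frag_extend signed_sort (tuple_boundary t)"
proof -
  define P where "P = (\<lambda>t::'a list. frag_extend tuple_boundary (signed_sort t))"
  define Q where "Q = (\<lambda>t::'a list. frag_extend signed_sort (tuple_boundary t))"
  have "alternating P"
    unfolding P_def alternating_def
    by (subst alternatingD[OF alternating_signed_sort_self]) (simp add: frag_extend_minus)
  moreover have "alternating Q"
    unfolding Q_def by (rule alternating_boundary[OF alternating_signed_sort_self])
  moreover have "P u = Q u" if "sorted_wrt vertex_less u" for u
  proof -
    have "frag_extend signed_sort (tuple_boundary u) = tuple_boundary u"
      using keys_tuple_boundary[of u] sorted_wrt_list_face[OF that]
      by (intro frag_extend_signed_sort_sorted) blast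
    then show ?thesis
      by (simp add: P_def Q_def signed_sort_sorted[OF that])
  qed
  then have "frag_extend P (signed_sort t) = frag_extend Q (signed_sort t)"
    by (intro frag_extend_eq) (simp add: keys_signed_sort)
  ultimately show ?thesis
    using alternating_signed_sort[of P t] alternating_signed_sort[of Q t] by (simp add: P_def Q_def)
qed

section \<open>Alternating functions under arbitrary permutations\<close>

lemma alternating_move:
  assumes "alternating P"
  shows "P (xs @ a # zs @ ys) = frag_cmul ((-1) ^ length zs) (P (xs @ zs @ a # ys))"
proof (induction zs arbitrary: xs)
  case (Cons z zs)
  have "P (xs @ a # (z # zs) @ ys) = - P ((xs @ [z]) @ a # zs @ ys)"
    using alternatingD[OF assms, of xs a z "zs @ ys"] by simp
  then show ?case
    using Cons.IH[of "xs @ [z]"] by simp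
qed simp

lemma frag_cmul_minus: "frag_cmul k (- c) = frag_cmul (- k) c"
  by (rule poly_mapping_eqI) (simp add: lookup_uminus)

text \<open>With \<open>k\<close> entries in between, moving \<open>a\<close> to the right and
  \<open>b\<close> to the left takes an odd number of adjacent exchanges, 2k + 1 in all.\<close>

lemma alternating_swap:
  assumes "alternating P"
  shows "P (xs @ a # zs @ b # ys) = - P (xs @ b # zs @ a # ys)"
  using alternating_move[OF assms, of xs a zs "b # ys"] alternating_move[OF assms, of xs b zs "a # ys"]
    alternatingD[OF assms, of "xs @ zs" a b ys]
  by (simp add: frag_cmul_minus)

lemma nth_append_two:
  "(xs @ a # zs @ b # ys) ! k =
     (if k < length xs then xs ! k else if k = length xs then a
      else if k < Suc (length xs + length zs) then zs ! (k - Suc (length xs))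
      else if k = Suc (length xs + length zs) then b else ys ! (k - Suc (Suc (length xs + length zs))))"
proof -
  have "k - Suc (length xs) - Suc (length zs) = k - Suc (Suc (length xs + length zs))"
    by simp
  then show ?thesis
    by (simp add: nth_append nth_Cons') (intro conjI impI; simp add: algebra_simps)
qed

lemma permute_list_swap:
  "permute_list (Transposition.transpose (length xs) (Suc (length xs + length zs))) (xs @ a # zs @ b # ys)
    = xs @ b # zs @ a # ys" (is "permute_list ?p ?l = ?r")
proof (rule nth_equalityI)
  have p: "?p permutes {..<length ?l}"
    by (rule permutes_swap_id) auto
  fix i assume "i < length (permute_list ?p ?l)"
  then have i: "i < length ?l"
    by simp
  have "permute_list ?p ?l ! i = ?l ! ?p i"
    by (rule permute_list_nth[OF p i])
  also have "\<dots> = ?r ! i"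
    unfolding nth_append_two Transposition.transpose_def by simp
  finally show "permute_list ?p ?l ! i = ?r ! i" .
qed simp

lemma split_list_two:
  assumes "i < j" "j < length vs"
  obtains xs a zs b ys where "vs = xs @ a # zs @ b # ys" "i = length xs" "j = Suc (length xs + length zs)"
proof -
  define us where "us = drop (Suc i) vs"
  have "vs = take i vs @ vs ! i # us"
    unfolding us_def using assms by (intro id_take_nth_drop) simp
  moreover have "us = take (j - Suc i) us @ us ! (j - Suc i) # drop (Suc (j - Suc i)) us"
    using assms by (intro id_take_nth_drop) (simp add: us_def)
  ultimately have "vs = take i vs @ vs ! i # take (j - Suc i) us @ us ! (j - Suc i) # drop (Suc (j - Suc i)) us"
    by simp
  then show thesis
    using assms by (intro that[of "take i vs" "vs ! i" "take (j - Suc i) us"]) (simp_all add: us_def)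
qed

lemma alternating_transpose:
  assumes P: "alternating P" and "i \<noteq> j" "i < length vs" "j < length vs"
  shows "P (permute_list (Transposition.transpose i j) vs) = - P vs"
proof -
  have main: "P (permute_list (Transposition.transpose i j) vs) = - P vs"
    if lt: "i < j" "j < length vs" for i j
  proof -
    obtain xs a zs b ys where "vs = xs @ a # zs @ b # ys" "i = length xs" "j = Suc (length xs + length zs)"
      using split_list_two[OF lt] .
    then show ?thesis
      using alternating_swap[OF P, of xs a zs b ys] by (simp add: permute_list_swap)
  qed
  show ?thesis
  proof (cases "i < j")
    case False
    then show ?thesis
      using main[of j i] assms by (simp add: transpose_commute)
  qed (use main assms in simp)
qed

text \<open>A permutation is a product of transpositions, each of which contributes a factor -1.
  This connects the adjacent exchanges used here with the relations that define oriented chains,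
  where all permutations occur.\<close>

lemma alternating_permute_list:
  assumes P: "alternating P" and p: "p permutes {..<length vs}"
  shows "P (permute_list p vs) = frag_cmul (sign p) (P vs)"
proof -
  have "\<forall>vs. length vs = n \<longrightarrow> P (permute_list p vs) = frag_cmul (sign p) (P vs)"
    if "p permutes {..<n}" for n p
    using that finite_lessThan[of n]
  proof (induction rule: permutes_induct)
    case (swap a b p)
    have perm: "permutation p" "permutation (Transposition.transpose a b)"
      using swap.hyps by (auto intro: permutes_imp_permutation permutation_swap_id)
    show ?case
    proof (intro allI impI)
      fix vs :: "'a list" assume n: "length vs = n"
      let ?q = "Transposition.transpose a b"
      have "P (permute_list (?q \<circ> p) vs) = P (permute_list p (permute_list ?q vs))"
        using swap.hyps n by (simp add: permute_list_compose)
      also have "\<dots> = frag_cmul (sign p) (- P vs)"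
        using swap n alternating_transpose[OF P swap.hyps(3), of vs] by simp
      finally show "P (permute_list (?q \<circ> p) vs) = frag_cmul (sign (?q \<circ> p)) (P vs)"
        using swap.hyps perm by (simp add: sign_compose sign_swap_id)
          (simp flip: frag_cmul_minus_one)
    qed
  qed simp_all
  then show ?thesis
    using p by blast
qed

section \<open>Orientation relations as the kernel of sorting\<close>

text \<open>Sorting proceeds in the interior of a tuple. With a fixed prefix in front, the
  inductions below can be stated for tails while the relations concern whole tuples.\<close>

definition prefix_chain :: "'v list \<Rightarrow> ('v list \<Rightarrow>\<^sub>0 int) \<Rightarrow> ('v list \<Rightarrow>\<^sub>0 int)" where
  "prefix_chain xs = frag_extend (\<lambda>u. frag_of (xs @ u))"

lemma prefix_chain_simps:
  "prefix_chain xs (frag_of u) = frag_of (xs @ u)"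
  "prefix_chain xs (c - d) = prefix_chain xs c - prefix_chain xs d"
  "prefix_chain xs (c + d) = prefix_chain xs c + prefix_chain xs d"
  "prefix_chain xs (- c) = - prefix_chain xs c"
  "prefix_chain xs (vcone y c) = prefix_chain (xs @ [y]) c"
  "prefix_chain xs (frag_extend F c) = frag_extend (\<lambda>u. prefix_chain xs (F u)) c"
  "prefix_chain [] c = c"
  "prefix_chain xs 0 = 0"
  using frag_expansion[of c]
  by (simp_all add: prefix_chain_def frag_extend_diff frag_extend_add frag_extend_minus frag_extend_vcone frag_extend_extend)

lemma in_ordered_simplicesI:
  "vs \<in> ordered_simplices K n \<Longrightarrow> set us = set vs \<Longrightarrow> length us = length vs \<Longrightarrow> us \<in> ordered_simplices K n"
  by (simp add: ordered_simplices_def card_distinct distinct_card)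

lemma frag_subgroup_orientation_relations: "frag_subgroup (orientation_relations K n)"
  and orientation_relations_keys: "c \<in> orientation_relations K n \<Longrightarrow> Poly_Mapping.keys c \<subseteq> ordered_simplices K n"
proof -
  let ?F = "free_Abelian_group (ordered_simplices K n)"
  interpret group ?F by simp
  have "subgroup (orientation_relations K n) ?F"
    unfolding orientation_relations_def ordered_chain_group_def
  proof (rule generate_is_subgroup, safe)
    fix p vs assume vs: "vs \<in> ordered_simplices K n" and p: "p permutes {..<Suc n}"
    then have "permute_list p vs \<in> ordered_simplices K n"
      by (auto simp: ordered_simplices_def)
    then show "frag_of (permute_list p vs) - frag_cmul (sign p) (frag_of vs) \<in> carrier ?F"
      using vs by (simp only: carrier_free_Abelian_group_iff, intro keys_diff_subset) (auto simp: keys_frag_of)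
  qed
  then interpret R: subgroup "orientation_relations K n" ?F .
  show keys: "Poly_Mapping.keys c \<subseteq> ordered_simplices K n" if "c \<in> orientation_relations K n" for c
    using subsetD[OF R.subset that] by simp
  show "frag_subgroup (orientation_relations K n)"
    unfolding frag_subgroup_def
  proof (intro conjI ballI)
    show "0 \<in> orientation_relations K n"
      using R.one_closed by simp
    fix x y assume "x \<in> orientation_relations K n" "y \<in> orientation_relations K n"
    then show "x - y \<in> orientation_relations K n"
      using R.m_closed[of x "- y"] R.m_inv_closed[of y] keys[of y] by simp
  qed
qed

lemma swap_relation:
  assumes "xs @ a # b # ys \<in> ordered_simplices K n"
  shows "frag_of (xs @ a # b # ys) + frag_of (xs @ b # a # ys) \<in> orientation_relations K n"
proof -
  let ?p = "Transposition.transpose (length xs) (Suc (length xs))"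
  have "length xs < Suc n" "Suc (length xs) < Suc n"
    using assms by (auto simp: ordered_simplices_def)
  then have "?p permutes {..<Suc n}"
    by (intro permutes_swap_id) auto
  then have "frag_of (permute_list ?p (xs @ a # b # ys)) - frag_cmul (sign ?p) (frag_of (xs @ a # b # ys))
      \<in> orientation_relations K n"
    unfolding orientation_relations_def using assms by (intro generate.incl) blast
  then show ?thesis
    using permute_list_swap[of xs "[]" a b ys] by (simp add: sign_swap_id add.commute)
qed

text \<open>One exchange relation carries \<open>x\<close> past \<open>y\<close>, and the remaining
  insertion takes place behind the prefix extended by \<open>y\<close>. Distinctness of the entries
  excludes the case in which insertion yields 0.\<close>

lemma signed_insert_relation:
  assumes "xs @ x # s \<in> ordered_simplices K n"
  shows "prefix_chain xs (frag_of (x # s) - signed_insert x s) \<in> orientation_relations K n"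
  using assms
proof (induction s arbitrary: xs)
  case Nil
  then show ?case
    using frag_subgroup_closed(1)[OF frag_subgroup_orientation_relations] by (simp add: prefix_chain_simps)
next
  case (Cons y ys)
  have "x \<noteq> y"
    using Cons.prems by (auto simp: ordered_simplices_def)
  show ?case
  proof (cases "vertex_less x y")
    case True
    then show ?thesis
      using \<open>x \<noteq> y\<close> frag_subgroup_closed(1)[OF frag_subgroup_orientation_relations]
      by (simp add: prefix_chain_simps)
  next
    case False
    have "(xs @ [y]) @ x # ys \<in> ordered_simplices K n"
      using Cons.prems by (rule in_ordered_simplicesI) auto
    then have "prefix_chain (xs @ [y]) (frag_of (x # ys) - signed_insert x ys) \<in> orientation_relations K n"
      by (rule Cons.IH)
    moreover have "prefix_chain xs (frag_of (x # y # ys) - signed_insert x (y # ys))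
       = (frag_of (xs @ x # y # ys) + frag_of (xs @ y # x # ys))
         - prefix_chain (xs @ [y]) (frag_of (x # ys) - signed_insert x ys)"
      using False \<open>x \<noteq> y\<close> by (simp add: prefix_chain_simps)
    ultimately show ?thesis
      using swap_relation[OF Cons.prems] frag_subgroup_closed(2)[OF frag_subgroup_orientation_relations] by metis
  qed
qed

lemma signed_sort_relation_prefix:
  assumes "xs @ t \<in> ordered_simplices K n"
  shows "prefix_chain xs (frag_of t - signed_sort t) \<in> orientation_relations K n"
  using assms
proof (induction t arbitrary: xs)
  case Nil
  then show ?case
    using frag_subgroup_closed(1)[OF frag_subgroup_orientation_relations] by (simp add: prefix_chain_simps)
next
  case (Cons x t)
  have "prefix_chain (xs @ [x]) (frag_of t - signed_sort t) \<in> orientation_relations K n"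
    using Cons by simp
  moreover have "frag_extend (\<lambda>u. prefix_chain xs (frag_of (x # u) - signed_insert x u)) (signed_sort t)
      \<in> orientation_relations K n"
  proof (intro frag_subgroup_extend frag_subgroup_orientation_relations signed_insert_relation)
    fix u assume "u \<in> Poly_Mapping.keys (signed_sort t)"
    then have "set u = set t" "length u = length t"
      using keys_signed_sort by auto
    then show "xs @ x # u \<in> ordered_simplices K n"
      using Cons.prems by (intro in_ordered_simplicesI[OF Cons.prems]) auto
  qed
  moreover have "prefix_chain xs (frag_of (x # t) - signed_sort (x # t))
      = prefix_chain (xs @ [x]) (frag_of t - signed_sort t)
        + frag_extend (\<lambda>u. prefix_chain xs (frag_of (x # u) - signed_insert x u)) (signed_sort t)"
  proof -
    have "frag_extend (\<lambda>u. frag_of (xs @ x # u)) (signed_sort t) = prefix_chain (xs @ [x]) (signed_sort t)"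
      by (simp add: prefix_chain_def)
    then show ?thesis
      by (simp add: prefix_chain_simps frag_extend_fun_diff)
  qed
  ultimately show ?case
    using frag_subgroup_closed(4)[OF frag_subgroup_orientation_relations] by simp
qed

lemma frag_extend_id_diff: "frag_extend (\<lambda>t. frag_of t - F t) c = c - frag_extend F c"
  using frag_expansion[of c] by (simp add: frag_extend_fun_diff)

text \<open>Sorting is alternating and therefore kills the generators. Conversely, if sorting kills
  \<open>c\<close>, then \<open>c\<close> is the combination of the differences
  \<open>frag_of t - signed_sort t\<close>, each of which is a relation. Equality of oriented chains
  thus becomes equality after sorting.\<close>

lemma orientation_relations_iff:
  "c \<in> orientation_relations K n \<longleftrightarrow>
     Poly_Mapping.keys c \<subseteq> ordered_simplices K n \<and> frag_extend signed_sort c = 0"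
proof
  assume c: "c \<in> orientation_relations K n"
  have "frag_extend signed_sort c = 0 \<and> Poly_Mapping.keys c \<subseteq> ordered_simplices K n"
    using c unfolding orientation_relations_def ordered_chain_group_def
  proof (induction rule: generate.induct)
    case (incl h)
    then have "h \<in> orientation_relations K n"
      unfolding orientation_relations_def ordered_chain_group_def by (rule generate.incl)
    moreover obtain p vs where "h = frag_of (permute_list p vs) - frag_cmul (sign p) (frag_of vs)"
      "vs \<in> ordered_simplices K n" "p permutes {..<Suc n}"
      using incl by blast
    ultimately show ?case
      using alternating_permute_list[OF alternating_signed_sort_self, of p vs] orientation_relations_keys
      by (auto simp: frag_extend_diff frag_extend_cmul ordered_simplices_def)
  next
    case (inv h)
    then have "h \<in> orientation_relations K n"
      unfolding orientation_relations_def ordered_chain_group_def by (rule generate.incl)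
    moreover obtain p vs where "h = frag_of (permute_list p vs) - frag_cmul (sign p) (frag_of vs)"
      "vs \<in> ordered_simplices K n" "p permutes {..<Suc n}"
      using inv by blast
    ultimately have "frag_extend signed_sort h = 0" "Poly_Mapping.keys h \<subseteq> ordered_simplices K n"
      using alternating_permute_list[OF alternating_signed_sort_self, of p vs] orientation_relations_keys
      by (auto simp: frag_extend_diff frag_extend_cmul ordered_simplices_def)
    then show ?case
      by (simp add: frag_extend_minus)
  next
    case (eng h1 h2)
    then show ?case
      using keys_add[of h1 h2] by (auto simp: frag_extend_add)
  qed simp
  then show "Poly_Mapping.keys c \<subseteq> ordered_simplices K n \<and> frag_extend signed_sort c = 0"
    by simp
next
  assume c: "Poly_Mapping.keys c \<subseteq> ordered_simplices K n \<and> frag_extend signed_sort c = 0"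
  then have "c = frag_extend (\<lambda>t. frag_of t - signed_sort t) c"
    by (simp add: frag_extend_id_diff)
  also have "\<dots> \<in> orientation_relations K n"
    using c signed_sort_relation_prefix[of "[]" _ K n]
    by (intro frag_subgroup_extend frag_subgroup_orientation_relations) (auto simp: prefix_chain_simps)
  finally show "c \<in> orientation_relations K n" .
qed

section \<open>Weighted homology compared with the homology of the tuple complex\<close>

lemma rescale_sum: "rescale b k (sum g I) = (\<Sum>i\<in>I. rescale b k (g i))"
  by (induction I rule: infinite_finite_induct) (simp_all add: rescale_add)

lemma rat_weight_floor:
  "\<lfloor>rat_weight asc m / rat_weight asc m'\<rfloor> = int (if asc then m div m' else m' div m)"
  using floor_divide_of_nat_eq[of m m', where 'a = rat] floor_divide_of_nat_eq[of m' m, where 'a = rat]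
  by (simp add: rat_weight_def)

text \<open>The second assumption ties the Boolean to the case distinction of
  \<open>weight_coeff\<close>, which tests for an ascending weight first; a weight of both types is
  therefore treated as ascending.\<close>

locale weighted_chain_complex =
  fixes asc :: bool and K :: "'v set set" and \<mu> :: "'v set \<Rightarrow> nat"
  assumes typed: "typed_weight asc K \<mu>"
    and asc_iff: "asc \<longleftrightarrow> ascending_weight K \<mu>"
begin

abbreviation "w \<equiv> tuple_weight asc \<mu>"
abbreviation "oriented n \<equiv> {c. Poly_Mapping.keys c \<subseteq> ordered_simplices K n}"
abbreviation "bd \<equiv> ordered_boundary K \<mu>"
abbreviation "tbd \<equiv> twisted_boundary (\<lambda>n. w) tuple_differential"
abbreviation "sort_chain \<equiv> frag_extend (signed_sort :: 'v list \<Rightarrow> 'v list \<Rightarrow>\<^sub>0 int)"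
abbreviation "coset n c \<equiv> orientation_relations K n #>\<^bsub>ordered_chain_group K n\<^esub> c"

lemma vc: "vertex_complex K"
  using typed by (simp add: typed_weight_def)

lemma ordered_subset_tuples: "ordered_simplices K n \<subseteq> tuples K n"
  by (auto simp: ordered_simplices_def tuples_def)

text \<open>The coefficients of the weighted boundary are integer quotients of weights, that is,
  floors of the rational ratios by which \<open>twist\<close> multiplies the unweighted
  boundary.\<close>

lemma bd_eq_tbd:
  assumes c: "Poly_Mapping.keys c \<subseteq> ordered_simplices K n"
  shows "bd n c = tbd n c"
proof (cases "n = 0")
  case True
  have "tuple_differential 0 = (\<lambda>t::'v list. 0)"
    by (rule ext) (simp add: tuple_differential_def)
  with True show ?thesis
    by (simp add: ordered_boundary_def twisted_boundary_def twist_zero_fun)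
next
  case False
  have "bd n c = frag_extend (\<lambda>vs. \<Sum>j\<le>n.
      frag_cmul ((-1) ^ j * int (weight_coeff K \<mu> j vs)) (frag_of (list_face j vs))) c"
    using False by (simp add: ordered_boundary_def)
  also have "\<dots> = frag_extend (\<lambda>vs. rescale w (w vs) (tuple_differential n vs)) c"
  proof (rule frag_extend_eq)
    fix vs assume "vs \<in> Poly_Mapping.keys c"
    then have "{..<length vs} = {..n}"
      using c by (auto simp: ordered_simplices_def)
    then show "(\<Sum>j\<le>n. frag_cmul ((-1) ^ j * int (weight_coeff K \<mu> j vs)) (frag_of (list_face j vs)))
        = rescale w (w vs) (tuple_differential n vs)"
      using False asc_iff
      by (simp add: tuple_differential_def tuple_boundary_eq_sum rescale_sum rescale_cmul weight_coeff_def
          tuple_weight_def rat_weight_floor)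
  qed
  finally show ?thesis
    by (simp add: twisted_boundary_def twist_def)
qed

lemma keys_face_oriented:
  assumes "t \<in> ordered_simplices K n" "n \<noteq> 0"
  shows "Poly_Mapping.keys (tuple_boundary t) \<subseteq> ordered_simplices K (n - 1)"
proof
  fix u assume "u \<in> Poly_Mapping.keys (tuple_boundary t)"
  then obtain j where j: "j < length t" "u = list_face j t"
    using keys_tuple_boundary[of t] by blast
  have "distinct u"
    using assms j set_take_disj_set_drop_if_distinct[of t j "Suc j"]
    by (auto simp: list_face_def ordered_simplices_def distinct_take distinct_drop)
  moreover have "u \<in> tuples K (n - 1)"
    using assms j set_list_face[of j t] vc tuples_subset[of K t u "n - 1"]
    by (auto simp: ordered_simplices_def length_list_face)
  ultimately show "u \<in> ordered_simplices K (n - 1)"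
    by (simp add: ordered_simplices_def tuples_def)
qed

lemma keys_bd:
  assumes c: "Poly_Mapping.keys c \<subseteq> ordered_simplices K n"
  shows "Poly_Mapping.keys (bd n c) \<subseteq> ordered_simplices K (n - 1)"
proof (cases "n = 0")
  case False
  show ?thesis
    unfolding bd_eq_tbd[OF c] twisted_boundary_def
    using c keys_face_oriented[OF _ False] False
    by (intro keys_twist_subset) (auto simp: tuple_differential_def)
qed (simp add: ordered_boundary_def)

text \<open>Sorting keeps the set of vertices, so all weight ratios are 1.\<close>

lemma twist_signed_sort:
  assumes c: "Poly_Mapping.keys c \<subseteq> tuples K n"
  shows "twist w w signed_sort c = sort_chain c"
  unfolding twist_def
proof (rule frag_extend_eq)
  fix t assume "t \<in> Poly_Mapping.keys c"
  then have w0: "w t \<noteq> 0"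
    using c based_complexD(1)[OF based_complex_tuples[OF typed], of t n] by blast
  have "rescale w (w t) (signed_sort t) = frag_extend frag_of (signed_sort t)"
    unfolding rescale_def
  proof (rule frag_extend_eq)
    fix u assume "u \<in> Poly_Mapping.keys (signed_sort t)"
    then have "w u = w t"
      using keys_signed_sort[of u t] by (simp add: tuple_weight_def)
    then show "frag_cmul \<lfloor>w t / w u\<rfloor> (frag_of u) = frag_of u"
      using w0 by simp
  qed
  then show "rescale w (w t) (signed_sort t) = signed_sort t"
    using frag_expansion[of "signed_sort t"] by simp
qed

lemma keys_sort_chain:
  assumes c: "Poly_Mapping.keys c \<subseteq> tuples K n"
  shows "Poly_Mapping.keys (sort_chain c) \<subseteq> ordered_simplices K n"
proof (rule keys_extend_subset)
  fix t assume "t \<in> Poly_Mapping.keys c"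
  then show "Poly_Mapping.keys (signed_sort t) \<subseteq> ordered_simplices K n"
    using c keys_signed_sort[of _ t] sorted_imp_distinct
    by (auto simp: tuples_def ordered_simplices_def subset_iff)
qed

lemma fits_signed_sort:
  assumes "t \<in> tuples K n"
  shows "fits w (w t) (signed_sort t)"
proof (rule fits_carried[OF typed])
  fix u assume "u \<in> Poly_Mapping.keys (signed_sort t)"
  then have "set u = set t" "length u = Suc n"
    using assms keys_signed_sort[of u t] by (auto simp: tuples_def)
  then show "u \<noteq> [] \<and> set u \<subseteq> set t"
    by auto
qed (use assms in \<open>simp add: tuples_def\<close>)

lemma tbd_sort_chain:
  assumes c: "Poly_Mapping.keys c \<subseteq> tuples K n"
  shows "tbd n (sort_chain c) = sort_chain (tbd n c)"
proof -
  have C: "based_complex (tuples K) (\<lambda>n. w) tuple_differential"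
    by (rule based_complex_tuples[OF typed])
  have "tbd n (sort_chain c) = twist w w (\<lambda>t. frag_extend (tuple_differential n) (signed_sort t)) c"
    unfolding twist_signed_sort[OF c, symmetric] twisted_boundary_def
  proof (rule twist_twist)
    fix t assume t: "t \<in> Poly_Mapping.keys c"
    then show "fits w (w t) (signed_sort t)"
      using c fits_signed_sort by blast
    fix u assume "u \<in> Poly_Mapping.keys (signed_sort t)"
    then have "u \<in> tuples K n"
      using t c keys_signed_sort[of u t] by (auto simp: tuples_def)
    then show "fits w (w u) (tuple_differential n u)"
      using based_complexD(3)[OF C] by blast
  qed
  also have "\<dots> = twist w w (\<lambda>t. sort_chain (tuple_differential n t)) c"
  proof (rule twist_cong)
    fix t
    show "frag_extend (tuple_differential n) (signed_sort t) = sort_chain (tuple_differential n t)"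
    proof (cases "n = 0")
      case False
      then have "frag_extend (tuple_differential n) (signed_sort t) = frag_extend tuple_boundary (signed_sort t)"
        by (intro frag_extend_eq) (simp add: tuple_differential_def)
      then show ?thesis
        using False by (simp add: boundary_signed_sort tuple_differential_def)
    qed (simp add: tuple_differential_def frag_extend_eq_0)
  qed
  also have "\<dots> = twist w w signed_sort (tbd n c)"
    unfolding twisted_boundary_def
  proof (rule twist_twist[symmetric])
    fix t assume t: "t \<in> Poly_Mapping.keys c"
    then show "fits w (w t) (tuple_differential n t)"
      using c based_complexD(3)[OF C, of t n] by blast
    fix u assume "u \<in> Poly_Mapping.keys (tuple_differential n t)"
    then have "u \<in> tuples K (n - 1)"
      using t c based_complexD(2)[OF C, of t n] by blast
    then show "fits w (w u) (signed_sort u)"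
      by (rule fits_signed_sort)
  qed
  also have "\<dots> = sort_chain (tbd n c)"
    using keys_twisted_boundary[OF C c] by (rule twist_signed_sort)
  finally show ?thesis .
qed

lemma sort_chain_idem: "sort_chain (sort_chain c) = sort_chain c"
  by (simp add: frag_extend_extend signed_sort_idem)

lemma sort_chain_bd:
  assumes c: "c \<in> oriented n"
  shows "sort_chain (bd n c) = tbd n (sort_chain c)"
  using c order_trans[OF _ ordered_subset_tuples, of "Poly_Mapping.keys c" n]
  by (simp add: bd_eq_tbd tbd_sort_chain)

lemma bd_diff: "bd n (c - d) = bd n c - bd n d"
  by (simp add: ordered_boundary_def frag_extend_diff)

text \<open>Cycles and boundaries of the oriented complex, pulled back to ordered chains. With
  relations expressed through sorting, they avoid cosets and serve as a middle term between the two
  homology groups.\<close>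

definition "rel_cycles n = {c \<in> oriented n. sort_chain (bd n c) = 0}"

definition "rel_boundaries n = {c \<in> oriented n. \<exists>b\<in>oriented (Suc n). sort_chain (c - bd (Suc n) b) = 0}"

lemma frag_subgroup_rel_cycles: "frag_subgroup (rel_cycles n)"
  by (simp add: frag_subgroup_def rel_cycles_def keys_diff_subset bd_diff frag_extend_diff ordered_boundary_def)

lemma frag_subgroup_rel_boundaries: "frag_subgroup (rel_boundaries n)"
  unfolding frag_subgroup_def
proof (intro conjI ballI)
  show "0 \<in> rel_boundaries n"
    unfolding rel_boundaries_def by (auto intro!: bexI[of _ 0] simp: ordered_boundary_def)
  fix x y assume "x \<in> rel_boundaries n" "y \<in> rel_boundaries n"
  then obtain b b' where b: "x \<in> oriented n" "y \<in> oriented n" "b \<in> oriented (Suc n)" "b' \<in> oriented (Suc n)"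
    "sort_chain (x - bd (Suc n) b) = 0" "sort_chain (y - bd (Suc n) b') = 0"
    unfolding rel_boundaries_def by blast
  then have "sort_chain (x - y - bd (Suc n) (b - b')) = 0"
    by (simp add: frag_extend_diff bd_diff)
  then show "x - y \<in> rel_boundaries n"
    using b unfolding rel_boundaries_def
    by (intro CollectI conjI bexI[of _ "b - b'"]) (simp_all add: keys_diff_subset)
qed

lemma rel_boundaries_subset: "rel_boundaries n \<subseteq> rel_cycles n"
proof
  fix c assume "c \<in> rel_boundaries n"
  then obtain b where c: "c \<in> oriented n" and b: "b \<in> oriented (Suc n)" and "sort_chain (c - bd (Suc n) b) = 0"
    unfolding rel_boundaries_def by blast
  then have "sort_chain c = sort_chain (bd (Suc n) b)"
    by (simp add: frag_extend_diff)
  also have "\<dots> = tbd (Suc n) (sort_chain b)"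
    using b by (rule sort_chain_bd)
  finally have "sort_chain (bd n c) = tbd n (tbd (Suc n) (sort_chain b))"
    using c by (simp add: sort_chain_bd)
  also have "\<dots> = 0"
    using twisted_boundary_boundary[OF based_complex_tuples[OF typed], of "sort_chain b" "Suc n"]
      keys_sort_chain[of b "Suc n"] b ordered_subset_tuples[of "Suc n"] by auto
  finally show "c \<in> rel_cycles n"
    using c by (simp add: rel_cycles_def)
qed

text \<open>The isomorphism is induced by sorting, an idempotent chain map that is homotopic to the
  identity on tuples; the homotopy gives surjectivity, idempotence the reflection of
  boundaries.\<close>

lemma rel_homology_iso_tuples:
  "frag_group (rel_cycles n) Mod rel_boundaries n
    \<cong> twisted_homology (tuples K) (\<lambda>n. w) tuple_differential n"
  unfolding twisted_homology_def
proof (rule quotient_iso_criterion)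
  let ?Z = "twisted_cycles (tuples K) (\<lambda>n. w) tuple_differential n"
  let ?B = "twisted_boundaries (tuples K) (\<lambda>n. w) tuple_differential n"
  have C: "based_complex (tuples K) (\<lambda>n. w) tuple_differential"
    by (rule based_complex_tuples[OF typed])
  have T: "Poly_Mapping.keys (sort_chain c) \<subseteq> tuples K m" if "Poly_Mapping.keys c \<subseteq> tuples K m" for c m
    using keys_sort_chain[OF that] ordered_subset_tuples by blast
  have O: "Poly_Mapping.keys c \<subseteq> tuples K m" if "c \<in> oriented m" for c m
    using that ordered_subset_tuples by blast
  show "comm_group (frag_group (rel_cycles n))" "comm_group (frag_group ?Z)"
    "subgroup (rel_boundaries n) (frag_group (rel_cycles n))" "subgroup ?B (frag_group ?Z)"
    by (intro comm_group_frag_group subgroup_frag_group frag_subgroup_rel_cycles frag_subgroup_rel_boundaries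
        frag_subgroup_twisted_cycles frag_subgroup_twisted_boundaries rel_boundaries_subset
        twisted_boundaries_subset_cycles C)+
  have cyc: "sort_chain c \<in> ?Z" if "c \<in> rel_cycles n" for c
    using that sort_chain_bd[of c n] T[OF O, of c n] by (auto simp: rel_cycles_def twisted_cycles_def)
  then show "sort_chain \<in> hom (frag_group (rel_cycles n)) (frag_group ?Z)"
    by (auto simp: hom_def frag_extend_add)
  show "sort_chain c \<in> ?B \<longleftrightarrow> c \<in> rel_boundaries n" if "c \<in> carrier (frag_group (rel_cycles n))" for c
  proof
    have c: "c \<in> oriented n"
      using that by (simp add: rel_cycles_def)
    show "sort_chain c \<in> ?B" if cb: "c \<in> rel_boundaries n"
    proof -
      obtain b where b: "b \<in> oriented (Suc n)" "sort_chain (c - bd (Suc n) b) = 0"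
        using cb unfolding rel_boundaries_def by blast
      then have "sort_chain c = tbd (Suc n) (sort_chain b)"
        using sort_chain_bd[OF b(1)] by (simp add: frag_extend_diff)
      then show ?thesis
        using T[OF O[OF b(1)]] unfolding twisted_boundaries_def by auto
    qed
    show "c \<in> rel_boundaries n" if cb: "sort_chain c \<in> ?B"
    proof -
      obtain y where y: "Poly_Mapping.keys y \<subseteq> tuples K (Suc n)" "sort_chain c = tbd (Suc n) y"
        using cb unfolding twisted_boundaries_def by blast
      \<comment> \<open>The chain \<open>y\<close> may contain tuples with repetitions; its sorted
        version does not, and it bounds the same chain because \<open>sort_chain c\<close> is fixed
        by sorting.\<close>
      have "sort_chain (c - bd (Suc n) (sort_chain y)) = 0"
        using keys_sort_chain[OF y(1)] sort_chain_bd[of "sort_chain y" "Suc n"] y(2) tbd_sort_chain[OF y(1)]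
        by (simp add: frag_extend_diff sort_chain_idem) (metis sort_chain_idem)
      then show ?thesis
        using c keys_sort_chain[OF y(1)] unfolding rel_boundaries_def by blast
    qed
  qed
  show "\<exists>x\<in>carrier (frag_group (rel_cycles n)). \<exists>b\<in>?B. y = b \<otimes>\<^bsub>frag_group ?Z\<^esub> sort_chain x"
    if "y \<in> carrier (frag_group ?Z)" for y
  proof -
    have y: "Poly_Mapping.keys y \<subseteq> tuples K n" "tbd n y = 0" "y \<in> ?Z"
      using that by (auto simp: twisted_cycles_def)
    have "twist w w signed_sort y - y \<in> ?B"
      using y(3) keys_signed_sort
      by (intro carried_chain_map_homotopic[OF typed] boundary_signed_sort) (auto simp: subset_iff)
    then have "y - sort_chain y \<in> ?B"
      using frag_subgroup_closed(3)[OF frag_subgroup_twisted_boundaries] twist_signed_sort[OF y(1)] by force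
    moreover have "sort_chain y \<in> rel_cycles n"
      using keys_sort_chain[OF y(1)] sort_chain_bd[of "sort_chain y" n] tbd_sort_chain[OF y(1)] y(2)
      by (simp add: rel_cycles_def sort_chain_idem)
    ultimately show ?thesis
      by (intro bexI[of _ "sort_chain y"] bexI[of _ "y - sort_chain y"]) (simp_all add: sort_chain_idem)
  qed
qed

lemma coset_eq_iff:
  assumes "c \<in> oriented n" "d \<in> oriented n"
  shows "coset n c = coset n d \<longleftrightarrow> sort_chain (c - d) = 0"
proof -
  let ?R = "orientation_relations K n"
  note R = frag_subgroup_closed[OF frag_subgroup_orientation_relations[of K n]]
  have co: "coset n c = (\<lambda>r. r + c) ` ?R" for c
    by (auto simp: r_coset_def ordered_chain_group_def)
  have "coset n c = coset n d \<longleftrightarrow> c - d \<in> ?R"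
  proof
    assume "coset n c = coset n d"
    then have "c \<in> (\<lambda>r. r + d) ` ?R"
      unfolding co using R(1) by (metis add_0 image_eqI)
    then show "c - d \<in> ?R"
      by auto
  next
    assume *: "c - d \<in> ?R"
    show "coset n c = coset n d"
      unfolding co
    proof (intro equalityI subsetI)
      fix x assume "x \<in> (\<lambda>r. r + c) ` ?R"
      then obtain r where "r \<in> ?R" "x = r + c" by blast
      then show "x \<in> (\<lambda>r. r + d) ` ?R"
        using R(4)[OF _ *, of r] by (intro image_eqI[of _ _ "r + (c - d)"]) simp_all
    next
      fix x assume "x \<in> (\<lambda>r. r + d) ` ?R"
      then obtain r where "r \<in> ?R" "x = r + d" by blast
      then show "x \<in> (\<lambda>r. r + c) ` ?R"
        using R(2)[OF _ *, of r] by (intro image_eqI[of _ _ "r - (c - d)"]) simp_all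
    qed
  qed
  then show ?thesis
    using assms by (simp add: orientation_relations_iff keys_diff_subset)
qed

lemma oriented_add:
  assumes "c \<in> oriented n" "d \<in> oriented n"
  shows "c + d \<in> oriented n"
  using assms keys_add[of c d] by auto

text \<open>The union in the definition of \<open>weighted_boundary\<close> collapses to one coset:
  sorting commutes with the boundary, so the boundary of a relation is again a relation.\<close>

lemma weighted_boundary_coset:
  assumes c: "c \<in> oriented n"
  shows "weighted_boundary K \<mu> n (coset n c) = coset (n - 1) (bd n c)"
proof -
  have "coset (n - 1) (bd n x) = coset (n - 1) (bd n c)" if x: "x \<in> coset n c" for x
  proof -
    obtain r where r: "r \<in> orientation_relations K n" "x = r + c"
      using x by (auto simp: r_coset_def ordered_chain_group_def)
    then have ro: "r \<in> oriented n" and r0: "sort_chain r = 0"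
      by (simp_all add: orientation_relations_iff)
    have x: "x \<in> oriented n"
      unfolding r(2) using ro c by (rule oriented_add)
    have "sort_chain (bd n x - bd n c) = sort_chain (bd n r)"
      using r(2) bd_diff[of n x c] by simp
    also have "\<dots> = 0"
      using ro r0 by (simp add: sort_chain_bd)
    finally show ?thesis
      using keys_bd[of x n] keys_bd[of c n] x c by (intro coset_eq_iff[THEN iffD2]) simp_all
  qed
  moreover have "c \<in> coset n c"
    using frag_subgroup_closed(1)[OF frag_subgroup_orientation_relations[of K n]]
    by (force simp: r_coset_def ordered_chain_group_def)
  ultimately show ?thesis
    unfolding weighted_boundary_def by blast
qed

lemma normal_relations: "orientation_relations K n \<lhd> ordered_chain_group K n"
proof -
  interpret comm_group "ordered_chain_group K n"
    unfolding ordered_chain_group_def by (rule abelian_free_Abelian_group)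
  have gens: "{frag_of (permute_list p vs) - frag_cmul (sign p) (frag_of vs) |p vs.
          vs \<in> ordered_simplices K n \<and> p permutes {..<Suc n}} \<subseteq> carrier (ordered_chain_group K n)"
  proof
    fix x assume x: "x \<in> {frag_of (permute_list p vs) - frag_cmul (sign p) (frag_of vs) |p vs.
          vs \<in> ordered_simplices K n \<and> p permutes {..<Suc n}}"
    then have "x \<in> orientation_relations K n"
      unfolding orientation_relations_def by (rule generate.incl)
    then show "x \<in> carrier (ordered_chain_group K n)"
      using orientation_relations_keys by (auto simp: ordered_chain_group_def)
  qed
  show ?thesis
    unfolding orientation_relations_def by (intro subgroup_imp_normal generate_is_subgroup gens)
qed

lemma comm_group_oriented: "comm_group (oriented_chain_group K n)"
proof -
  interpret comm_group "ordered_chain_group K n"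
    unfolding ordered_chain_group_def by (rule abelian_free_Abelian_group)
  show ?thesis
    unfolding oriented_chain_group_def
    by (rule abelian_FactGroup) (rule normal_imp_subgroup[OF normal_relations])
qed

lemma carrier_oriented: "carrier (oriented_chain_group K n) = coset n ` oriented n"
  by (auto simp: oriented_chain_group_def carrier_FactGroup ordered_chain_group_def)

lemma mult_oriented:
  "c \<in> oriented n \<Longrightarrow> d \<in> oriented n \<Longrightarrow>
     coset n c \<otimes>\<^bsub>oriented_chain_group K n\<^esub> coset n d = coset n (c + d)"
  using normal.rcos_sum[OF normal_relations, of c n d]
  by (simp add: oriented_chain_group_def ordered_chain_group_def)

lemma one_oriented: "\<one>\<^bsub>oriented_chain_group K n\<^esub> = coset n 0"
  by (auto simp: oriented_chain_group_def r_coset_def ordered_chain_group_def)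

lemma bd_add: "bd n (c + d) = bd n c + bd n d"
  by (simp add: ordered_boundary_def frag_extend_add)

lemma weighted_boundary_hom:
  "group_hom (oriented_chain_group K n) (oriented_chain_group K (n - 1)) (weighted_boundary K \<mu> n)"
proof -
  have "weighted_boundary K \<mu> n \<in> hom (oriented_chain_group K n) (oriented_chain_group K (n - 1))"
  proof (rule homI)
    fix A assume "A \<in> carrier (oriented_chain_group K n)"
    then obtain c where c: "c \<in> oriented n" "A = coset n c"
      by (auto simp: carrier_oriented)
    then show "weighted_boundary K \<mu> n A \<in> carrier (oriented_chain_group K (n - 1))"
      using keys_bd by (simp add: weighted_boundary_coset carrier_oriented)
    fix A' assume "A' \<in> carrier (oriented_chain_group K n)"
    then obtain d where d: "d \<in> oriented n" "A' = coset n d"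
      by (auto simp: carrier_oriented)
    then show "weighted_boundary K \<mu> n (A \<otimes>\<^bsub>oriented_chain_group K n\<^esub> A')
        = weighted_boundary K \<mu> n A \<otimes>\<^bsub>oriented_chain_group K (n - 1)\<^esub> weighted_boundary K \<mu> n A'"
      using c oriented_add[OF c(1) d(1)] keys_bd[of c n] keys_bd[of d n]
        weighted_boundary_coset[OF c(1)] weighted_boundary_coset[OF d(1)]
        weighted_boundary_coset[OF oriented_add[OF c(1) d(1)]]
        mult_oriented[OF c(1) d(1)] mult_oriented[of "bd n c" "n - 1" "bd n d"]
      by (simp add: bd_add)
  qed
  then show ?thesis
    using comm_group_oriented by (simp add: group_hom_def group_hom_axioms_def comm_group_def)
qed

lemma coset_eq_one_iff:
  "c \<in> oriented n \<Longrightarrow> coset n c = \<one>\<^bsub>oriented_chain_group K n\<^esub> \<longleftrightarrow> sort_chain c = 0"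
  using coset_eq_iff[of c n 0] by (simp add: one_oriented)

lemma weighted_cycles_eq: "weighted_cycles K \<mu> n = coset n ` rel_cycles n"
proof -
  have "weighted_boundary K \<mu> n (coset n c) = \<one>\<^bsub>oriented_chain_group K (n - 1)\<^esub> \<longleftrightarrow> c \<in> rel_cycles n"
    if "c \<in> oriented n" for c
    using that keys_bd[of c n] by (simp add: weighted_boundary_coset coset_eq_one_iff rel_cycles_def)
  then show ?thesis
    unfolding weighted_cycles_def kernel_def carrier_oriented by (auto simp: rel_cycles_def)
qed

text \<open>Passing to cosets maps \<open>rel_cycles\<close> onto the weighted cycles, and a coset
  lies in the image of the boundary exactly if its representatives are boundaries up to
  relations.\<close>

lemma weighted_homology_iso_rel_homology:
  "frag_group (rel_cycles n) Mod rel_boundaries n \<cong> weighted_homology K \<mu> n"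
  unfolding weighted_homology_def
proof (rule quotient_iso_criterion)
  let ?C = "oriented_chain_group K n"
  let ?G = "subgroup_generated ?C (weighted_cycles K \<mu> n)"
  let ?N = "weighted_boundary K \<mu> (Suc n) ` carrier (oriented_chain_group K (Suc n))"
  interpret C: comm_group ?C
    by (rule comm_group_oriented)
  interpret b: group_hom "oriented_chain_group K (Suc n)" ?C "weighted_boundary K \<mu> (Suc n)"
    using weighted_boundary_hom[of "Suc n"] by simp
  have Z: "subgroup (weighted_cycles K \<mu> n) ?C"
    unfolding weighted_cycles_def by (rule group_hom.subgroup_kernel[OF weighted_boundary_hom])
  have car: "carrier ?G = weighted_cycles K \<mu> n"
    by (rule subgroup.carrier_subgroup_generated_subgroup[OF Z])
  have N: "?N = coset n ` bd (Suc n) ` oriented (Suc n)"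
    unfolding carrier_oriented by (auto simp: weighted_boundary_coset image_image intro!: image_eqI)
  have mem: "coset n c \<in> ?N \<longleftrightarrow> c \<in> rel_boundaries n" if "c \<in> oriented n" for c
  proof -
    have "coset n c = coset n (bd (Suc n) b) \<longleftrightarrow> sort_chain (c - bd (Suc n) b) = 0" if "b \<in> oriented (Suc n)" for b
      using that keys_bd[of b "Suc n"] \<open>c \<in> oriented n\<close> by (intro coset_eq_iff) simp_all
    moreover have "coset n c \<in> ?N \<longleftrightarrow> (\<exists>b\<in>oriented (Suc n). coset n c = coset n (bd (Suc n) b))"
      unfolding N by blast
    ultimately show ?thesis
      using that unfolding rel_boundaries_def by blast
  qed
  show "comm_group (frag_group (rel_cycles n))" "subgroup (rel_boundaries n) (frag_group (rel_cycles n))"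
    by (intro comm_group_frag_group subgroup_frag_group frag_subgroup_rel_cycles frag_subgroup_rel_boundaries
        rel_boundaries_subset)+
  show "comm_group ?G"
    by (rule C.abelian_subgroup_generated) (rule comm_group_oriented)
  have "?N \<subseteq> weighted_cycles K \<mu> n"
  proof
    fix A assume A: "A \<in> ?N"
    then obtain c where "c \<in> oriented n" "A = coset n c"
      unfolding N using keys_bd[of _ "Suc n"] by auto
    then show "A \<in> weighted_cycles K \<mu> n"
      using A mem rel_boundaries_subset[of n] by (auto simp: weighted_cycles_eq)
  qed
  then show "subgroup ?N ?G"
    using b.img_is_subgroup by (simp add: C.subgroup_of_subgroup_generated)
  show "coset n \<in> hom (frag_group (rel_cycles n)) ?G"
  proof (rule homI)
    fix x assume x: "x \<in> carrier (frag_group (rel_cycles n))"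
    then show "coset n x \<in> carrier ?G"
      unfolding car by (simp add: weighted_cycles_eq)
    fix y assume "y \<in> carrier (frag_group (rel_cycles n))"
    with x show "coset n (x \<otimes>\<^bsub>frag_group (rel_cycles n)\<^esub> y) = coset n x \<otimes>\<^bsub>?G\<^esub> coset n y"
      by (simp add: rel_cycles_def mult_oriented)
  qed
  show "coset n c \<in> ?N \<longleftrightarrow> c \<in> rel_boundaries n" if "c \<in> carrier (frag_group (rel_cycles n))" for c
    using that by (intro mem) (simp add: rel_cycles_def)
  show "\<exists>c\<in>carrier (frag_group (rel_cycles n)). \<exists>B\<in>?N. A = B \<otimes>\<^bsub>?G\<^esub> coset n c" if A: "A \<in> carrier ?G" for A
  proof -
    obtain c where c: "c \<in> rel_cycles n" "A = coset n c"
      using A unfolding car by (auto simp: weighted_cycles_eq)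
    have "\<one>\<^bsub>?C\<^esub> \<in> ?N"
      using b.img_is_subgroup by (rule subgroup.one_closed)
    moreover have "A \<in> carrier ?C"
      using c by (auto simp: carrier_oriented rel_cycles_def)
    ultimately show ?thesis
      using c by (intro bexI[of _ c] bexI[of _ "\<one>\<^bsub>?C\<^esub>"]) simp_all
  qed
qed

lemma group_rel_homology: "group (frag_group (rel_cycles n) Mod rel_boundaries n)"
proof -
  interpret comm_group "frag_group (rel_cycles n)"
    by (rule comm_group_frag_group[OF frag_subgroup_rel_cycles])
  show ?thesis
    by (intro normal.factorgroup_is_group subgroup_imp_normal subgroup_frag_group frag_subgroup_rel_cycles
        frag_subgroup_rel_boundaries rel_boundaries_subset)
qed

theorem weighted_homology_iso_tuples:
  "weighted_homology K \<mu> n \<cong> twisted_homology (tuples K) (\<lambda>n. w) tuple_differential n"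
  using group.iso_sym[OF group_rel_homology weighted_homology_iso_rel_homology] rel_homology_iso_tuples
  by (rule iso_trans)

theorem tuples_iso_weighted_homology:
  "twisted_homology (tuples K) (\<lambda>n. w) tuple_differential n \<cong> weighted_homology K \<mu> n"
  using group.iso_sym[OF group_rel_homology rel_homology_iso_tuples] weighted_homology_iso_rel_homology
  by (rule iso_trans)

end

section \<open>A natural prism operator\<close>

abbreviation simplex_space :: "nat \<Rightarrow> (nat \<Rightarrow> real) topology" where
  "simplex_space p \<equiv> subtopology (powertop_real UNIV) (standard_simplex p)"

abbreviation cylinder :: "nat \<Rightarrow> (real \<times> (nat \<Rightarrow> real)) topology" where
  "cylinder p \<equiv> prod_topology (top_of_set {0..1}) (simplex_space p)"

abbreviation identity_simplex :: "nat \<Rightarrow> (nat \<Rightarrow> real) \<Rightarrow> (nat \<Rightarrow> real)" where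
  "identity_simplex p \<equiv> restrict id (standard_simplex p)"

lemma continuous_map_coordinate:
  "continuous_map (simplex_space p) euclideanreal (\<lambda>y. y k)"
  by (intro continuous_map_from_subtopology continuous_map_product_projection) simp

lemma contractible_simplex_space: "contractible_space (simplex_space p)"
proof -
  define e :: "nat \<Rightarrow> real" where "e = (\<lambda>j. if j = 0 then 1 else 0)"
  define h where "h = (\<lambda>(s::real, y). \<lambda>i. (1 - s) * y i + s * e i)"
  have e: "e \<in> standard_simplex p"
    by (simp add: e_def)
  have "continuous_map (cylinder p) (simplex_space p) h"
    unfolding continuous_map_in_subtopology
  proof
    show "continuous_map (cylinder p) (powertop_real UNIV) h"
      unfolding continuous_map_componentwise_UNIV
    proof
      fix k
      have 1: "continuous_map (cylinder p) euclideanreal fst"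
        using continuous_map_fst[of "top_of_set {0..1::real}" "simplex_space p"]
        by (simp add: continuous_map_in_subtopology)
      have 2: "continuous_map (cylinder p) euclideanreal (\<lambda>z. snd z k)"
        using continuous_map_compose[OF continuous_map_snd continuous_map_coordinate] by (simp add: o_def)
      show "continuous_map (cylinder p) euclideanreal (\<lambda>z. h z k)"
        unfolding h_def case_prod_unfold
        by (intro continuous_map_add continuous_map_real_mult continuous_map_diff 1 2) auto
    qed
    show "h \<in> topspace (cylinder p) \<rightarrow> standard_simplex p"
      unfolding h_def using e by (auto intro!: convex_standard_simplex)
  qed
  then have "homotopic_with (\<lambda>x. True) (simplex_space p) (simplex_space p) id (\<lambda>x. e)"
    unfolding homotopic_with_def by (intro exI[of _ h]) (auto simp: h_def)
  then show ?thesis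
    unfolding contractible_space_def by blast
qed

text \<open>The identity is homotopic to a constant map, so the cycle is homologous to its image in
  a one-point space. There cycles of positive degree bound; in degree 0 the third hypothesis takes
  over, since it says that the coefficients add up to zero.\<close>

lemma contractible_cycle_is_boundary:
  fixes X :: "'x topology"
  assumes X: "contractible_space X" and c: "singular_relcycle p X {} c"
    and "1 \<le> p \<or> (\<forall>a::'x. chain_map p (\<lambda>x. a) c = 0)"
  shows "singular_relboundary p X {} c"
proof (cases "topspace X = {}")
  case True
  then have "c = 0"
    using c by (auto simp: singular_relcycle_def singular_chain_empty)
  then show ?thesis by simp
next
  case False
  obtain a where a: "homotopic_with (\<lambda>x. True) X X id (\<lambda>x. a)"
    using X unfolding contractible_space_def by blast
  then have cont: "continuous_map X X (\<lambda>x. a)"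
    using homotopic_with_imp_continuous_maps by blast
  then have aX: "a \<in> topspace X"
    using False by auto
  have "homotopic_with (\<lambda>h. h \<in> {} \<rightarrow> {}) X X id (\<lambda>x. a)"
    using a by simp
  then have "homologous_rel p X {} (chain_map p id c) (chain_map p (\<lambda>x. a) c)"
    using c by (rule homotopic_imp_homologous_rel_chain_maps)
  moreover have "chain_map p id c = c"
    using c by (intro chain_map_ident[of p X]) (simp add: singular_relcycle_def)
  moreover have "singular_relboundary p X {} (chain_map p (\<lambda>x. a) c)"
  proof (cases "1 \<le> p")
    case True
    have "continuous_map X (subtopology X {a}) (\<lambda>x. a)"
      using cont by (simp add: continuous_map_in_subtopology)
    then have "singular_relcycle p (subtopology X {a}) {} (chain_map p (\<lambda>x. a) c)"
      using c by (intro singular_relcycle_chain_map[of p X "{}"]) auto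
    then have "singular_relboundary p (subtopology X {a}) {} (chain_map p (\<lambda>x. a) c)"
      using True aX by (subst singular_boundary_eq_cycle_singleton[of _ a]) auto
    then show ?thesis
      unfolding singular_boundary
      using singular_chain_subtopology by blast
  next
    case False
    then have "chain_map p (\<lambda>x. a) c = 0"
      using assms(3) by blast
    then show ?thesis by simp
  qed
  ultimately have "singular_relboundary p X {} (c - chain_map p (\<lambda>x. a) c + chain_map p (\<lambda>x. a) c)"
    unfolding homologous_rel_def by (intro singular_relboundary_add) simp_all
  then show ?thesis by simp
qed

text \<open>The model chain \<open>q\<close> is pushed along the product of the identity of the
  interval with \<open>f\<close>. Naturality is built in, so an identity checked for the identity
  simplex passes to every \<open>f\<close>.\<close>

definition cylinder_chain ::
  "nat \<Rightarrow> (real \<times> (nat \<Rightarrow> real)) chain \<Rightarrow> 'x chain \<Rightarrow> (real \<times> 'x) chain" where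
  "cylinder_chain n q = frag_extend (\<lambda>f. chain_map (Suc n) (apsnd f) q)"

text \<open>The chain \<open>q\<close> plays the role of the triangulated prism over the identity simplex. No formula for
  it is needed: the cylinder is contractible, so the cycle that \<open>q\<close> has to bound is a boundary.\<close>

definition prism_step ::
  "nat \<Rightarrow> (real \<times> (nat \<Rightarrow> real)) chain \<Rightarrow> (real \<times> (nat \<Rightarrow> real)) chain \<Rightarrow> bool" where
  "prism_step n q' q \<longleftrightarrow> singular_chain (Suc n) (cylinder n) q \<and>
     (n \<noteq> 0 \<longrightarrow> singular_chain n (cylinder (n - 1)) q') \<and>
     chain_boundary (Suc n) q = chain_map n (Pair 1) (frag_of (identity_simplex n))
       - chain_map n (Pair 0) (frag_of (identity_simplex n))
       - cylinder_chain (n - 1) q' (chain_boundary n (frag_of (identity_simplex n)))"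

lemma apsnd_Pair: "apsnd f \<circ> Pair t = Pair t \<circ> f"
  by (simp add: fun_eq_iff)

lemma singular_simplex_identity: "singular_simplex p (simplex_space p) (identity_simplex p)"
  unfolding singular_simplex_def by (auto simp: continuous_map_in_subtopology intro: continuous_map_eq[of _ _ id])

text \<open>The two maps agree only over the standard simplex, because singular simplices are
  \<open>undefined\<close> elsewhere. That suffices for chains of the cylinder.\<close>

lemma chain_map_apsnd_face:
  assumes f: "singular_simplex n X f" and n: "n \<noteq> 0" "k \<le> n"
    and q: "singular_chain n (cylinder (n - 1)) q"
  shows "chain_map n (apsnd f) (chain_map n (apsnd (singular_face n k (identity_simplex n))) q)
    = chain_map n (apsnd (singular_face n k f)) q"
proof -
  have "chain_map n (apsnd f) (chain_map n (apsnd (singular_face n k (identity_simplex n))) q)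
      = chain_map n (apsnd f \<circ> apsnd (singular_face n k (identity_simplex n))) q"
    by (simp add: chain_map_compose)
  also have "\<dots> = chain_map n (apsnd (singular_face n k f)) q"
  proof (rule chain_map_eq[OF q])
    fix z assume "z \<in> topspace (cylinder (n - 1))"
    then have "snd z \<in> standard_simplex (n - Suc 0)"
      by auto
    moreover from this have "simplical_face k (snd z) \<in> standard_simplex n"
      using n by (intro simplical_face_in_standard_simplex) auto
    ultimately show "(apsnd f \<circ> apsnd (singular_face n k (identity_simplex n))) z = apsnd (singular_face n k f) z"
      by (simp add: singular_face_def prod_eq_iff)
  qed
  finally show ?thesis .
qed

lemma cylinder_chain_boundary:
  assumes s: "prism_step n q' q" and c: "singular_chain n X c"
  shows "chain_boundary (Suc n) (cylinder_chain n q c)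
    = chain_map n (Pair 1) c - chain_map n (Pair 0) c - cylinder_chain (n - 1) q' (chain_boundary n c)"
  using c unfolding singular_chain_def
proof (induction c rule: frag_induction)
  case (one f)
  then have f: "singular_simplex n X f"
    by simp
  have q: "singular_chain (Suc n) (cylinder n) q"
    using s by (simp add: prism_step_def)
  have ends: "chain_map n (apsnd f) (chain_map n (Pair t) (frag_of (identity_simplex n))) = chain_map n (Pair t) (frag_of f)" for t :: real
  proof -
    have "chain_map n (apsnd f) (chain_map n (Pair t) (frag_of (identity_simplex n)))
        = chain_map n (Pair t) (chain_map n f (frag_of (identity_simplex n)))"
      by (metis apsnd_Pair chain_map_compose comp_apply)
    then show ?thesis
      by (simp only: singular_simplex_chain_map_id[OF f])
  qed
  have sides: "chain_map n (apsnd f) (cylinder_chain (n - 1) q' (chain_boundary n (frag_of (identity_simplex n))))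
      = cylinder_chain (n - 1) q' (chain_boundary n (frag_of f))"
  proof (cases "n = 0")
    case False
    then have q': "singular_chain n (cylinder (n - 1)) q'"
      using s by (simp add: prism_step_def)
    show ?thesis
      using False chain_map_apsnd_face[OF f False _ q']
      by (simp add: cylinder_chain_def chain_boundary_of frag_extend_sum frag_extend_cmul chain_map_sum
          del: restrict_apply)
  qed (simp add: chain_boundary_of cylinder_chain_def)
  have "chain_boundary (Suc n) (cylinder_chain n q (frag_of f)) = chain_map n (apsnd f) (chain_boundary (Suc n) q)"
    using chain_boundary_chain_map[OF q, of "apsnd f"] by (simp add: cylinder_chain_def)
  also have "\<dots> = chain_map n (Pair 1) (frag_of f) - chain_map n (Pair 0) (frag_of f)
      - cylinder_chain (n - 1) q' (chain_boundary n (frag_of f))"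
    using s ends sides by (simp only: prism_step_def chain_map_diff)
  finally show ?case .
qed (simp_all add: cylinder_chain_def frag_extend_diff chain_boundary_diff chain_map_diff)

lemma continuous_map_cylinder:
  assumes "continuous_map (simplex_space p) (simplex_space m) f"
  shows "continuous_map (cylinder p) (cylinder m) (apsnd f)"
proof -
  have "apsnd f = (\<lambda>z. (fst z, f (snd z)))"
    by (auto simp: fun_eq_iff)
  then show ?thesis
    using continuous_map_compose[OF continuous_map_snd assms]
    by (simp add: continuous_map_pairwise o_def continuous_map_fst)
qed

lemma singular_cylinder_chain:
  assumes q: "singular_chain (Suc n) (cylinder n) q" and c: "singular_chain n (simplex_space m) c"
  shows "singular_chain (Suc n) (cylinder m) (cylinder_chain n q c)"
  unfolding cylinder_chain_def
proof (rule singular_chain_extend)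
  fix f assume "f \<in> Poly_Mapping.keys c"
  then have "continuous_map (simplex_space n) (simplex_space m) f"
    using c by (auto simp: singular_chain_def singular_simplex_def)
  then show "singular_chain (Suc n) (cylinder m) (chain_map (Suc n) (apsnd f) q)"
    by (intro singular_chain_chain_map[OF q] continuous_map_cylinder)
qed

lemma continuous_map_Pair_simplex:
  "t \<in> {0..1} \<Longrightarrow> continuous_map (simplex_space n) (cylinder n) (Pair t)"
  by (simp add: continuous_map_pairwise o_def)

text \<open>Acyclic models. The prescribed boundary is a cycle, since its two end faces cancel
  against the boundary formula of the prism one degree lower, and the cylinder is
  contractible.\<close>

lemma prism_step_exists:
  assumes n: "n \<noteq> 0 \<Longrightarrow> singular_chain n (cylinder (n - 1)) q' \<and> prism_step (n - 1) q'' q'"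
  shows "\<exists>q. prism_step n q' q"
proof -
  let ?i = "frag_of (identity_simplex n)"
  define z where "z = chain_map n (Pair 1) ?i - chain_map n (Pair 0) ?i - cylinder_chain (n - 1) q' (chain_boundary n ?i)"
  have i: "singular_chain n (simplex_space n) ?i"
    using singular_simplex_identity by (simp add: singular_chain_of)
  have ends: "singular_chain n (cylinder n) (chain_map n (Pair t) ?i)" if "t \<in> {0..1}" for t
    using that by (intro singular_chain_chain_map[OF i] continuous_map_Pair_simplex)
  have b: "singular_chain (n - 1) (simplex_space n) (chain_boundary n ?i)"
    using singular_chain_boundary[OF i] by simp
  have "singular_chain n (cylinder n) (cylinder_chain (n - 1) q' (chain_boundary n ?i))"
  proof (cases "n = 0")
    case False
    then show ?thesis
      using singular_cylinder_chain[of "n - 1" q' n, OF _ b] n by simp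
  qed (simp add: chain_boundary_of cylinder_chain_def)
  then have z: "singular_chain n (cylinder n) z"
    unfolding z_def by (intro singular_chain_diff ends) auto
  have "chain_boundary n z = 0"
  proof (cases "n = 0")
    case False
    have "chain_boundary n (cylinder_chain (n - 1) q' (chain_boundary n ?i))
        = chain_map (n - 1) (Pair 1) (chain_boundary n ?i) - chain_map (n - 1) (Pair 0) (chain_boundary n ?i)
          - cylinder_chain (n - 1 - 1) q'' (chain_boundary (n - 1) (chain_boundary n ?i))"
      using cylinder_chain_boundary[of "n - 1" q'' q', OF _ b] n False by simp
    moreover have "chain_boundary (n - 1) (chain_boundary n ?i) = 0"
      using chain_boundary_boundary[OF i] by simp
    ultimately show ?thesis
      using chain_boundary_chain_map[OF i, of "Pair (1::real)"] chain_boundary_chain_map[OF i, of "Pair (0::real)"]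
      by (simp add: z_def chain_boundary_diff cylinder_chain_def del: chain_map_of)
  qed (simp add: chain_boundary_def)
  then have "singular_relcycle n (cylinder n) {} z"
    using z by (simp add: singular_cycle)
  \<comment> \<open>In degree 0 the cycle is the difference of two points, which a constant map
    sends to 0.\<close>
  moreover have "1 \<le> n \<or> (\<forall>a::real \<times> (nat \<Rightarrow> real). chain_map n (\<lambda>x. a) z = 0)"
  proof (cases "n = 0")
    case True
    have "chain_map n (\<lambda>x. a) (chain_map n (Pair t) ?i) = chain_map n (\<lambda>x. a) ?i" for a :: "real \<times> (nat \<Rightarrow> real)" and t :: real
    proof -
      have eq: "(\<lambda>x. a) \<circ> Pair t = (\<lambda>x. a)"
        by auto
      show ?thesis
        using fun_cong[OF chain_map_compose[of n "\<lambda>x. a" "Pair t"], of ?i] by (simp only: comp_apply eq)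
    qed
    then show ?thesis
      using True by (simp add: z_def chain_map_diff chain_boundary_of cylinder_chain_def)
  qed simp
  moreover have "contractible_space (cylinder n)"
    by (simp add: contractible_space_prod_topology contractible_simplex_space convex_imp_contractible)
  ultimately have "singular_relboundary n (cylinder n) {} z"
    by (intro contractible_cycle_is_boundary)
  then obtain q where "singular_chain (Suc n) (cylinder n) q" "chain_boundary (Suc n) q = z"
    unfolding singular_boundary by blast
  then have "prism_step n q' q"
    using n by (simp add: prism_step_def z_def)
  then show ?thesis ..
qed

theorem prism_exists: "\<exists>Q. \<forall>n. prism_step n (Q (n - 1)) (Q n)"
proof -
  \<comment> \<open>Dependent choice on pairs: the first component repeats the prism of the previous
    degree, so that each choice can see its predecessor.\<close>
  have "\<exists>f. \<forall>n. prism_step n (fst (f n)) (snd (f n)) \<and> fst (f (Suc n)) = snd (f n)"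
  proof (rule dependent_nat_choice)
    show "\<exists>x. prism_step 0 (fst x) (snd x)"
      using prism_step_exists[of 0] by auto
    fix x n assume x: "prism_step n (fst x) (snd x)"
    then have "singular_chain (Suc n) (cylinder n) (snd x)"
      by (simp add: prism_step_def)
    then obtain q where "prism_step (Suc n) (snd x) q"
      using prism_step_exists[of "Suc n" "snd x" "fst x"] x by auto
    then show "\<exists>y. prism_step (Suc n) (fst y) (snd y) \<and> fst y = snd x"
      by (intro exI[of _ "(snd x, q)"]) simp
  qed
  then obtain f where f: "\<And>n. prism_step n (fst (f n)) (snd (f n))" "\<And>n. fst (f (Suc n)) = snd (f n)"
    by blast
  have "prism_step n (snd (f (n - 1))) (snd (f n))" for n
  proof (cases n)
    \<comment> \<open>Here \<open>Q (n - 1)\<close> is \<open>Q 0\<close> and not the first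
      component of the pair. In degree 0 the predecessor may be replaced by any chain, as the
      boundary of a 0-simplex is 0.\<close>
    case 0
    then show ?thesis
      using f(1)[of 0] by (simp add: prism_step_def chain_boundary_of cylinder_chain_def)
  next
    case (Suc m)
    then show ?thesis
      using f(1)[of n] f(2)[of m] by simp
  qed
  then show ?thesis
    by (intro exI[of _ "\<lambda>n. snd (f n)"]) blast
qed

section \<open>Barycentric coordinates on a realized complex\<close>

lemma affine_independent_sums_eq:
  fixes r :: "'v \<Rightarrow> 'a::euclidean_space"
  assumes fin: "finite s" and inj: "inj_on r s" and ind: "\<not> affine_dependent (r ` s)"
    and "sum c s = sum d s" "(\<Sum>u\<in>s. c u *\<^sub>R r u) = (\<Sum>u\<in>s. d u *\<^sub>R r u)" "u \<in> s"
  shows "c u = d u"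
proof (rule ccontr)
  assume "c u \<noteq> d u"
  define U where "U = (\<lambda>x. c (the_inv_into s r x) - d (the_inv_into s r x))"
  have U: "U (r w) = c w - d w" if "w \<in> s" for w
    using the_inv_into_f_f[OF inj that] by (simp add: U_def)
  have "sum U (r ` s) = 0"
    using assms(4) U by (simp add: sum.reindex[OF inj] sum_subtractf)
  moreover have "(\<Sum>x\<in>r ` s. U x *\<^sub>R x) = 0"
    using assms(5) U by (simp add: sum.reindex[OF inj] scaleR_diff_left sum_subtractf)
  moreover have "\<exists>x\<in>r ` s. U x \<noteq> 0"
    using \<open>u \<in> s\<close> \<open>c u \<noteq> d u\<close> U by auto
  ultimately have "affine_dependent (r ` s)"
    using fin by (subst affine_dependent_explicit_finite) auto
  with ind show False by simp
qed

lemma convex_hull_image_iff: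
  fixes r :: "'v \<Rightarrow> 'a::euclidean_space"
  assumes fin: "finite s" and inj: "inj_on r s"
  shows "x \<in> convex hull (r ` s) \<longleftrightarrow>
    (\<exists>c. (\<forall>u\<in>s. 0 \<le> c u) \<and> sum c s = 1 \<and> (\<Sum>u\<in>s. c u *\<^sub>R r u) = x)"
proof
  assume "x \<in> convex hull (r ` s)"
  then obtain d where "\<forall>x\<in>r ` s. 0 \<le> d x" "sum d (r ` s) = 1" "(\<Sum>x\<in>r ` s. d x *\<^sub>R x) = x"
    using fin by (auto simp: convex_hull_finite)
  then show "\<exists>c. (\<forall>u\<in>s. 0 \<le> c u) \<and> sum c s = 1 \<and> (\<Sum>u\<in>s. c u *\<^sub>R r u) = x"
    by (intro exI[of _ "d \<circ> r"]) (simp add: sum.reindex[OF inj])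
next
  assume "\<exists>c. (\<forall>u\<in>s. 0 \<le> c u) \<and> sum c s = 1 \<and> (\<Sum>u\<in>s. c u *\<^sub>R r u) = x"
  then obtain c where "\<forall>u\<in>s. 0 \<le> c u" "sum c s = 1" "(\<Sum>u\<in>s. c u *\<^sub>R r u) = x"
    by blast
  then show "x \<in> convex hull (r ` s)"
    using convex_sum[OF fin convex_convex_hull[of "r ` s"], of c r] by (auto intro: hull_inc)
qed

lemma rel_interior_image_iff:
  fixes r :: "'v \<Rightarrow> 'a::euclidean_space"
  assumes fin: "finite s" and inj: "inj_on r s" and ind: "\<not> affine_dependent (r ` s)"
  shows "x \<in> rel_interior (convex hull (r ` s)) \<longleftrightarrow>
    (\<exists>c. (\<forall>u\<in>s. 0 < c u) \<and> sum c s = 1 \<and> (\<Sum>u\<in>s. c u *\<^sub>R r u) = x)"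
proof
  assume "x \<in> rel_interior (convex hull (r ` s))"
  then obtain d where "\<forall>x\<in>r ` s. 0 < d x" "sum d (r ` s) = 1" "(\<Sum>x\<in>r ` s. d x *\<^sub>R x) = x"
    by (auto simp: rel_interior_convex_hull_explicit[OF ind])
  then show "\<exists>c. (\<forall>u\<in>s. 0 < c u) \<and> sum c s = 1 \<and> (\<Sum>u\<in>s. c u *\<^sub>R r u) = x"
    by (intro exI[of _ "d \<circ> r"]) (simp add: sum.reindex[OF inj])
next
  assume "\<exists>c. (\<forall>u\<in>s. 0 < c u) \<and> sum c s = 1 \<and> (\<Sum>u\<in>s. c u *\<^sub>R r u) = x"
  then obtain c where c: "\<forall>u\<in>s. 0 < c u" "sum c s = 1" "(\<Sum>u\<in>s. c u *\<^sub>R r u) = x"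
    by blast
  have i: "the_inv_into s r (r u) = u" if "u \<in> s" for u
    by (rule the_inv_into_f_f[OF inj that])
  show "x \<in> rel_interior (convex hull (r ` s))"
    unfolding rel_interior_convex_hull_explicit[OF ind]
    using c i by (intro CollectI exI[of _ "c \<circ> the_inv_into s r"]) (simp add: sum.reindex[OF inj])
qed

locale realized_complex =
  fixes r :: "'v \<Rightarrow> 'a::euclidean_space" and K :: "'v set set"
  assumes complex: "vertex_complex K" and realization: "geometric_realization r K"
begin

abbreviation "cell s \<equiv> convex hull (r ` s)"
abbreviation "carr \<equiv> carrier_simplex r K"
abbreviation "ptop \<equiv> polyhedron_topology r K"

text \<open>Coordinates are extended by 0 to all vertices, which makes those taken in different
  simplices comparable as functions.\<close>

definition barycentric :: "'v set \<Rightarrow> ('v \<Rightarrow> real) \<Rightarrow> 'a \<Rightarrow> bool" where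
  "barycentric s c x \<longleftrightarrow>
     (\<forall>u\<in>s. 0 \<le> c u) \<and> (\<forall>u. u \<notin> s \<longrightarrow> c u = 0) \<and> sum c s = 1 \<and> (\<Sum>u\<in>s. c u *\<^sub>R r u) = x"

definition coord :: "'a \<Rightarrow> 'v \<Rightarrow> real" where
  "coord x = (SOME c. \<exists>s\<in>K. barycentric s c x)"

lemma simplex_finite: "s \<in> K \<Longrightarrow> finite s" "s \<in> K \<Longrightarrow> s \<noteq> {}"
  using complex by (auto simp: vertex_complex_def)

lemma face_closed: "s \<in> K \<Longrightarrow> t \<subseteq> s \<Longrightarrow> t \<noteq> {} \<Longrightarrow> t \<in> K"
  using complex unfolding vertex_complex_def by blast

lemma simplex_inj: "s \<in> K \<Longrightarrow> inj_on r s"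
  using realization unfolding geometric_realization_def by (meson Union_upper inj_on_subset)

lemma simplex_independent: "s \<in> K \<Longrightarrow> \<not> affine_dependent (r ` s)"
  using realization unfolding geometric_realization_def by blast

lemma cell_Int: "s \<in> K \<Longrightarrow> t \<in> K \<Longrightarrow> cell s \<inter> cell t = cell (s \<inter> t)"
  using realization unfolding geometric_realization_def by blast

lemma mem_cell_iff: "s \<in> K \<Longrightarrow> x \<in> cell s \<longleftrightarrow> (\<exists>c. barycentric s c x)"
proof
  assume s: "s \<in> K" and "x \<in> cell s"
  then obtain c where "\<forall>u\<in>s. 0 \<le> c u" "sum c s = 1" "(\<Sum>u\<in>s. c u *\<^sub>R r u) = x"
    using convex_hull_image_iff[OF simplex_finite(1) simplex_inj] by blast
  then have "barycentric s (\<lambda>u. if u \<in> s then c u else 0) x"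
    by (simp add: barycentric_def)
  then show "\<exists>c. barycentric s c x"
    by blast
next
  assume s: "s \<in> K" and "\<exists>c. barycentric s c x"
  then show "x \<in> cell s"
    unfolding convex_hull_image_iff[OF simplex_finite(1)[OF s] simplex_inj[OF s]] barycentric_def by blast
qed

lemma barycentric_unique_simplex:
  assumes s: "s \<in> K" and "barycentric s c x" "barycentric s d x"
  shows "c = d"
proof
  fix u
  show "c u = d u"
  proof (cases "u \<in> s")
    case True
    then show ?thesis
      using assms affine_independent_sums_eq[OF simplex_finite(1)[OF s] simplex_inj[OF s] simplex_independent[OF s], of c d u]
      by (simp add: barycentric_def)
  qed (use assms in \<open>simp add: barycentric_def\<close>)
qed

lemma barycentric_mono:
  assumes "barycentric s c x" "s \<subseteq> t" "finite t"
  shows "barycentric t c x"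
proof -
  have "sum c t = sum c s" "(\<Sum>u\<in>t. c u *\<^sub>R r u) = (\<Sum>u\<in>s. c u *\<^sub>R r u)"
    by (rule sum.mono_neutral_right; use assms in \<open>auto simp: barycentric_def\<close>)+
  moreover have "0 \<le> c u" for u
    using assms(1) by (cases "u \<in> s") (auto simp: barycentric_def)
  ultimately show ?thesis
    using assms by (auto simp: barycentric_def)
qed

text \<open>The point lies in the cell of the common face; its coordinates there, extended by 0, are
  coordinates in both simplices, where affine independence makes them unique.\<close>

lemma barycentric_unique:
  assumes s: "s \<in> K" and t: "t \<in> K" and c: "barycentric s c x" and d: "barycentric t d x"
  shows "c = d"
proof -
  have x: "x \<in> cell (s \<inter> t)"
    using assms mem_cell_iff cell_Int[OF s t] by blast
  then have "s \<inter> t \<noteq> {}"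
    by auto
  then have st: "s \<inter> t \<in> K"
    using face_closed[OF s] by simp
  then obtain e where e: "barycentric (s \<inter> t) e x"
    using x mem_cell_iff by blast
  have "c = e"
    using barycentric_unique_simplex[OF s c barycentric_mono[OF e]] simplex_finite(1)[OF s] by simp
  moreover have "d = e"
    using barycentric_unique_simplex[OF t d barycentric_mono[OF e]] simplex_finite(1)[OF t] by simp
  ultimately show ?thesis by simp
qed

lemma coord_eq:
  assumes "s \<in> K" "barycentric s c x"
  shows "coord x = c"
proof -
  have "\<exists>s\<in>K. barycentric s (coord x) x"
    unfolding coord_def by (rule someI[of "\<lambda>c. \<exists>s\<in>K. barycentric s c x" c]) (use assms in blast)
  then show ?thesis
    using barycentric_unique assms by blast
qed

lemma underlying_iff: "x \<in> underlying_set r K \<longleftrightarrow> (\<exists>s\<in>K. x \<in> cell s)"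
  by (simp add: underlying_set_def)

lemma cell_barycentric: "s \<in> K \<Longrightarrow> x \<in> cell s \<Longrightarrow> barycentric s (coord x) x"
  using mem_cell_iff coord_eq by metis

lemma coord_nonneg: "x \<in> underlying_set r K \<Longrightarrow> 0 \<le> coord x u"
  using cell_barycentric unfolding underlying_iff barycentric_def by (metis order_refl)

lemma support_in_complex:
  assumes s: "s \<in> K" and x: "x \<in> cell s"
  shows "{u. coord x u \<noteq> 0} \<subseteq> s" "{u. coord x u \<noteq> 0} \<in> K"
proof -
  have b: "barycentric s (coord x) x"
    by (rule cell_barycentric[OF s x])
  then show "{u. coord x u \<noteq> 0} \<subseteq> s"
    by (auto simp: barycentric_def)
  moreover have "{u. coord x u \<noteq> 0} \<noteq> {}"
  proof
    assume "{u. coord x u \<noteq> 0} = {}"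
    then have "sum (coord x) s = 0"
      by (intro sum.neutral) blast
    then show False
      using b by (simp add: barycentric_def)
  qed
  ultimately show "{u. coord x u \<noteq> 0} \<in> K"
    by (rule face_closed[OF s])
qed

lemma barycentric_support:
  assumes s: "s \<in> K" and x: "x \<in> cell s"
  shows "barycentric {u. coord x u \<noteq> 0} (coord x) x"
proof -
  let ?t = "{u. coord x u \<noteq> 0}"
  have b: "barycentric s (coord x) x"
    by (rule cell_barycentric[OF s x])
  have "sum (coord x) s = sum (coord x) ?t" "(\<Sum>u\<in>s. coord x u *\<^sub>R r u) = (\<Sum>u\<in>?t. coord x u *\<^sub>R r u)"
    using simplex_finite(1)[OF s] support_in_complex[OF s x] by (auto intro!: sum.mono_neutral_right)
  then show ?thesis
    using b by (auto simp: barycentric_def)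
qed

lemma rel_interior_cell_iff:
  assumes s: "s \<in> K"
  shows "x \<in> rel_interior (cell s) \<longleftrightarrow> x \<in> cell s \<and> {u. coord x u \<noteq> 0} = s"
proof
  assume "x \<in> rel_interior (cell s)"
  then obtain c where c: "\<forall>u\<in>s. 0 < c u" "sum c s = 1" "(\<Sum>u\<in>s. c u *\<^sub>R r u) = x"
    unfolding rel_interior_image_iff[OF simplex_finite(1)[OF s] simplex_inj[OF s] simplex_independent[OF s]] by blast
  then have "barycentric s (\<lambda>u. if u \<in> s then c u else 0) x"
    by (auto simp: barycentric_def less_imp_le)
  then have "coord x = (\<lambda>u. if u \<in> s then c u else 0)" "x \<in> cell s"
    using coord_eq[OF s] mem_cell_iff[OF s] by blast+
  then show "x \<in> cell s \<and> {u. coord x u \<noteq> 0} = s"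
    using c(1) by (auto simp: order_less_le split: if_splits)
next
  assume x: "x \<in> cell s \<and> {u. coord x u \<noteq> 0} = s"
  then have "barycentric s (coord x) x"
    using cell_barycentric[OF s] by blast
  moreover from this x have "\<forall>u\<in>s. 0 < coord x u"
    by (auto simp: barycentric_def order_less_le)
  ultimately show "x \<in> rel_interior (cell s)"
    unfolding rel_interior_image_iff[OF simplex_finite(1)[OF s] simplex_inj[OF s] simplex_independent[OF s]]
    by (auto simp: barycentric_def)
qed

lemma carr_eq_support:
  assumes "x \<in> underlying_set r K"
  shows "carr x = {u. coord x u \<noteq> 0}"
  unfolding carrier_simplex_def
proof (rule the_equality)
  obtain s where s: "s \<in> K" "x \<in> cell s"
    using assms underlying_iff by blast
  have t: "{u. coord x u \<noteq> 0} \<in> K"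
    by (rule support_in_complex(2)[OF s])
  show "{u. coord x u \<noteq> 0} \<in> K \<and> x \<in> rel_interior (cell {u. coord x u \<noteq> 0})"
    using rel_interior_cell_iff[OF t] t barycentric_support[OF s] mem_cell_iff[OF t] by blast
  show "s = {u. coord x u \<noteq> 0}" if "s \<in> K \<and> x \<in> rel_interior (cell s)" for s
    using that rel_interior_cell_iff by blast
qed

lemma carr_in_complex: "x \<in> underlying_set r K \<Longrightarrow> carr x \<in> K"
  using carr_eq_support support_in_complex(2) underlying_iff by metis

lemma mem_carr_iff: "x \<in> underlying_set r K \<Longrightarrow> u \<in> carr x \<longleftrightarrow> 0 < coord x u"
  using carr_eq_support coord_nonneg[of x u] by (auto simp: order_less_le)

lemma cell_subset_underlying: "s \<in> K \<Longrightarrow> cell s \<subseteq> underlying_set r K"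
  using underlying_iff by blast

lemma carr_subset: "s \<in> K \<Longrightarrow> x \<in> cell s \<Longrightarrow> carr x \<subseteq> s"
  using support_in_complex(1) carr_eq_support cell_subset_underlying by blast

lemma mem_cell_carr: "x \<in> underlying_set r K \<Longrightarrow> x \<in> cell (carr x)"
  using barycentric_support mem_cell_iff carr_eq_support carr_in_complex underlying_iff by metis

lemma mem_cell_iff_carr:
  assumes s: "s \<in> K"
  shows "x \<in> cell s \<longleftrightarrow> x \<in> underlying_set r K \<and> carr x \<subseteq> s"
proof
  assume "x \<in> underlying_set r K \<and> carr x \<subseteq> s"
  then show "x \<in> cell s"
    using mem_cell_carr hull_mono[OF image_mono, of "carr x" s convex r] by blast
qed (use carr_subset cell_subset_underlying s in blast)

lemma sum_coord_carr:
  assumes "x \<in> underlying_set r K" "carr x \<subseteq> t" "finite t"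
  shows "sum (coord x) t = 1"
proof -
  obtain s where s: "s \<in> K" "x \<in> cell s"
    using assms underlying_iff by blast
  have "barycentric t (coord x) x"
    using barycentric_mono[OF barycentric_support[OF s]] assms carr_eq_support by metis
  then show ?thesis
    by (simp add: barycentric_def)
qed

text \<open>On a cell that contains \<open>u\<close> the coordinate is an affine function. By affine
  independence some linear \<open>g\<close> takes the value 1 on all edge vectors
  \<open>r w - r u\<close>, so \<open>g\<close> grows from \<open>r u\<close> exactly by the total
  of the other coordinates.\<close>

lemma continuous_on_coord:
  assumes s: "s \<in> K"
  shows "continuous_on (cell s) (\<lambda>x. coord x u)"
proof (cases "u \<in> s")
  case False
  then have "coord x u = 0" if "x \<in> cell s" for x
    using cell_barycentric[OF s that] by (simp add: barycentric_def)
  then show ?thesis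
    by (simp add: continuous_on_eq[OF continuous_on_const])
next
  case True
  let ?B = "(\<lambda>x. - r u + x) ` (r ` s - {r u})"
  have "independent ?B"
    using affine_dependent_iff_dependent2[of "r u" "r ` s"] simplex_independent[OF s] True by simp
  then obtain g :: "'a \<Rightarrow> real" where g: "linear g" "\<And>x. x \<in> ?B \<Longrightarrow> g x = 1"
    using linear_independent_extend[of ?B "\<lambda>x. 1"] by blast
  have g1: "g (r w) = g (r u) + (if w = u then 0 else 1)" if "w \<in> s" for w
  proof (cases "w = u")
    case False
    then have "r w \<noteq> r u"
      using simplex_inj[OF s] that True by (auto dest: inj_onD)
    then have "g (- r u + r w) = 1"
      using g(2) that by blast
    then show ?thesis
      using False linear_add[OF g(1), of "- r u" "r w"] linear_neg[OF g(1), of "r u"] by simp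
  qed simp
  have "coord x u = 1 + g (r u) - g x" if x: "x \<in> cell s" for x
  proof -
    have b: "sum (coord x) s = 1" "(\<Sum>w\<in>s. coord x w *\<^sub>R r w) = x"
      using cell_barycentric[OF s x] by (auto simp: barycentric_def)
    have "g x = (\<Sum>w\<in>s. coord x w * g (r w))"
      by (subst b(2)[symmetric]) (simp add: linear_sum[OF g(1)] linear_cmul[OF g(1)])
    also have "\<dots> = (\<Sum>w\<in>s. coord x w * g (r u) + (coord x w - (if w = u then coord x w else 0)))"
      using g1 by (intro sum.cong) (auto simp: algebra_simps)
    also have "\<dots> = g (r u) + (1 - coord x u)"
      using b(1) True simplex_finite(1)[OF s]
      by (simp add: sum.distrib sum_subtractf sum_distrib_right[symmetric])
    finally show ?thesis by simp
  qed
  moreover have "continuous_on (cell s) (\<lambda>x. 1 + g (r u) - g x)"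
    using g(1) by (intro continuous_intros linear_continuous_on) (simp add: linear_conv_bounded_linear)
  ultimately show ?thesis
    using continuous_on_eq by force
qed

section \<open>Consequences of the coherent topology\<close>

lemma continuous_map_from_poly:
  assumes "\<And>s. s \<in> K \<Longrightarrow> continuous_map (top_of_set (cell s)) Y f"
  shows "continuous_map ptop Y f"
  unfolding continuous_map_def topspace_polyhedron_topology openin_polyhedron_topology polyhedron_open_def
proof (intro conjI allI impI ballI)
  show "f \<in> underlying_set r K \<rightarrow> topspace Y"
    using continuous_map_image_subset_topspace[OF assms] unfolding underlying_set_def by fastforce
  fix U assume U: "openin Y U"
  show "{x \<in> underlying_set r K. f x \<in> U} \<subseteq> underlying_set r K"
    by blast
  fix s assume s: "s \<in> K"
  have "{x \<in> underlying_set r K. f x \<in> U} \<inter> cell s = {x \<in> topspace (top_of_set (cell s)). f x \<in> U}"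
    using cell_subset_underlying[OF s] by auto
  then show "openin (top_of_set (cell s)) ({x \<in> underlying_set r K. f x \<in> U} \<inter> cell s)"
    using openin_continuous_map_preimage[OF assms[OF s] U] by simp
qed

lemma continuous_map_cell_poly:
  assumes s: "s \<in> K"
  shows "continuous_map (top_of_set (cell s)) ptop (\<lambda>x. x)"
  unfolding continuous_map_def topspace_polyhedron_topology openin_polyhedron_topology polyhedron_open_def
proof (intro conjI allI impI)
  fix U assume "U \<subseteq> underlying_set r K \<and> (\<forall>s\<in>K. openin (top_of_set (cell s)) (U \<inter> cell s))"
  then have "openin (top_of_set (cell s)) (U \<inter> cell s)"
    using s by blast
  moreover have "{x \<in> topspace (top_of_set (cell s)). x \<in> U} = U \<inter> cell s"
    by auto
  ultimately show "openin (top_of_set (cell s)) {x \<in> topspace (top_of_set (cell s)). x \<in> U}"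
    by simp
qed (use cell_subset_underlying[OF s] in auto)

lemma continuous_map_poly_euclidean: "continuous_map ptop euclidean (\<lambda>x. x)"
  by (rule continuous_map_from_poly) simp

lemma continuous_map_coord: "continuous_map ptop euclideanreal (\<lambda>x. coord x u)"
  by (rule continuous_map_from_poly) (simp add: continuous_on_coord)

lemma closedin_cell: "s \<in> K \<Longrightarrow> closedin ptop (cell s)"
  using closedin_continuous_map_preimage[OF continuous_map_poly_euclidean, of "cell s"]
    simplex_finite(1) cell_subset_underlying[of s]
  by (simp add: topspace_polyhedron_topology compact_imp_closed finite_imp_compact_convex_hull Int_absorb1
      Collect_conj_eq)

text \<open>Points with pairwise different carriers form a closed discrete set, since a cell has
  finitely many faces and so contains finitely many of them. An infinite such set inside a compact
  one would have a limit point.\<close>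

lemma compactin_finite_carriers:
  assumes C: "compactin ptop C"
  shows "finite (carr ` C)"
proof (rule ccontr)
  assume inf: "infinite (carr ` C)"
  obtain A where A: "A \<subseteq> C" "inj_on carr A" "carr ` A = carr ` C"
    using subset_image_inj[of "carr ` C" carr C] by auto
  then have "infinite A"
    using inf by (metis finite_imageI)
  then obtain a where a: "a \<in> ptop derived_set_of A"
    using compactin_imp_Bolzano_Weierstrass[OF C, of A] A(1) by blast
  \<comment> \<open>All chosen points are removed except the supposed limit point. The rest is open
    because only finitely many points are removed from each cell.\<close>
  define U where "U = underlying_set r K - (A - {a})"
  have "openin (top_of_set (cell s)) (U \<inter> cell s)" if s: "s \<in> K" for s
  proof -
    have "carr ` (A \<inter> cell s) \<subseteq> Pow s"
      using carr_subset[OF s] by blast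
    then have "finite (carr ` (A \<inter> cell s))"
      using simplex_finite(1)[OF s] finite_subset by auto
    then have "finite (A \<inter> cell s)"
      using A(2) by (meson finite_imageD inj_on_Int)
    then have "closed (A \<inter> cell s - {a})"
      by (simp add: finite_imp_closed)
    then have "openin (top_of_set (cell s)) (cell s - (A \<inter> cell s - {a}))"
      by (metis Diff_eq open_Compl openin_open_Int)
    moreover have "U \<inter> cell s = cell s - (A \<inter> cell s - {a})"
      unfolding U_def using cell_subset_underlying[OF s] by auto
    ultimately show ?thesis by simp
  qed
  then have "openin ptop U"
    unfolding openin_polyhedron_topology polyhedron_open_def U_def by blast
  moreover have "a \<in> U"
    using a by (simp add: U_def in_derived_set_of topspace_polyhedron_topology)
  ultimately obtain y where "y \<noteq> a" "y \<in> A" "y \<in> U"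
    using a by (auto simp: in_derived_set_of)
  then show False
    by (simp add: U_def)
qed

section \<open>Vertices of largest barycentric coordinate\<close>

definition top_vertex :: "'a \<Rightarrow> 'v" where
  "top_vertex x = (SOME u. \<forall>w. coord x w \<le> coord x u)"

lemma top_vertex_max:
  assumes x: "x \<in> underlying_set r K"
  shows "coord x w \<le> coord x (top_vertex x)"
proof -
  have fin: "finite (carr x)" and ne: "carr x \<noteq> {}"
    using simplex_finite carr_in_complex[OF x] by auto
  define m where "m = Max (coord x ` carr x)"
  have "m \<in> coord x ` carr x"
    unfolding m_def using fin ne by (intro Max_in) auto
  then obtain u where u: "u \<in> carr x" "coord x u = m"
    by blast
  have "coord x w \<le> coord x u" for w
  proof (cases "w \<in> carr x")
    case True
    then show ?thesis
      using fin u by (simp add: m_def)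
  next
    case False
    then have "coord x w = 0"
      using carr_eq_support[OF x] by auto
    then show ?thesis
      using coord_nonneg[OF x] by simp
  qed
  then have "\<forall>w. coord x w \<le> coord x (top_vertex x)"
    unfolding top_vertex_def by (intro someI[of "\<lambda>u. \<forall>w. coord x w \<le> coord x u" u]) blast
  then show ?thesis by blast
qed

lemma top_vertex_in_carr:
  assumes x: "x \<in> underlying_set r K"
  shows "top_vertex x \<in> carr x"
proof -
  obtain u where "u \<in> carr x"
    using simplex_finite(2)[OF carr_in_complex[OF x]] by blast
  then have "0 < coord x u"
    using mem_carr_iff[OF x] by blast
  then show ?thesis
    using top_vertex_max[OF x, of u] mem_carr_iff[OF x] by simp
qed

text \<open>Near \<open>x\<close> the largest coordinate of any point belongs to a vertex of the
  carrier of \<open>x\<close> and is bounded away from 0; it therefore stays positive at all other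
  nearby points. Ties in the choice of the vertex do not matter.\<close>

lemma small_neighbourhood:
  assumes x: "x \<in> underlying_set r K"
  obtains V where "openin ptop V" "x \<in> V" "\<And>y z. y \<in> V \<Longrightarrow> z \<in> V \<Longrightarrow> top_vertex y \<in> carr z"
proof -
  define k where "k = real (card (carr x))"
  \<comment> \<open>With \<open>k\<close> vertices in the carrier, the largest coordinate near
    \<open>x\<close> is at least \<open>(1 - e) / k\<close>, which is \<open>4 * e * (1 - e)\<close>
    and hence at least \<open>3 * e\<close>. This margin survives the two errors of size
    \<open>e\<close> made in passing from \<open>y\<close> to \<open>x\<close> and from
    \<open>x\<close> to \<open>z\<close>.\<close>
  define e where "e = 1 / (4 * k)"
  have fin: "finite (carr x)" and ne: "carr x \<noteq> {}"
    using simplex_finite carr_in_complex[OF x] by auto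
  then have k: "1 \<le> k"
    by (simp add: k_def Suc_leI card_gt_0_iff)
  then have e: "0 < e" "e \<le> 1 / 4" "4 * (k * e) = 1"
    by (simp_all add: e_def field_simps)
  define d where "d = (\<lambda>y. \<Sum>u\<in>carr x. \<bar>coord y u - coord x u\<bar>)"
  define V where "V = {y \<in> topspace ptop. d y \<in> {..<e}}"
  have "continuous_map ptop euclideanreal d"
    unfolding d_def using fin
    by (intro continuous_map_sum continuous_map_real_abs continuous_map_diff continuous_map_coord) auto
  then have "openin ptop V"
    unfolding V_def by (rule openin_continuous_map_preimage) simp
  moreover have "x \<in> V"
    using x e by (simp add: V_def d_def topspace_polyhedron_topology)
  moreover have "top_vertex y \<in> carr z" if "y \<in> V" "z \<in> V" for y z
  proof -
    have y: "y \<in> underlying_set r K" "d y < e" and z: "z \<in> underlying_set r K" "d z < e"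
      using that by (auto simp: V_def topspace_polyhedron_topology)
    have close: "\<bar>coord w u - coord x u\<bar> \<le> d w" if "u \<in> carr x" for u w
      unfolding d_def using fin that by (intro member_le_sum) auto
    have "1 - sum (coord y) (carr x) = (\<Sum>u\<in>carr x. coord x u - coord y u)"
      using sum_coord_carr[OF x order_refl fin] by (simp add: sum_subtractf)
    also have "\<dots> \<le> d y"
      unfolding d_def by (intro sum_mono) auto
    finally have big: "1 - e < sum (coord y) (carr x)"
      using y(2) by simp
    let ?v = "top_vertex y"
    have "sum (coord y) (carr x) \<le> k * coord y ?v"
      unfolding k_def using top_vertex_max[OF y(1)] by (intro sum_bounded_above) auto
    then have "3 * e * k < coord y ?v * k"
      using big e by (simp add: algebra_simps)
    then have v: "3 * e < coord y ?v"
      using k by simp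
    \<comment> \<open>Otherwise its coordinate, above \<open>3 * e\<close>, would come on top of the
      mass above \<open>1 - e\<close> in the carrier of \<open>x\<close>, and the coordinates would
      add up to more than 1.\<close>
    have "?v \<in> carr x"
    proof (rule ccontr)
      assume nv: "?v \<notin> carr x"
      have finy: "finite (carr y)"
        using simplex_finite carr_in_complex[OF y(1)] by auto
      have "sum (coord y) (insert ?v (carr x)) \<le> sum (coord y) (insert ?v (carr x) \<union> carr y)"
        using fin finy coord_nonneg[OF y(1)] by (intro sum_mono2) auto
      also have "\<dots> = 1"
        using fin finy by (intro sum_coord_carr[OF y(1)]) auto
      finally show False
        using nv fin big v e(1) by simp
    qed
    then have "0 < coord z ?v"
      using close[of ?v y] close[of ?v z] v y(2) z(2) e(1) by linarith
    then show ?thesis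
      using mem_carr_iff[OF z(1)] by blast
  qed
  ultimately show thesis
    using that by blast
qed

end

section \<open>Weighted singular chains\<close>

definition singular_differential :: "nat \<Rightarrow> ((nat \<Rightarrow> real) \<Rightarrow> 'x) \<Rightarrow> 'x chain" where
  "singular_differential n f = chain_boundary n (frag_of f)"

definition span_weight :: "bool \<Rightarrow> nat set \<Rightarrow> nat" where
  "span_weight asc A = (if asc then Lcm A else Gcd A)"

definition singular_weight :: "bool \<Rightarrow> ('x \<Rightarrow> nat) \<Rightarrow> nat \<Rightarrow> ((nat \<Rightarrow> real) \<Rightarrow> 'x) \<Rightarrow> rat" where
  "singular_weight asc l n f = rat_weight asc (span_weight asc (l ` f ` standard_simplex n))"

text \<open>The value \<open>b\<close> relates to \<open>a\<close> as the weight of a face relates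
  to that of the simplex.\<close>

definition weight_divides :: "bool \<Rightarrow> nat \<Rightarrow> nat \<Rightarrow> bool" where
  "weight_divides asc b a \<longleftrightarrow> (if asc then b dvd a else a dvd b)"

text \<open>Finiteness keeps \<open>Lcm\<close> away from 0, the value that it takes on infinite
  sets of natural numbers.\<close>

definition tame :: "'x topology \<Rightarrow> ('x \<Rightarrow> nat) \<Rightarrow> bool" where
  "tame X l \<longleftrightarrow> (\<forall>x\<in>topspace X. 0 < l x) \<and>
     (\<forall>n f. singular_simplex n X f \<longrightarrow> finite (l ` f ` standard_simplex n))"

lemma chain_boundary_eq_extend: "chain_boundary n c = frag_extend (singular_differential n) c"
proof -
  have "Poly_Mapping.keys c \<subseteq> UNIV" by simp
  then show ?thesis
    by (induction c rule: frag_induction) (simp_all add: singular_differential_def chain_boundary_diff frag_extend_diff)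
qed

lemma span_weight_pos:
  assumes "finite A" "A \<noteq> {}" "\<forall>a\<in>A. 0 < a"
  shows "0 < span_weight asc A"
proof -
  have "Lcm A \<noteq> 0"
    using assms by (auto simp: Lcm_0_iff)
  moreover have "Gcd A \<noteq> 0"
    using assms by (auto simp: Gcd_0_iff)
  ultimately show ?thesis
    by (cases asc) (simp_all only: span_weight_def if_True if_False neq0_conv)
qed

lemma span_weight_divides:
  assumes "\<forall>b\<in>B. \<exists>a\<in>A. weight_divides asc b a"
  shows "if asc then span_weight asc B dvd span_weight asc A else span_weight asc A dvd span_weight asc B"
proof (cases asc)
  case True
  then have "Lcm B dvd Lcm A"
    using assms by (intro Lcm_least) (meson dvd_Lcm dvd_trans weight_divides_def)
  then show ?thesis
    using True by (simp add: span_weight_def)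
next
  case False
  then have "Gcd A dvd Gcd B"
    using assms by (intro Gcd_greatest) (meson Gcd_dvd dvd_trans weight_divides_def)
  then show ?thesis
    using False by (simp add: span_weight_def)
qed

lemma singular_simplex_image:
  "singular_simplex n X f \<Longrightarrow> f ` standard_simplex n \<subseteq> topspace X"
  by (force simp: singular_simplex_def dest: continuous_map_image_subset_topspace)

lemma tame_span_weight_pos:
  assumes "tame X l" "singular_simplex n X f"
  shows "0 < span_weight asc (l ` f ` standard_simplex n)"
  using assms singular_simplex_image[OF assms(2)] nonempty_standard_simplex[of n]
  by (intro span_weight_pos) (auto simp: tame_def image_subset_iff simp del: neq0_conv)

text \<open>It suffices that each value of the weight on the image of \<open>g\<close> is dominated
  by some value on the image of \<open>f\<close>. The images need not be nested; the straight-line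
  homotopy uses this.\<close>

lemma singular_weight_ratio:
  assumes t: "tame X l" and f: "singular_simplex n X f" and g: "singular_simplex m X g"
    and d: "\<forall>x\<in>g ` standard_simplex m. \<exists>y\<in>f ` standard_simplex n. weight_divides asc (l x) (l y)"
  shows "singular_weight asc l m g \<noteq> 0" "singular_weight asc l n f / singular_weight asc l m g \<in> \<int>"
proof -
  have "\<forall>b\<in>l ` g ` standard_simplex m. \<exists>a\<in>l ` f ` standard_simplex n. weight_divides asc b a"
    using d by blast
  from rat_weight_ratio[OF tame_span_weight_pos[OF t f] tame_span_weight_pos[OF t g] span_weight_divides[OF this]]
  show "singular_weight asc l m g \<noteq> 0" "singular_weight asc l n f / singular_weight asc l m g \<in> \<int>"
    by (simp_all add: singular_weight_def)
qed

lemma weight_divides_refl: "weight_divides asc a a"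
  by (simp add: weight_divides_def)

text \<open>Operators that do not leave the image of a simplex are automatically compatible with
  weights. Boundary, subdivision and the subdivision homotopy are all of this kind.\<close>

lemma fits_subspace:
  assumes t: "tame X l" and f: "singular_simplex n X f"
    and c: "singular_chain m (subtopology X (f ` standard_simplex n)) c"
  shows "fits (singular_weight asc l m) (singular_weight asc l n f) c"
  unfolding fits_def
proof
  fix g assume "g \<in> Poly_Mapping.keys c"
  then have "singular_simplex m X g" "g ` standard_simplex m \<subseteq> f ` standard_simplex n"
    using c[unfolded singular_chain_subtopology] unfolding singular_chain_def by blast+
  then show "singular_weight asc l m g \<noteq> 0 \<and> singular_weight asc l n f / singular_weight asc l m g \<in> \<int>"
    using singular_weight_ratio[OF t f, of m g asc] weight_divides_refl by blast
qed

lemma singular_simplex_own_image: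
  "singular_simplex n X f \<Longrightarrow> singular_chain n (subtopology X (f ` standard_simplex n)) (frag_of f)"
  by (simp add: singular_chain_of singular_simplex_subtopology)

lemma singular_chain_subspace: "singular_chain n (subtopology X A) c \<Longrightarrow> singular_chain n X c"
  by (simp add: singular_chain_subtopology)

abbreviation singular_basis :: "'x topology \<Rightarrow> nat \<Rightarrow> ((nat \<Rightarrow> real) \<Rightarrow> 'x) set" where
  "singular_basis X \<equiv> \<lambda>n. singular_simplex_set n X"

lemma based_complex_singular:
  assumes t: "tame X l"
  shows "based_complex (singular_basis X) (singular_weight asc l) singular_differential"
  unfolding based_complex_def
proof (intro conjI allI ballI)
  fix n f assume "f \<in> singular_basis X n"
  then have f: "singular_simplex n X f" by simp
  note own = singular_simplex_own_image[OF f]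
  show "singular_weight asc l n f \<noteq> 0"
    using singular_weight_ratio(1)[OF t f f] weight_divides_refl by blast
  have b: "singular_chain (n - 1) (subtopology X (f ` standard_simplex n)) (singular_differential n f)"
    using singular_chain_boundary[OF own] by (simp add: singular_differential_def)
  then show "Poly_Mapping.keys (singular_differential n f) \<subseteq> singular_basis X (n - 1)"
    using singular_chain_subspace unfolding singular_chain_def by blast
  show "fits (singular_weight asc l (n - 1)) (singular_weight asc l n f) (singular_differential n f)"
    by (rule fits_subspace[OF t f b])
  show "frag_extend (singular_differential (n - 1)) (singular_differential n f) = 0"
    using chain_boundary_boundary[OF own]
    by (simp add: singular_differential_def[of n] chain_boundary_eq_extend[symmetric])
qed (simp add: singular_differential_def chain_boundary_def)

section \<open>Iterated subdivision of weighted singular chains\<close>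

definition subdivide :: "nat \<Rightarrow> nat \<Rightarrow> ((nat \<Rightarrow> real) \<Rightarrow> 'x) \<Rightarrow> 'x chain" where
  "subdivide m n f = (singular_subdivision n ^^ m) (frag_of f)"

lemma subdivision_power_eq_extend: "(singular_subdivision n ^^ m) c = frag_extend (subdivide m n) c"
proof -
  have "Poly_Mapping.keys c \<subseteq> UNIV" by simp
  then show ?thesis
    by (induction c rule: frag_induction) (simp_all add: subdivide_def singular_subdivision_power_diff frag_extend_diff)
qed

lemma singular_chain_subdivision_power:
  "singular_chain n X c \<Longrightarrow> singular_chain n X ((singular_subdivision n ^^ m) c)"
  by (induction m) (simp_all add: singular_chain_singular_subdivision)

lemma chain_boundary_subdivision_power:
  assumes "singular_chain n X c"
  shows "chain_boundary n ((singular_subdivision n ^^ m) c) = (singular_subdivision (n - 1) ^^ m) (chain_boundary n c)"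
proof (induction m)
  case (Suc m)
  then show ?case
    using chain_boundary_singular_subdivision[OF singular_chain_subdivision_power[OF assms, of m]] by simp
qed simp

lemma singular_chain_subdivide:
  "singular_simplex n X f \<Longrightarrow> singular_chain n (subtopology X (f ` standard_simplex n)) (subdivide m n f)"
  unfolding subdivide_def by (intro singular_chain_subdivision_power singular_simplex_own_image)

lemma keys_subdivide:
  assumes "singular_simplex n X f" "g \<in> Poly_Mapping.keys (subdivide m n f)"
  shows "singular_simplex n X g" "g ` standard_simplex n \<subseteq> f ` standard_simplex n"
  using singular_chain_subdivide[OF assms(1), of m, unfolded singular_chain_subtopology] assms(2)
  unfolding singular_chain_def by blast+

context
  fixes X :: "'x topology" and l :: "'x \<Rightarrow> nat" and asc :: bool
  assumes tame: "tame X l"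
begin

abbreviation "sw \<equiv> singular_weight asc l"
abbreviation "sbd \<equiv> twisted_boundary sw singular_differential"
abbreviation "subdivide_chain m n \<equiv> twist (sw n) (sw n) (subdivide m n)"

lemma fits_singular_differential:
  "singular_simplex n X f \<Longrightarrow> fits (sw (n - 1)) (sw n f) (singular_differential n f)"
  using based_complexD(3)[OF based_complex_singular[OF tame, of asc], of f n] by simp

lemma keys_singular_differential:
  "singular_simplex n X f \<Longrightarrow> g \<in> Poly_Mapping.keys (singular_differential n f) \<Longrightarrow> singular_simplex (n - 1) X g"
  using based_complexD(2)[OF based_complex_singular[OF tame, of asc], of f n] by auto

lemma sbd_subdivide_chain:
  assumes c: "singular_chain n X c"
  shows "sbd n (subdivide_chain m n c) = subdivide_chain m (n - 1) (sbd n c)"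
proof -
  have f: "singular_simplex n X f" if "f \<in> Poly_Mapping.keys c" for f
    using c that by (auto simp: singular_chain_def)
  have "sbd n (subdivide_chain m n c)
      = twist (sw n) (sw (n - 1)) (\<lambda>f. frag_extend (singular_differential n) (subdivide m n f)) c"
    unfolding twisted_boundary_def
  proof (rule twist_twist)
    show "fits (sw n) (sw n g) (subdivide m n g)" if "g \<in> Poly_Mapping.keys c" for g
      by (rule fits_subspace[OF tame f[OF that] singular_chain_subdivide[OF f[OF that]]])
    show "fits (sw (n - 1)) (sw n g) (singular_differential n g)"
      if "f' \<in> Poly_Mapping.keys c" "g \<in> Poly_Mapping.keys (subdivide m n f')" for f' g
      by (rule fits_singular_differential[OF keys_subdivide(1)[OF f[OF that(1)] that(2)]])
  qed
  also have "\<dots> = twist (sw n) (sw (n - 1)) (\<lambda>f. frag_extend (subdivide m (n - 1)) (singular_differential n f)) c"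
  proof (rule twist_cong)
    fix g assume "g \<in> Poly_Mapping.keys c"
    then have "singular_chain n X (frag_of g)"
      using f by (simp add: singular_chain_of)
    from chain_boundary_subdivision_power[OF this, of m]
    show "frag_extend (singular_differential n) (subdivide m n g)
        = frag_extend (subdivide m (n - 1)) (singular_differential n g)"
      by (simp add: chain_boundary_eq_extend[symmetric] subdivision_power_eq_extend[symmetric]
          subdivide_def[of m n] singular_differential_def[of n])
  qed
  also have "\<dots> = subdivide_chain m (n - 1) (sbd n c)"
    unfolding twisted_boundary_def
  proof (rule twist_twist[symmetric])
    show "fits (sw (n - 1)) (sw n g) (singular_differential n g)" if "g \<in> Poly_Mapping.keys c" for g
      by (rule fits_singular_differential[OF f[OF that]])
    show "fits (sw (n - 1)) (sw (n - 1) g) (subdivide m (n - 1) g)"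
      if "f' \<in> Poly_Mapping.keys c" "g \<in> Poly_Mapping.keys (singular_differential n f')" for f' g
      using keys_singular_differential[OF f[OF that(1)] that(2)]
      by (intro fits_subspace[OF tame] singular_chain_subdivide)
  qed
  finally show ?thesis .
qed

text \<open>The homotopy enters by its values in degrees \<open>n\<close> and \<open>n - 1\<close>.
  These are separate parameters because the two degrees coincide when \<open>n\<close> is 0, where
  the lower value can be taken to be 0.\<close>

lemma chain_homotopy_boundary:
  assumes c: "c \<in> twisted_cycles (singular_basis X) sw singular_differential n"
    and h: "\<And>f. f \<in> Poly_Mapping.keys c \<Longrightarrow>
        fits (sw (Suc n)) (sw n f) (h f) \<and> singular_chain (Suc n) X (h f)"
    and h': "\<And>f g. f \<in> Poly_Mapping.keys c \<Longrightarrow> g \<in> Poly_Mapping.keys (singular_differential n f) \<Longrightarrow>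
        fits (sw n) (sw (n - 1) g) (h' g)"
    and eq: "\<And>f. f \<in> Poly_Mapping.keys c \<Longrightarrow>
        chain_boundary (Suc n) (h f) + frag_extend h' (singular_differential n f) = G f - frag_of f"
  shows "twist (sw n) (sw n) G c - c \<in> twisted_boundaries (singular_basis X) sw singular_differential n"
proof -
  have f: "singular_simplex n X f" if "f \<in> Poly_Mapping.keys c" for f
    using c that by (auto simp: twisted_cycles_def)
  have 1: "sbd (Suc n) (twist (sw n) (sw (Suc n)) h c)
      = twist (sw n) (sw n) (\<lambda>f. frag_extend (singular_differential (Suc n)) (h f)) c"
    unfolding twisted_boundary_def diff_Suc_1
  proof (rule twist_twist)
    show "fits (sw (Suc n)) (sw n g) (h g)" if "g \<in> Poly_Mapping.keys c" for g
      using h[OF that] by blast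
    show "fits (sw n) (sw (Suc n) g) (singular_differential (Suc n) g)"
      if "f' \<in> Poly_Mapping.keys c" "g \<in> Poly_Mapping.keys (h f')" for f' g
      using h[OF that(1)] that(2) fits_singular_differential[of "Suc n" g] by (auto simp: singular_chain_def)
  qed
  have 2: "twist (sw (n - 1)) (sw n) h' (sbd n c)
      = twist (sw n) (sw n) (\<lambda>f. frag_extend h' (singular_differential n f)) c"
    unfolding twisted_boundary_def
    using fits_singular_differential f h' by (intro twist_twist) blast+
  have "twist (sw n) (sw n) G c - c = twist (sw n) (sw n) (\<lambda>f. G f - frag_of f) c"
    using based_complexD(1)[OF based_complex_singular[OF tame]] f by (simp add: twist_fun_diff twist_frag_of)
  also have "\<dots> = twist (sw n) (sw n) (\<lambda>f. frag_extend (singular_differential (Suc n)) (h f)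
      + frag_extend h' (singular_differential n f)) c"
    using eq by (intro twist_cong) (simp add: chain_boundary_eq_extend)
  also have "\<dots> = sbd (Suc n) (twist (sw n) (sw (Suc n)) h c)"
    using 1 2 c by (simp add: twist_fun_add twisted_cycles_def)
  finally have "twist (sw n) (sw n) G c - c = sbd (Suc n) (twist (sw n) (sw (Suc n)) h c)" .
  moreover have "Poly_Mapping.keys (twist (sw n) (sw (Suc n)) h c) \<subseteq> singular_basis X (Suc n)"
    using h by (intro keys_twist_subset) (simp add: singular_chain_def)
  ultimately show ?thesis
    unfolding twisted_boundaries_def by blast
qed

text \<open>The homotopy \<open>h\<close> takes chains of any space to chains of the same space.
  Applied to the image of a single simplex as a space, this keeps it inside that image, and so it
  fits the weights.\<close>

lemma subdivide_chain_homotopic: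
  assumes c: "c \<in> twisted_cycles (singular_basis X) sw singular_differential n"
  shows "subdivide_chain m n c - c \<in> twisted_boundaries (singular_basis X) sw singular_differential n"
proof -
  obtain h :: "nat \<Rightarrow> 'x chain \<Rightarrow> 'x chain" where h: "\<And>p. h p 0 = 0" "\<And>p c1 c2. h p (c1 - c2) = h p c1 - h p c2"
    "\<And>p X c. singular_chain p X c \<Longrightarrow> singular_chain (Suc p) X (h p c)"
    "\<And>p X c. singular_chain p X c \<Longrightarrow>
        chain_boundary (Suc p) (h p c) + h (p - Suc 0) (chain_boundary p c) = (singular_subdivision p ^^ m) c - c"
    using chain_homotopic_iterated_singular_subdivision[of m] by blast
  \<comment> \<open>A homotopy on whole chains is recovered from its values on single simplices, the
    form to which weights can be attached.\<close>
  have ext: "h p d = frag_extend (\<lambda>f. h p (frag_of f)) d" for p d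
  proof -
    have "Poly_Mapping.keys d \<subseteq> UNIV" by simp
    then show ?thesis
      by (induction d rule: frag_induction) (simp_all add: h(1,2) frag_extend_diff)
  qed
  have f: "singular_simplex n X f" if "f \<in> Poly_Mapping.keys c" for f
    using c that by (auto simp: twisted_cycles_def)
  have sub: "singular_chain (Suc p) (subtopology X (f ` standard_simplex p)) (h p (frag_of f))"
    if "singular_simplex p X f" for p f
    by (intro h(3) singular_simplex_own_image that)
  have fit: "fits (sw (Suc p)) (sw p f) (h p (frag_of f))" if "singular_simplex p X f" for p f
    by (rule fits_subspace[OF tame that sub[OF that]])
  show ?thesis
  proof (rule chain_homotopy_boundary[OF c, where h = "\<lambda>f. h n (frag_of f)"
        and h' = "\<lambda>f. if n = 0 then 0 else h (n - 1) (frag_of f)"])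
    fix f assume fc: "f \<in> Poly_Mapping.keys c"
    show "fits (sw (Suc n)) (sw n f) (h n (frag_of f)) \<and> singular_chain (Suc n) X (h n (frag_of f))"
      using fit[OF f[OF fc]] sub[OF f[OF fc]] singular_chain_subspace by blast
    show "fits (sw n) (sw (n - 1) g) (if n = 0 then 0 else h (n - 1) (frag_of g))"
      if "g \<in> Poly_Mapping.keys (singular_differential n f)" for g
      using fit[OF keys_singular_differential[OF f[OF fc] that]] by (cases n) auto
    have "frag_extend (\<lambda>f. if n = 0 then 0 else h (n - 1) (frag_of f)) (singular_differential n f)
        = h (n - Suc 0) (chain_boundary n (frag_of f))"
    proof (cases n)
      case 0
      then show ?thesis
        by (simp add: singular_differential_def chain_boundary_def h(1))
    next
      case (Suc k)
      then show ?thesis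
        by (simp add: ext[symmetric] singular_differential_def)
    qed
    then show "chain_boundary (Suc n) (h n (frag_of f))
        + frag_extend (\<lambda>f. if n = 0 then 0 else h (n - 1) (frag_of f)) (singular_differential n f)
        = subdivide m n f - frag_of f"
      using h(4)[of n X "frag_of f"] f[OF fc] by (simp add: singular_chain_of subdivide_def)
  qed
qed

end

section \<open>Comparison of ordered and singular chains\<close>

definition corner :: "nat \<Rightarrow> nat \<Rightarrow> real" where
  "corner i = (\<lambda>j. if j = i then 1 else 0)"

lemma corner_in_simplex: "i \<le> n \<Longrightarrow> corner i \<in> standard_simplex n"
  by (simp add: corner_def)

lemma simplical_face_corner: "simplical_face k (corner j) = corner (if j < k then j else Suc j)"
  by (auto simp: simplical_face_def corner_def fun_eq_iff)

lemma nth_list_face: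
  "k < length t \<Longrightarrow> j < length t - 1 \<Longrightarrow> list_face k t ! j = t ! (if j < k then j else Suc j)"
  by (simp add: list_face_def nth_append)

lemma sum_simplical_face:
  fixes g :: "nat \<Rightarrow> 'a::real_vector"
  assumes "k \<le> Suc m"
  shows "(\<Sum>i\<le>Suc m. simplical_face k y i *\<^sub>R g i) = (\<Sum>j\<le>m. y j *\<^sub>R g (if j < k then j else Suc j))"
proof -
  let ?s = "\<lambda>j. if j < k then j else Suc j"
  have inj: "inj_on ?s {..m}"
    by (auto simp: inj_on_def split: if_splits)
  have im: "?s ` {..m} = {..Suc m} - {k}"
  proof (intro equalityI subsetI)
    fix i assume i: "i \<in> {..Suc m} - {k}"
    show "i \<in> ?s ` {..m}"
    proof (cases "i < k")
      case True
      then show ?thesis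
        using i assms by (intro image_eqI[of _ _ i]) auto
    next
      case False
      then show ?thesis
        using i by (intro image_eqI[of _ _ "i - 1"]) auto
    qed
  qed auto
  have "(\<Sum>i\<le>Suc m. simplical_face k y i *\<^sub>R g i) = (\<Sum>i\<in>{..Suc m} - {k}. simplical_face k y i *\<^sub>R g i)"
    using assms by (intro sum.mono_neutral_right) (auto simp: simplical_face_def)
  also have "\<dots> = (\<Sum>j\<le>m. simplical_face k y (?s j) *\<^sub>R g (?s j))"
    unfolding im[symmetric] by (subst sum.reindex[OF inj]) (simp add: o_def)
  also have "\<dots> = (\<Sum>j\<le>m. y j *\<^sub>R g (?s j))"
    by (intro sum.cong) (auto simp: simplical_face_def)
  finally show ?thesis .
qed

lemma span_weight_singleton [simp]: "span_weight asc {m} = m"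
  by (simp add: span_weight_def)

section \<open>Linear simplices, vertex tuples and the straight-line homotopy\<close>

locale weighted_realization = realized_complex r K
  for r :: "'v \<Rightarrow> 'a::euclidean_space" and K :: "'v set set" +
  fixes asc :: bool and \<mu> :: "'v set \<Rightarrow> nat"
  assumes typed: "typed_weight asc K \<mu>"
begin

abbreviation "l \<equiv> point_weight r K \<mu>"
abbreviation "w \<equiv> tuple_weight asc \<mu>"

lemma weight_pos: "s \<in> K \<Longrightarrow> 0 < \<mu> s"
  using typed_weightD(1)[OF typed] by blast

lemma weight_divides_face: "s \<in> K \<Longrightarrow> t \<in> K \<Longrightarrow> t \<subseteq> s \<Longrightarrow> weight_divides asc (\<mu> t) (\<mu> s)"
  using typed_weightD(2)[OF typed] by (simp add: weight_divides_def)

text \<open>The image of a singular simplex is compact, so finitely many carriers occur in it, and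
  the weight of a point depends on its carrier only.\<close>

lemma tame_polyhedron: "tame ptop l"
  unfolding tame_def
proof (intro conjI ballI allI impI)
  show "0 < l x" if "x \<in> topspace ptop" for x
    using that carr_in_complex weight_pos by (simp add: topspace_polyhedron_topology point_weight_def)
  fix n f assume f: "singular_simplex n ptop f"
  have "compactin (simplex_space n) (standard_simplex n)"
    by (simp add: compactin_subtopology compactin_standard_simplex)
  then have "compactin ptop (f ` standard_simplex n)"
    using f image_compactin unfolding singular_simplex_def by blast
  then have "finite (\<mu> ` carr ` f ` standard_simplex n)"
    by (intro finite_imageI[of "carr ` f ` standard_simplex n"] compactin_finite_carriers)
  then show "finite (l ` f ` standard_simplex n)"
    by (simp add: image_image point_weight_def)
qed

abbreviation "sing_weight \<equiv> singular_weight asc l"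

definition linear_simplex :: "nat \<Rightarrow> 'v list \<Rightarrow> (nat \<Rightarrow> real) \<Rightarrow> 'a" where
  "linear_simplex n t = restrict (\<lambda>y. \<Sum>i\<le>n. y i *\<^sub>R r (t ! i)) (standard_simplex n)"

definition vertex_tuple :: "nat \<Rightarrow> ((nat \<Rightarrow> real) \<Rightarrow> 'a) \<Rightarrow> 'v list" where
  "vertex_tuple n f = map (\<lambda>i. top_vertex (f (corner i))) [0..<Suc n]"

text \<open>Smallness is measured by carriers and not by a metric, and it is inherited by faces.
  Corners are included among the points \<open>y\<close>, so the selected vertices span a
  simplex.\<close>

definition small :: "nat \<Rightarrow> ((nat \<Rightarrow> real) \<Rightarrow> 'a) \<Rightarrow> bool" where
  "small n f \<longleftrightarrow> singular_simplex n ptop f \<and>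
     (\<forall>i\<le>n. \<forall>y\<in>standard_simplex n. top_vertex (f (corner i)) \<in> carr (f y))"

lemma length_vertex_tuple [simp]: "length (vertex_tuple n f) = Suc n"
  by (simp add: vertex_tuple_def)

lemma nth_vertex_tuple: "i \<le> n \<Longrightarrow> vertex_tuple n f ! i = top_vertex (f (corner i))"
  by (simp add: vertex_tuple_def del: upt_Suc)

lemma set_vertex_tuple: "set (vertex_tuple n f) = (\<lambda>i. top_vertex (f (corner i))) ` {..n}"
  by (auto simp: vertex_tuple_def simp del: upt_Suc)

lemma linear_simplex_in_cell:
  assumes "y \<in> standard_simplex n" "length t = Suc n" "set t \<subseteq> s"
  shows "linear_simplex n t y \<in> cell s"
proof -
  have "(\<Sum>i\<le>n. y i *\<^sub>R r (t ! i)) \<in> cell s"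
  proof (rule convex_sum)
    show "r (t ! i) \<in> cell s" if "i \<in> {..n}" for i
      using that assms(2) subsetD[OF assms(3) nth_mem, of i] by (intro hull_inc imageI) simp
  qed (use assms(1) in \<open>auto simp: standard_simplex_def\<close>)
  then show ?thesis
    using assms(1) by (simp add: linear_simplex_def)
qed

lemma continuous_map_linear_simplex: "continuous_map (simplex_space n) euclidean (linear_simplex n t)"
proof -
  have "continuous_map (simplex_space n) euclidean (\<lambda>y. y i *\<^sub>R r (t ! i))" for i
    using continuous_map_compose[OF continuous_map_coordinate[of n i], of euclidean "\<lambda>c. c *\<^sub>R r (t ! i)"]
    by (simp add: o_def continuous_intros)
  then have "continuous_map (simplex_space n) euclidean (\<lambda>y. \<Sum>i\<le>n. y i *\<^sub>R r (t ! i))"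
    by (intro continuous_map_sum) auto
  then show ?thesis
    by (rule continuous_map_eq) (simp add: linear_simplex_def)
qed

lemma singular_linear_simplex:
  assumes "t \<in> tuples K n"
  shows "singular_simplex n ptop (linear_simplex n t)"
proof -
  have t: "length t = Suc n" "set t \<in> K"
    using assms by (auto simp: tuples_def)
  have "continuous_map (simplex_space n) (top_of_set (cell (set t))) (linear_simplex n t)"
    using continuous_map_linear_simplex linear_simplex_in_cell[OF _ t(1) order_refl]
    by (auto simp: continuous_map_in_subtopology)
  from continuous_map_compose[OF this continuous_map_cell_poly[OF t(2)]]
  have "continuous_map (simplex_space n) ptop (linear_simplex n t)"
    by (simp add: o_def)
  moreover have "linear_simplex n t \<in> extensional (standard_simplex n)"
    by (simp add: linear_simplex_def)
  ultimately show ?thesis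
    unfolding singular_simplex_def by blast
qed

lemma singular_face_linear_simplex:
  assumes "n \<noteq> 0" "k \<le> n" "length t = Suc n"
  shows "singular_face n k (linear_simplex n t) = linear_simplex (n - 1) (list_face k t)"
proof
  fix y
  obtain m where n: "n = Suc m"
    using assms(1) not0_implies_Suc by blast
  show "singular_face n k (linear_simplex n t) y = linear_simplex (n - 1) (list_face k t) y"
  proof (cases "y \<in> standard_simplex m")
    case True
    then have "simplical_face k y \<in> standard_simplex n"
      using simplical_face_in_standard_simplex[of n k y] assms n by simp
    moreover have "(\<Sum>j\<le>m. y j *\<^sub>R r (t ! (if j < k then j else Suc j))) = (\<Sum>j\<le>m. y j *\<^sub>R r (list_face k t ! j))"
      using assms n by (intro sum.cong refl) (simp add: nth_list_face)
    ultimately show ?thesis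
      using True n assms(2) sum_simplical_face[of k m y "\<lambda>i. r (t ! i)"]
      by (simp add: singular_face_def linear_simplex_def)
  qed (simp add: singular_face_def linear_simplex_def n)
qed

text \<open>Each vertex depends on its own corner alone, so the assignment commutes with faces. This
  makes it a chain map without any coherent choices.\<close>

lemma vertex_tuple_face:
  assumes "n \<noteq> 0" "k \<le> n"
  shows "vertex_tuple (n - 1) (singular_face n k f) = list_face k (vertex_tuple n f)"
proof (rule nth_equalityI)
  show "length (vertex_tuple (n - 1) (singular_face n k f)) = length (list_face k (vertex_tuple n f))"
    using assms by (simp add: length_list_face)
  fix j assume "j < length (vertex_tuple (n - 1) (singular_face n k f))"
  then have j: "j \<le> n - 1" by simp
  then have "singular_face n k f (corner j) = f (corner (if j < k then j else Suc j))"
    using corner_in_simplex[OF j] by (simp add: singular_face_def simplical_face_corner)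
  then show "vertex_tuple (n - 1) (singular_face n k f) ! j = list_face k (vertex_tuple n f) ! j"
    using assms j by (simp add: nth_vertex_tuple nth_list_face)
qed

lemma tuple_differential_eq_sum:
  assumes "length t = Suc n" "n \<noteq> 0"
  shows "tuple_differential n t = (\<Sum>k\<le>n. frag_cmul ((-1) ^ k) (frag_of (list_face k t)))"
  using assms by (simp add: tuple_differential_def tuple_boundary_eq_sum lessThan_Suc_atMost del: sum.lessThan_Suc)

lemma frag_extend_differential_sum:
  "frag_extend F (\<Sum>k\<le>n. frag_cmul ((-1) ^ k) (frag_of (g k))) = (\<Sum>k\<le>n. frag_cmul ((-1) ^ k) (F (g k)))"
  by (simp add: frag_extend_sum frag_extend_cmul o_def)

lemma tuple_differential_vertex_tuple:
  "tuple_differential n (vertex_tuple n f)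
    = frag_extend (\<lambda>g. frag_of (vertex_tuple (n - 1) g)) (singular_differential n f)"
proof (cases "n = 0")
  case False
  then show ?thesis
    by (simp add: tuple_differential_eq_sum singular_differential_def chain_boundary_of frag_extend_differential_sum
        vertex_tuple_face del: One_nat_def)
qed (simp add: tuple_differential_def singular_differential_def chain_boundary_of)

lemma singular_differential_linear_simplex:
  assumes "length t = Suc n"
  shows "singular_differential n (linear_simplex n t)
    = frag_extend (\<lambda>u. frag_of (linear_simplex (n - 1) u)) (tuple_differential n t)"
proof (cases "n = 0")
  case False
  then show ?thesis
    using assms by (simp add: tuple_differential_eq_sum singular_differential_def chain_boundary_of
        frag_extend_differential_sum singular_face_linear_simplex del: One_nat_def)
qed (simp add: tuple_differential_def singular_differential_def chain_boundary_of)

lemma small_face: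
  assumes "small n f" "n \<noteq> 0" "k \<le> n"
  shows "small (n - 1) (singular_face n k f)"
  unfolding small_def
proof (intro conjI allI impI ballI)
  show "singular_simplex (n - 1) ptop (singular_face n k f)"
    using assms singular_simplex_singular_face[of n ptop f k] by (simp add: small_def)
  fix i y assume i: "i \<le> n - 1" and y: "y \<in> standard_simplex (n - 1)"
  have "singular_face n k f (corner i) = f (corner (if i < k then i else Suc i))"
    using corner_in_simplex[OF i] by (simp add: singular_face_def simplical_face_corner)
  moreover have "singular_face n k f y = f (simplical_face k y)"
    using y by (simp add: singular_face_def)
  moreover have "simplical_face k y \<in> standard_simplex n"
    using y assms by (intro simplical_face_in_standard_simplex) auto
  ultimately show "top_vertex (singular_face n k f (corner i)) \<in> carr (singular_face n k f y)"
    using assms i by (simp add: small_def)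
qed

lemma keys_singular_differential_small:
  assumes "small n f" "g \<in> Poly_Mapping.keys (singular_differential n f)"
  shows "small (n - 1) g"
proof (cases "n = 0")
  case False
  then have "Poly_Mapping.keys (singular_differential n f) \<subseteq> (\<lambda>k. singular_face n k f) ` {..n}"
    unfolding singular_differential_def chain_boundary_of
    by (simp, intro order_trans[OF keys_sum]) (auto simp: keys_frag_of)
  then show ?thesis
    using assms False small_face by blast
qed (use assms in \<open>simp add: singular_differential_def chain_boundary_of\<close>)

lemma small_image:
  assumes "small n f" "y \<in> standard_simplex n"
  shows "f y \<in> underlying_set r K" "set (vertex_tuple n f) \<subseteq> carr (f y)" "carr (f y) \<in> K"
proof -
  show x: "f y \<in> underlying_set r K"
    using assms singular_simplex_image[of n ptop f] by (auto simp: small_def topspace_polyhedron_topology)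
  then show "carr (f y) \<in> K"
    by (rule carr_in_complex)
  show "set (vertex_tuple n f) \<subseteq> carr (f y)"
    using assms by (auto simp: set_vertex_tuple small_def)
qed

lemma vertex_tuple_in_tuples:
  assumes "small n f"
  shows "vertex_tuple n f \<in> tuples K n"
  using small_image[OF assms corner_in_simplex[of 0 n]] face_closed[of "carr (f (corner 0))" "set (vertex_tuple n f)"]
  by (simp add: tuples_def set_vertex_tuple)

text \<open>One point of the image is enough: the selected vertices span a face of the carrier at
  the first corner, and the weight there is among the values whose multiple or divisor is
  formed.\<close>

lemma fits_vertex_tuple:
  assumes f: "small n f"
  shows "fits w (sing_weight n f) (frag_of (vertex_tuple n f))"
proof -
  let ?y = "corner 0" and ?A = "l ` f ` standard_simplex n"
  have y: "?y \<in> standard_simplex n"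
    by (rule corner_in_simplex) simp
  have sing: "singular_simplex n ptop f"
    using f by (simp add: small_def)
  have V: "set (vertex_tuple n f) \<in> K"
    using vertex_tuple_in_tuples[OF f] by (simp add: tuples_def)
  have "weight_divides asc (\<mu> (set (vertex_tuple n f))) (l (f ?y))"
    unfolding point_weight_def using small_image[OF f y] V by (intro weight_divides_face)
  then have "\<forall>b\<in>{\<mu> (set (vertex_tuple n f))}. \<exists>a\<in>?A. weight_divides asc b a"
    using y by blast
  from span_weight_divides[OF this]
  have "if asc then \<mu> (set (vertex_tuple n f)) dvd span_weight asc ?A
      else span_weight asc ?A dvd \<mu> (set (vertex_tuple n f))"
    by (simp only: span_weight_singleton)
  from rat_weight_ratio[OF tame_span_weight_pos[OF tame_polyhedron sing] weight_pos[OF V] this]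
  show ?thesis
    by (simp add: tuple_weight_def singular_weight_def)
qed

text \<open>The image lies in the closed cell of \<open>set t\<close>, so each point has a face of
  \<open>set t\<close> as its carrier.\<close>

lemma fits_linear_simplex:
  assumes t: "t \<in> tuples K n"
  shows "fits (sing_weight n) (w t) (frag_of (linear_simplex n t))"
proof -
  let ?A = "l ` linear_simplex n t ` standard_simplex n"
  have tK: "length t = Suc n" "set t \<in> K"
    using t by (auto simp: tuples_def)
  have "\<forall>b\<in>?A. \<exists>a\<in>{\<mu> (set t)}. weight_divides asc b a"
  proof
    fix b assume "b \<in> ?A"
    then obtain y where y: "y \<in> standard_simplex n" "b = \<mu> (carr (linear_simplex n t y))"
      by (auto simp: point_weight_def)
    then have c: "linear_simplex n t y \<in> cell (set t)"
      using linear_simplex_in_cell[OF _ tK(1) order_refl] by blast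
    then have "carr (linear_simplex n t y) \<in> K"
      using carr_in_complex cell_subset_underlying[OF tK(2)] by blast
    then show "\<exists>a\<in>{\<mu> (set t)}. weight_divides asc b a"
      using weight_divides_face[OF tK(2) _ carr_subset[OF tK(2) c]] y(2) by simp
  qed
  from span_weight_divides[OF this]
  have "if asc then span_weight asc ?A dvd \<mu> (set t) else \<mu> (set t) dvd span_weight asc ?A"
    by (simp only: span_weight_singleton)
  from rat_weight_ratio[OF weight_pos[OF tK(2)]
      tame_span_weight_pos[OF tame_polyhedron singular_linear_simplex[OF t]] this]
  show ?thesis
    by (simp add: tuple_weight_def singular_weight_def)
qed

definition homotopy :: "nat \<Rightarrow> ((nat \<Rightarrow> real) \<Rightarrow> 'a) \<Rightarrow> real \<times> (nat \<Rightarrow> real) \<Rightarrow> 'a" where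
  "homotopy n f z = (1 - fst z) *\<^sub>R f (snd z) + fst z *\<^sub>R linear_simplex n (vertex_tuple n f) (snd z)"

lemma homotopy_in_cell:
  assumes f: "small n f" and "t \<in> {0..1}" "y \<in> standard_simplex n" "carr (f y) \<subseteq> s" "s \<in> K"
  shows "homotopy n f (t, y) \<in> cell s"
proof -
  have "f y \<in> cell s"
    using small_image[OF f assms(3)] assms mem_cell_iff_carr by blast
  moreover have "linear_simplex n (vertex_tuple n f) y \<in> cell s"
    using small_image(2)[OF f assms(3)] assms by (intro linear_simplex_in_cell) auto
  ultimately show ?thesis
    using assms(2) unfolding homotopy_def fst_conv snd_conv
    by (intro convexD[OF convex_convex_hull]) auto
qed

text \<open>Vector operations give continuity for the Euclidean topology only, and the target has
  the coherent one. Where \<open>f\<close> takes values in a fixed cell, the homotopy stays in that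
  cell, whose inclusion into the polyhedron is continuous. These sets are closed, and finitely many
  cover the cylinder because \<open>f\<close> meets finitely many carriers.\<close>

lemma continuous_map_homotopy:
  assumes f: "small n f"
  shows "continuous_map (cylinder n) ptop (homotopy n f)"
proof -
  have cf: "continuous_map (simplex_space n) ptop f"
    using f by (simp add: small_def singular_simplex_def)
  have fs: "continuous_map (cylinder n) ptop (\<lambda>z. f (snd z))"
    using continuous_map_compose[OF continuous_map_snd cf] by (simp add: o_def)
  have "continuous_map (cylinder n) euclidean (\<lambda>z. f (snd z))"
    using continuous_map_compose[OF fs continuous_map_poly_euclidean] by (simp add: o_def)
  moreover have "continuous_map (cylinder n) euclidean (\<lambda>z. linear_simplex n (vertex_tuple n f) (snd z))"
    using continuous_map_compose[OF continuous_map_snd continuous_map_linear_simplex] by (simp add: o_def)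
  moreover have "continuous_map (cylinder n) euclidean fst"
    using continuous_map_fst[of "top_of_set {0..1::real}" "simplex_space n"]
    by (simp add: continuous_map_in_subtopology)
  ultimately have pair: "continuous_map (cylinder n) (prod_topology euclidean (prod_topology euclidean euclidean))
      (\<lambda>z. (fst z, f (snd z), linear_simplex n (vertex_tuple n f) (snd z)))"
    by (simp add: continuous_map_pairwise o_def del: prod_topology_euclidean)
  have comb: "continuous_map (prod_topology euclidean (prod_topology euclidean euclidean)) euclidean
      (\<lambda>z. (1 - fst z) *\<^sub>R fst (snd z) + fst z *\<^sub>R (snd (snd z) :: 'a))"
    unfolding prod_topology_euclidean continuous_map_iff_continuous2
    by (intro continuous_intros)
  have "homotopy n f = (\<lambda>z. (1 - fst z) *\<^sub>R fst (snd z) + fst z *\<^sub>R snd (snd z))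
      \<circ> (\<lambda>z. (fst z, f (snd z), linear_simplex n (vertex_tuple n f) (snd z)))"
    by (simp add: fun_eq_iff homotopy_def)
  then have he: "continuous_map (cylinder n) euclidean (homotopy n f)"
    using continuous_map_compose[OF pair comb] by simp
  have "compactin ptop (f ` standard_simplex n)"
    using image_compactin[OF _ cf] by (simp add: compactin_subtopology compactin_standard_simplex)
  then have fin: "finite (carr ` f ` standard_simplex n)"
    by (rule compactin_finite_carriers)
  show ?thesis
  proof (rule pasting_lemma_closed[OF fin, where T = "\<lambda>s. {z \<in> topspace (cylinder n). f (snd z) \<in> cell s}"
        and f = "\<lambda>s. homotopy n f"])
    fix s assume "s \<in> carr ` f ` standard_simplex n"
    then have s: "s \<in> K"
      using small_image[OF f] by blast
    show "closedin (cylinder n) {z \<in> topspace (cylinder n). f (snd z) \<in> cell s}"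
      by (rule closedin_continuous_map_preimage[OF fs closedin_cell[OF s]])
    have "continuous_map (subtopology (cylinder n) {z \<in> topspace (cylinder n). f (snd z) \<in> cell s})
        (top_of_set (cell s)) (homotopy n f)"
      unfolding continuous_map_in_subtopology
    proof
      show "continuous_map (subtopology (cylinder n) {z \<in> topspace (cylinder n). f (snd z) \<in> cell s})
          euclidean (homotopy n f)"
        by (rule continuous_map_from_subtopology[OF he])
      show "homotopy n f \<in> topspace (subtopology (cylinder n) {z \<in> topspace (cylinder n). f (snd z) \<in> cell s}) \<rightarrow> cell s"
        using homotopy_in_cell[OF f _ _ carr_subset[OF s] s] by auto
    qed
    from continuous_map_compose[OF this continuous_map_cell_poly[OF s]]
    show "continuous_map (subtopology (cylinder n) {z \<in> topspace (cylinder n). f (snd z) \<in> cell s}) ptop (homotopy n f)"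
      by (simp add: o_def)
  next
    fix z assume z: "z \<in> topspace (cylinder n)"
    then have "snd z \<in> standard_simplex n"
      by auto
    then show "\<exists>s. s \<in> carr ` f ` standard_simplex n \<and> z \<in> {z \<in> topspace (cylinder n). f (snd z) \<in> cell s}
        \<and> homotopy n f z = homotopy n f z"
      using z small_image(1)[OF f] mem_cell_carr by blast
  qed auto
qed

lemma homotopy_face:
  assumes "n \<noteq> 0" "k \<le> n" "y \<in> standard_simplex (n - 1)"
  shows "homotopy n f (t, simplical_face k y) = homotopy (n - 1) (singular_face n k f) (t, y)"
proof -
  have "linear_simplex n (vertex_tuple n f) (simplical_face k y)
      = singular_face n k (linear_simplex n (vertex_tuple n f)) y"
    using assms by (simp add: singular_face_def)
  also have "\<dots> = linear_simplex (n - 1) (vertex_tuple (n - 1) (singular_face n k f)) y"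
    using assms singular_face_linear_simplex[OF assms(1,2), of "vertex_tuple n f"]
    by (simp add: vertex_tuple_face del: One_nat_def)
  finally show ?thesis
    using assms(3) by (simp add: homotopy_def singular_face_def[of n k f])
qed

end

section \<open>Comparison maps between tuples and small singular chains\<close>

context weighted_realization
begin

abbreviation "tbd \<equiv> twisted_boundary (\<lambda>n. w) tuple_differential"
abbreviation "sing_bd \<equiv> twisted_boundary sing_weight singular_differential"
abbreviation "tuple_cycles \<equiv> twisted_cycles (tuples K) (\<lambda>n. w) tuple_differential"
abbreviation "tuple_boundaries \<equiv> twisted_boundaries (tuples K) (\<lambda>n. w) tuple_differential"
abbreviation "sing_cycles \<equiv> twisted_cycles (singular_basis ptop) sing_weight singular_differential"
abbreviation "sing_boundaries \<equiv> twisted_boundaries (singular_basis ptop) sing_weight singular_differential"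
abbreviation "realize_chain n \<equiv> twist w (sing_weight n) (\<lambda>t. frag_of (linear_simplex n t))"
abbreviation "vertex_chain n \<equiv> twist (sing_weight n) w (\<lambda>f. frag_of (vertex_tuple n f))"
abbreviation "sub_chain m n \<equiv> twist (sing_weight n) (sing_weight n) (subdivide m n)"

lemma based_tuples: "based_complex (tuples K) (\<lambda>n. w) tuple_differential"
  by (rule based_complex_tuples[OF typed])

lemma based_singular: "based_complex (singular_basis ptop) sing_weight singular_differential"
  by (rule based_complex_singular[OF tame_polyhedron])

text \<open>The model prism is pushed forward along the straight-line homotopy. The homotopy
  restricts to that of each face, so the sides of the prism become the operator in the degree
  below.\<close>

lemma prism_homotopy:
  obtains D where
    "\<And>n f. small n f \<Longrightarrow> singular_chain (Suc n) ptop (D n f)"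
    "\<And>n f. small n f \<Longrightarrow> fits (sing_weight (Suc n)) (sing_weight n f) (D n f)"
    "\<And>n f. small n f \<Longrightarrow> chain_boundary (Suc n) (D n f) + frag_extend (D (n - 1)) (singular_differential n f)
        = frag_of (linear_simplex n (vertex_tuple n f)) - frag_of f"
proof -
  obtain Q where Q: "\<And>n. prism_step n (Q (n - 1)) (Q n)"
    using prism_exists by blast
  define D where "D = (\<lambda>n f. chain_map (Suc n) (homotopy n f) (Q n))"
  have q: "singular_chain (Suc n) (cylinder n) (Q n)" for n
    using Q[of n] by (simp add: prism_step_def)
  have sub: "singular_chain (Suc n) (subtopology ptop (homotopy n f ` topspace (cylinder n))) (D n f)"
    if f: "small n f" for n f
    unfolding D_def
  proof (rule singular_chain_chain_map[OF q])
    show "continuous_map (cylinder n) (subtopology ptop (homotopy n f ` topspace (cylinder n))) (homotopy n f)"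
      using continuous_map_homotopy[OF f] by (simp add: continuous_map_in_subtopology)
  qed
  show thesis
  proof (rule that[of D])
    fix n f assume f: "small n f"
    have sing: "singular_simplex n ptop f"
      using f by (simp add: small_def)
    show "singular_chain (Suc n) ptop (D n f)"
      by (rule singular_chain_subspace[OF sub[OF f]])
    show "fits (sing_weight (Suc n)) (sing_weight n f) (D n f)"
      unfolding fits_def
    proof
      fix g assume "g \<in> Poly_Mapping.keys (D n f)"
      then have g: "singular_simplex (Suc n) ptop g"
        "g ` standard_simplex (Suc n) \<subseteq> homotopy n f ` topspace (cylinder n)"
        using sub[OF f, unfolded singular_chain_subtopology] unfolding singular_chain_def by blast+
      \<comment> \<open>At time \<open>t\<close> the point \<open>y\<close> has moved inside the
        closed cell of the carrier of \<open>f y\<close>; its new carrier is a face of the old one,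
        and its weight is dominated by that of \<open>f y\<close>.\<close>
      have "\<forall>x\<in>g ` standard_simplex (Suc n). \<exists>y\<in>f ` standard_simplex n. weight_divides asc (l x) (l y)"
      proof
        fix x assume "x \<in> g ` standard_simplex (Suc n)"
        then obtain z where z: "z \<in> topspace (cylinder n)" "x = homotopy n f z"
          using g(2) by blast
        define t y where "t = fst z" and "y = snd z"
        have ty: "t \<in> {0..1}" "y \<in> standard_simplex n" "x = homotopy n f (t, y)"
          using z by (auto simp: t_def y_def)
        note c = small_image(3)[OF f ty(2)]
        have x: "x \<in> cell (carr (f y))"
          unfolding ty(3) by (rule homotopy_in_cell[OF f ty(1,2) order_refl c])
        then have "carr x \<in> K"
          using carr_in_complex cell_subset_underlying[OF c] by blast
        then have "weight_divides asc (l x) (l (f y))"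
          unfolding point_weight_def using carr_subset[OF c x] c by (intro weight_divides_face)
        then show "\<exists>y\<in>f ` standard_simplex n. weight_divides asc (l x) (l y)"
          using ty(2) by blast
      qed
      then show "sing_weight (Suc n) g \<noteq> 0 \<and> sing_weight n f / sing_weight (Suc n) g \<in> \<int>"
        using singular_weight_ratio[OF tame_polyhedron sing g(1)] by blast
    qed
    let ?i = "frag_of (identity_simplex n)"
    have "chain_boundary (Suc n) (D n f) = chain_map n (homotopy n f) (chain_boundary (Suc n) (Q n))"
      unfolding D_def using chain_boundary_chain_map[OF q] by simp
    also have "\<dots> = chain_map n (homotopy n f) (chain_map n (Pair 1) ?i)
        - chain_map n (homotopy n f) (chain_map n (Pair 0) ?i)
        - chain_map n (homotopy n f) (cylinder_chain (n - 1) (Q (n - 1)) (chain_boundary n ?i))"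
      using Q[of n] by (simp only: prism_step_def chain_map_diff)
    also have "chain_map n (homotopy n f) (chain_map n (Pair 1) ?i) = frag_of (linear_simplex n (vertex_tuple n f))"
    proof -
      have "simplex_map n (homotopy n f) (simplex_map n (Pair 1) (identity_simplex n)) = linear_simplex n (vertex_tuple n f)"
        by (auto simp: simplex_map_def homotopy_def linear_simplex_def fun_eq_iff)
      then show ?thesis by simp
    qed
    also have "chain_map n (homotopy n f) (chain_map n (Pair 0) ?i) = frag_of f"
    proof -
      \<comment> \<open>At time 0 the homotopy is \<open>f\<close> over the simplex; elsewhere both
        sides are \<open>undefined\<close>, as \<open>f\<close> is extensional.\<close>
      have "simplex_map n (homotopy n f) (simplex_map n (Pair 0) (identity_simplex n)) = f"
      proof
        fix y
        show "simplex_map n (homotopy n f) (simplex_map n (Pair 0) (identity_simplex n)) y = f y"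
          using sing by (cases "y \<in> standard_simplex n")
            (auto simp: simplex_map_def homotopy_def singular_simplex_def extensional_def)
      qed
      then show ?thesis by simp
    qed
    also have "chain_map n (homotopy n f) (cylinder_chain (n - 1) (Q (n - 1)) (chain_boundary n ?i))
        = frag_extend (D (n - 1)) (singular_differential n f)"
    proof (cases "n = 0")
      case False
      have "chain_map n (homotopy n f) (chain_map n (apsnd (singular_face n k (identity_simplex n))) (Q (n - 1)))
          = chain_map n (homotopy (n - 1) (singular_face n k f)) (Q (n - 1))" if k: "k \<le> n" for k
      proof -
        have q': "singular_chain n (cylinder (n - 1)) (Q (n - 1))"
          using q[of "n - 1"] False by simp
        have "chain_map n (homotopy n f) (chain_map n (apsnd (singular_face n k (identity_simplex n))) (Q (n - 1)))
            = chain_map n (homotopy n f \<circ> apsnd (singular_face n k (identity_simplex n))) (Q (n - 1))"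
          by (simp add: chain_map_compose)
        also have "\<dots> = chain_map n (homotopy (n - 1) (singular_face n k f)) (Q (n - 1))"
        proof (rule chain_map_eq[OF q'])
          fix z assume "z \<in> topspace (cylinder (n - 1))"
          then have y: "snd z \<in> standard_simplex (n - 1)"
            by auto
          then have "simplical_face k (snd z) \<in> standard_simplex n"
            using False k by (intro simplical_face_in_standard_simplex) auto
          then have "apsnd (singular_face n k (identity_simplex n)) z = (fst z, simplical_face k (snd z))"
            using y by (simp add: singular_face_def prod_eq_iff)
          then show "(homotopy n f \<circ> apsnd (singular_face n k (identity_simplex n))) z
              = homotopy (n - 1) (singular_face n k f) z"
            using homotopy_face[OF False k y, of f "fst z"] by simp
        qed
        finally show ?thesis .
      qed
      then show ?thesis
        using False by (simp add: cylinder_chain_def chain_boundary_of singular_differential_def frag_extend_differential_sum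
            chain_map_sum D_def o_def del: restrict_apply)
    qed (simp add: chain_boundary_of cylinder_chain_def singular_differential_def)
    finally show "chain_boundary (Suc n) (D n f) + frag_extend (D (n - 1)) (singular_differential n f)
        = frag_of (linear_simplex n (vertex_tuple n f)) - frag_of f"
      by simp
  qed
qed

lemma realize_chain_boundary:
  assumes c: "Poly_Mapping.keys c \<subseteq> tuples K n"
  shows "sing_bd n (realize_chain n c) = realize_chain (n - 1) (tbd n c)"
proof -
  have t: "t \<in> tuples K n" if "t \<in> Poly_Mapping.keys c" for t
    using c that by blast
  have "sing_bd n (realize_chain n c)
      = twist w (sing_weight (n - 1)) (\<lambda>t. frag_extend (singular_differential n) (frag_of (linear_simplex n t))) c"
    unfolding twisted_boundary_def
    using t fits_linear_simplex based_complexD(3)[OF based_singular] singular_linear_simplex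
    by (intro twist_twist) (auto simp: keys_frag_of)
  also have "\<dots> = twist w (sing_weight (n - 1))
      (\<lambda>t. frag_extend (\<lambda>u. frag_of (linear_simplex (n - 1) u)) (tuple_differential n t)) c"
    using t by (intro twist_cong) (auto simp: singular_differential_linear_simplex tuples_def)
  also have "\<dots> = realize_chain (n - 1) (tbd n c)"
    unfolding twisted_boundary_def
  proof (rule twist_twist[symmetric])
    fix u v assume u: "u \<in> Poly_Mapping.keys c"
    show "fits w (w u) (tuple_differential n u)"
      by (rule based_complexD(3)[OF based_tuples t[OF u]])
    assume "v \<in> Poly_Mapping.keys (tuple_differential n u)"
    then show "fits (sing_weight (n - 1)) (w v) (frag_of (linear_simplex (n - 1) v))"
      using based_complexD(2)[OF based_tuples t[OF u]] fits_linear_simplex by blast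
  qed
  finally show ?thesis .
qed

lemma vertex_chain_boundary:
  assumes c: "\<And>f. f \<in> Poly_Mapping.keys c \<Longrightarrow> small n f"
  shows "tbd n (vertex_chain n c) = vertex_chain (n - 1) (sing_bd n c)"
proof -
  have "tbd n (vertex_chain n c)
      = twist (sing_weight n) w (\<lambda>f. frag_extend (tuple_differential n) (frag_of (vertex_tuple n f))) c"
    unfolding twisted_boundary_def
    using c fits_vertex_tuple based_complexD(3)[OF based_tuples] vertex_tuple_in_tuples
    by (intro twist_twist) (auto simp: keys_frag_of)
  also have "\<dots> = twist (sing_weight n) w
      (\<lambda>f. frag_extend (\<lambda>g. frag_of (vertex_tuple (n - 1) g)) (singular_differential n f)) c"
    by (simp only: frag_extend_of tuple_differential_vertex_tuple)
  also have "\<dots> = vertex_chain (n - 1) (sing_bd n c)"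
    unfolding twisted_boundary_def
  proof (rule twist_twist[symmetric])
    fix f g assume f: "f \<in> Poly_Mapping.keys c"
    have "singular_simplex n ptop f"
      using c[OF f] by (simp add: small_def)
    then show "fits (sing_weight (n - 1)) (sing_weight n f) (singular_differential n f)"
      using based_complexD(3)[OF based_singular, of f n] by simp
    assume "g \<in> Poly_Mapping.keys (singular_differential n f)"
    then show "fits w (sing_weight (n - 1) g) (frag_of (vertex_tuple (n - 1) g))"
      by (intro fits_vertex_tuple keys_singular_differential_small[OF c[OF f]])
  qed
  finally show ?thesis .
qed

lemma keys_realize_chain:
  "Poly_Mapping.keys c \<subseteq> tuples K n \<Longrightarrow> Poly_Mapping.keys (realize_chain n c) \<subseteq> singular_basis ptop n"
  using singular_linear_simplex by (intro keys_twist_subset) (auto simp: keys_frag_of)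

lemma keys_vertex_chain:
  "(\<And>f. f \<in> Poly_Mapping.keys c \<Longrightarrow> small n f) \<Longrightarrow> Poly_Mapping.keys (vertex_chain n c) \<subseteq> tuples K n"
  using vertex_tuple_in_tuples by (intro keys_twist_subset) (auto simp: keys_frag_of)

lemma realize_vertex_homotopic:
  assumes c: "c \<in> sing_cycles n" and small: "\<And>f. f \<in> Poly_Mapping.keys c \<Longrightarrow> small n f"
  shows "realize_chain n (vertex_chain n c) - c \<in> sing_boundaries n"
proof -
  obtain D where D: "\<And>n f. small n f \<Longrightarrow> singular_chain (Suc n) ptop (D n f)"
    "\<And>n f. small n f \<Longrightarrow> fits (sing_weight (Suc n)) (sing_weight n f) (D n f)"
    "\<And>n f. small n f \<Longrightarrow> chain_boundary (Suc n) (D n f) + frag_extend (D (n - 1)) (singular_differential n f)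
        = frag_of (linear_simplex n (vertex_tuple n f)) - frag_of f"
    using prism_homotopy by blast
  have "realize_chain n (vertex_chain n c)
      = twist (sing_weight n) (sing_weight n) (\<lambda>f. frag_of (linear_simplex n (vertex_tuple n f))) c"
  proof -
    have "realize_chain n (vertex_chain n c) = twist (sing_weight n) (sing_weight n)
        (\<lambda>f. frag_extend (\<lambda>t. frag_of (linear_simplex n t)) (frag_of (vertex_tuple n f))) c"
      using small fits_vertex_tuple fits_linear_simplex vertex_tuple_in_tuples
      by (intro twist_twist) (auto simp: keys_frag_of)
    then show ?thesis by simp
  qed
  moreover have "twist (sing_weight n) (sing_weight n) (\<lambda>f. frag_of (linear_simplex n (vertex_tuple n f))) c - c
      \<in> sing_boundaries n"
  proof (rule chain_homotopy_boundary[OF tame_polyhedron c, where h = "D n" and h' = "\<lambda>g. if n = 0 then 0 else D (n - 1) g"])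
    fix f assume f: "f \<in> Poly_Mapping.keys c"
    show "fits (sing_weight (Suc n)) (sing_weight n f) (D n f) \<and> singular_chain (Suc n) ptop (D n f)"
      using D(1,2) small[OF f] by blast
    show "fits (sing_weight n) (sing_weight (n - 1) g) (if n = 0 then 0 else D (n - 1) g)"
      if "g \<in> Poly_Mapping.keys (singular_differential n f)" for g
      using D(2)[OF keys_singular_differential_small[OF small[OF f] that]] by (cases n) auto
    have "frag_extend (\<lambda>g. if n = 0 then 0 else D (n - 1) g) (singular_differential n f)
        = frag_extend (D (n - 1)) (singular_differential n f)"
      by (cases "n = 0") (simp_all add: singular_differential_def chain_boundary_of)
    then show "chain_boundary (Suc n) (D n f) + frag_extend (\<lambda>g. if n = 0 then 0 else D (n - 1) g) (singular_differential n f)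
        = frag_of (linear_simplex n (vertex_tuple n f)) - frag_of f"
      using D(3)[OF small[OF f]] by simp
  qed
  ultimately show ?thesis by simp
qed

lemma eventually_small:
  assumes "finite S" "\<And>f. f \<in> S \<Longrightarrow> singular_simplex n ptop f"
  shows "\<exists>N. \<forall>m\<ge>N. \<forall>f\<in>S. \<forall>g\<in>Poly_Mapping.keys (subdivide m n f). small n g"
  using assms
proof (induction S)
  case (insert f S)
  then obtain N where N: "\<forall>m\<ge>N. \<forall>f\<in>S. \<forall>g\<in>Poly_Mapping.keys (subdivide m n f). small n g"
    by auto
  define \<C> where "\<C> = {V. openin ptop V \<and> (\<forall>y\<in>V. \<forall>z\<in>V. top_vertex y \<in> carr z)}"
  have f: "singular_simplex n ptop f"
    using insert.prems by simp
  have "topspace ptop \<subseteq> \<Union>\<C>"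
  proof
    fix x assume "x \<in> topspace ptop"
    then obtain V where "openin ptop V" "x \<in> V" "\<And>y z. y \<in> V \<Longrightarrow> z \<in> V \<Longrightarrow> top_vertex y \<in> carr z"
      using small_neighbourhood[of x] by (auto simp: topspace_polyhedron_topology)
    then show "x \<in> \<Union>\<C>"
      unfolding \<C>_def by blast
  qed
  moreover have "openin ptop U" if "U \<in> \<C>" for U
    using that by (simp add: \<C>_def)
  moreover have "singular_chain n ptop (frag_of f)"
    using f by (simp add: singular_chain_of)
  ultimately obtain M where M: "\<And>m g. M \<le> m \<Longrightarrow> g \<in> Poly_Mapping.keys ((singular_subdivision n ^^ m) (frag_of f))
      \<Longrightarrow> \<exists>V\<in>\<C>. g \<in> standard_simplex n \<rightarrow> V"
    using sufficient_iterated_singular_subdivision_exists[of \<C> ptop n "frag_of f"] by blast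
  have "small n g" if g: "M \<le> m" "g \<in> Poly_Mapping.keys (subdivide m n f)" for m g
  proof -
    obtain V where V: "V \<in> \<C>" "g \<in> standard_simplex n \<rightarrow> V"
      using M[of m g] g by (auto simp: subdivide_def)
    then have "top_vertex (g (corner i)) \<in> carr (g y)" if "i \<le> n" "y \<in> standard_simplex n" for i y
      using that corner_in_simplex[OF that(1)] unfolding \<C>_def by blast
    then show ?thesis
      using keys_subdivide(1)[OF f g(2)] by (simp add: small_def)
  qed
  then have "\<forall>m\<ge>max M N. \<forall>f'\<in>insert f S. \<forall>g\<in>Poly_Mapping.keys (subdivide m n f'). small n g"
    using N by (metis insertE max.boundedE)
  then show ?case ..
qed simp

lemma keys_sub_chain: "g \<in> Poly_Mapping.keys (sub_chain m n c) \<Longrightarrow> \<exists>f\<in>Poly_Mapping.keys c. g \<in> Poly_Mapping.keys (subdivide m n f)"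
  using keys_twist[of "sing_weight n" "sing_weight n" "subdivide m n" c] by blast

text \<open>The round trip from a tuple to its linear simplex, through subdivision, and back to
  vertices. The empty tuple is fixed, which makes the map compatible with the augmentation.\<close>

definition subdivided_tuple :: "nat \<Rightarrow> 'v list \<Rightarrow> ('v list \<Rightarrow>\<^sub>0 int)" where
  "subdivided_tuple m t = (if t = [] then frag_of [] else
     frag_extend (\<lambda>g. frag_of (vertex_tuple (length t - 1) g))
       (subdivide m (length t - 1) (linear_simplex (length t - 1) t)))"

lemma subdivide_0:
  assumes "singular_simplex 0 ptop f"
  shows "subdivide m 0 f = frag_of f"
proof (induction m)
  case (Suc m)
  then show ?case
    using assms by (simp add: subdivide_def singular_subdivision_zero[of ptop] singular_chain_of)
qed (simp add: subdivide_def)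

lemma subdivided_tuple_boundary:
  assumes "set t \<in> K"
  shows "frag_extend tuple_boundary (subdivided_tuple m t) = frag_extend (subdivided_tuple m) (tuple_boundary t)"
proof -
  have "t \<noteq> []"
    using assms simplex_finite(2) by auto
  then obtain n where n: "length t = Suc n"
    by (cases t) auto
  then have t: "t \<in> tuples K n"
    using assms by (simp add: tuples_def)
  let ?L = "linear_simplex n t" and ?V = "\<lambda>n g. frag_of (vertex_tuple n g)"
  have sub: "subdivided_tuple m t = frag_extend (?V n) (subdivide m n ?L)"
    using n \<open>t \<noteq> []\<close> by (simp add: subdivided_tuple_def)
  show ?thesis
  proof (cases "n = 0")
    case True
    then obtain v where "t = [v]"
      using n by (auto simp: length_Suc_conv)
    \<comment> \<open>A point is not changed by subdivision, and the augmented boundary of any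
      single vertex is the empty tuple.\<close>
    moreover have "frag_extend tuple_boundary (subdivided_tuple m t) = frag_of []"
      using True sub subdivide_0[of ?L m] singular_linear_simplex[OF t] by (simp add: vertex_tuple_def)
    ultimately show ?thesis
      by (simp add: subdivided_tuple_def)
  next
    case False
    have "frag_extend tuple_boundary (subdivided_tuple m t)
        = frag_extend (\<lambda>g. tuple_differential n (vertex_tuple n g)) (subdivide m n ?L)"
      using False by (simp add: sub frag_extend_extend tuple_differential_def)
    also have "\<dots> = frag_extend (?V (n - 1)) (chain_boundary n (subdivide m n ?L))"
      by (simp add: tuple_differential_vertex_tuple chain_boundary_eq_extend frag_extend_extend)
    also have "chain_boundary n (subdivide m n ?L)
        = (singular_subdivision (n - 1) ^^ m) (chain_boundary n (frag_of ?L))"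
      unfolding subdivide_def using singular_linear_simplex[OF t]
      by (intro chain_boundary_subdivision_power[of n ptop]) (simp add: singular_chain_of)
    also have "\<dots> = frag_extend (subdivide m (n - 1)) (frag_extend (\<lambda>u. frag_of (linear_simplex (n - 1) u)) (tuple_boundary t))"
      using singular_differential_linear_simplex[OF n] False
      by (simp add: subdivision_power_eq_extend singular_differential_def tuple_differential_def)
    also have "frag_extend (?V (n - 1)) \<dots>
        = frag_extend (\<lambda>u. frag_extend (?V (n - 1)) (subdivide m (n - 1) (linear_simplex (n - 1) u))) (tuple_boundary t)"
      by (simp add: frag_extend_extend)
    also have "\<dots> = frag_extend (subdivided_tuple m) (tuple_boundary t)"
    proof (rule frag_extend_eq)
      fix u assume "u \<in> Poly_Mapping.keys (tuple_boundary t)"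
      then have "length u = n"
        using keys_tuple_boundary[of t] n by (auto simp: length_list_face)
      then show "frag_extend (?V (n - 1)) (subdivide m (n - 1) (linear_simplex (n - 1) u)) = subdivided_tuple m u"
        using False by (auto simp: subdivided_tuple_def)
    qed
    finally show ?thesis .
  qed
qed

text \<open>Subdivision stays in the closed cell of \<open>set t\<close>, and a vertex of largest
  coordinate belongs to the carrier of its point, a face of \<open>set t\<close>. No smallness
  enters.\<close>

lemma keys_subdivided_tuple:
  assumes "set t \<in> K"
  shows "Poly_Mapping.keys (subdivided_tuple m t) \<subseteq> {u. set u \<subseteq> set t \<and> length u = length t}"
proof -
  have ne: "t \<noteq> []"
    using assms simplex_finite(2) by auto
  then obtain n where n: "length t = Suc n"
    by (cases t) auto
  then have t: "t \<in> tuples K n"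
    using assms by (simp add: tuples_def)
  have "set (vertex_tuple n g) \<subseteq> set t"
    if g: "g \<in> Poly_Mapping.keys (subdivide m n (linear_simplex n t))" for g
  proof -
    have "top_vertex (g (corner i)) \<in> set t" if i: "i \<le> n" for i
    proof -
      obtain y where y: "y \<in> standard_simplex n" "g (corner i) = linear_simplex n t y"
        using keys_subdivide(2)[OF singular_linear_simplex[OF t] g] corner_in_simplex[OF i] by blast
      then have c: "g (corner i) \<in> cell (set t)"
        using linear_simplex_in_cell[OF _ n order_refl] by simp
      then show ?thesis
        using top_vertex_in_carr carr_subset[OF assms c] cell_subset_underlying[OF assms] by blast
    qed
    then show ?thesis
      by (auto simp: set_vertex_tuple)
  qed
  then show ?thesis
    using ne n by (simp add: subdivided_tuple_def) (intro keys_extend_subset; auto simp: keys_frag_of)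
qed

text \<open>The isomorphism is induced by linear simplices. For injectivity a bounding singular
  chain is subdivided and turned into tuples, and the round trip is homotopic to the identity by
  carriers; for surjectivity a cycle is homologous to its subdivision, and that to the linear
  simplices on its vertices.\<close>

theorem tuple_homology_iso_singular:
  "twisted_homology (tuples K) (\<lambda>n. w) tuple_differential n
    \<cong> twisted_homology (singular_basis ptop) sing_weight singular_differential n"
proof (rule twisted_homology_iso_criterion[OF based_tuples based_singular])
  show "realize_chain n (x + y) = realize_chain n x + realize_chain n y" for x y
    by (rule twist_add)
  show "realize_chain n x \<in> sing_cycles n" if "x \<in> tuple_cycles n" for x
    using that realize_chain_boundary[of x n] keys_realize_chain[of x n] by (simp add: twisted_cycles_def)
  show "realize_chain n x \<in> sing_boundaries n" if x: "x \<in> tuple_boundaries n" for x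
  proof -
    obtain b where b: "Poly_Mapping.keys b \<subseteq> tuples K (Suc n)" "x = tbd (Suc n) b"
      using x unfolding twisted_boundaries_def by blast
    then have "realize_chain n x = sing_bd (Suc n) (realize_chain (Suc n) b)"
      using realize_chain_boundary[of b "Suc n"] by simp
    then show ?thesis
      using keys_realize_chain[OF b(1)] unfolding twisted_boundaries_def by blast
  qed
  show "x \<in> tuple_boundaries n" if x: "x \<in> tuple_cycles n" and rx: "realize_chain n x \<in> sing_boundaries n" for x
  proof -
    obtain y where y: "Poly_Mapping.keys y \<subseteq> singular_basis ptop (Suc n)" "realize_chain n x = sing_bd (Suc n) y"
      using rx unfolding twisted_boundaries_def by blast
    have xt: "t \<in> tuples K n" if "t \<in> Poly_Mapping.keys x" for t
      using x that by (auto simp: twisted_cycles_def)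
    obtain N1 where N1: "\<forall>m\<ge>N1. \<forall>f\<in>linear_simplex n ` Poly_Mapping.keys x.
        \<forall>g\<in>Poly_Mapping.keys (subdivide m n f). small n g"
      using eventually_small[OF finite_imageI[OF finite_keys], of "linear_simplex n" x n] xt singular_linear_simplex by auto
    obtain N2 where N2: "\<forall>m\<ge>N2. \<forall>f\<in>Poly_Mapping.keys y.
        \<forall>g\<in>Poly_Mapping.keys (subdivide m (Suc n) f). small (Suc n) g"
      using eventually_small[OF finite_keys, of y "Suc n"] y(1) by auto
    \<comment> \<open>Both sides of the equation that exhibits \<open>realize_chain n x\<close> as a
      boundary must be subdivided equally often.\<close>
    define m where "m = max N1 N2"
    have m: "N1 \<le> m" "N2 \<le> m"
      by (simp_all add: m_def)
    have s1: "small n g" if "t \<in> Poly_Mapping.keys x" "g \<in> Poly_Mapping.keys (subdivide m n (linear_simplex n t))" for t g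
      by (rule N1[rule_format, OF m(1) imageI[OF that(1)] that(2)])
    have s2: "small (Suc n) g" if "g \<in> Poly_Mapping.keys (sub_chain m (Suc n) y)" for g
      using keys_sub_chain[OF that] N2 m(2) by blast
    have L: "fits (sing_weight n) (sing_weight n (linear_simplex n t)) (subdivide m n (linear_simplex n t))"
      if "t \<in> Poly_Mapping.keys x" for t
      using singular_linear_simplex[OF xt[OF that]]
      by (intro fits_subspace[OF tame_polyhedron] singular_chain_subdivide)
    have "vertex_chain n (sub_chain m n (realize_chain n x)) = twist w w (subdivided_tuple m) x"
    proof -
      have "sub_chain m n (realize_chain n x)
          = twist w (sing_weight n) (\<lambda>t. frag_extend (subdivide m n) (frag_of (linear_simplex n t))) x"
        using xt fits_linear_simplex L by (intro twist_twist) (auto simp: keys_frag_of)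
      then have "vertex_chain n (sub_chain m n (realize_chain n x))
          = vertex_chain n (twist w (sing_weight n) (\<lambda>t. subdivide m n (linear_simplex n t)) x)"
        by simp
      also have "\<dots> = twist w w (\<lambda>t. frag_extend (\<lambda>g. frag_of (vertex_tuple n g)) (subdivide m n (linear_simplex n t))) x"
      proof (rule twist_twist)
        fix t g assume t: "t \<in> Poly_Mapping.keys x"
        show "fits (sing_weight n) (w t) (subdivide m n (linear_simplex n t))"
        \<comment> \<open>The weights are compared in two stages: from the tuple to its linear
          simplex, then to the pieces inside the image of that simplex.\<close>
        proof (rule fits_trans)
          show "sing_weight n (linear_simplex n t) \<noteq> 0" "w t / sing_weight n (linear_simplex n t) \<in> \<int>"
            using fits_linear_simplex[OF xt[OF t]] by simp_all
          show "fits (sing_weight n) (sing_weight n (linear_simplex n t)) (subdivide m n (linear_simplex n t))"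
            by (rule L[OF t])
        qed
        show "fits w (sing_weight n g) (frag_of (vertex_tuple n g))"
          if "g \<in> Poly_Mapping.keys (subdivide m n (linear_simplex n t))"
          by (rule fits_vertex_tuple[OF s1[OF t that]])
      qed
      also have "\<dots> = twist w w (subdivided_tuple m) x"
        using xt by (intro twist_cong) (fastforce simp: subdivided_tuple_def tuples_def)
      finally show ?thesis .
    qed
    moreover have "vertex_chain n (sub_chain m n (realize_chain n x)) = tbd (Suc n) (vertex_chain (Suc n) (sub_chain m (Suc n) y))"
      using y sbd_subdivide_chain[OF tame_polyhedron, of "Suc n" y asc m] vertex_chain_boundary[OF s2]
      by (simp add: singular_chain_def)
    moreover have "tbd (Suc n) (vertex_chain (Suc n) (sub_chain m (Suc n) y)) \<in> tuple_boundaries n"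
      using keys_vertex_chain[OF s2] unfolding twisted_boundaries_def by blast
    ultimately have "twist w w (subdivided_tuple m) x \<in> tuple_boundaries n"
      by simp
    moreover have "twist w w (subdivided_tuple m) x - x \<in> tuple_boundaries n"
      using subdivided_tuple_boundary keys_subdivided_tuple x
      by (intro carried_chain_map_homotopic[OF typed]) (simp_all add: subdivided_tuple_def)
    ultimately have "twist w w (subdivided_tuple m) x - (twist w w (subdivided_tuple m) x - x) \<in> tuple_boundaries n"
      by (rule frag_subgroup_closed(2)[OF frag_subgroup_twisted_boundaries])
    then show ?thesis by simp
  qed
  show "\<exists>x\<in>tuple_cycles n. y - realize_chain n x \<in> sing_boundaries n" if y: "y \<in> sing_cycles n" for y
  proof -
    have ys: "Poly_Mapping.keys y \<subseteq> singular_basis ptop n" "sing_bd n y = 0"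
      using y by (auto simp: twisted_cycles_def)
    have "\<exists>N. \<forall>m\<ge>N. \<forall>f\<in>Poly_Mapping.keys y. \<forall>g\<in>Poly_Mapping.keys (subdivide m n f). small n g"
      using ys(1) by (intro eventually_small) auto
    then obtain m where m: "\<forall>f\<in>Poly_Mapping.keys y. \<forall>g\<in>Poly_Mapping.keys (subdivide m n f). small n g"
      by blast
    let ?y = "sub_chain m n y"
    have s: "small n g" if "g \<in> Poly_Mapping.keys ?y" for g
      using keys_sub_chain[OF that] m by blast
    have "sing_bd n ?y = 0"
      using sbd_subdivide_chain[OF tame_polyhedron, of n y asc m] ys by (simp add: singular_chain_def)
    then have cyc: "?y \<in> sing_cycles n"
      using s unfolding twisted_cycles_def small_def by blast
    have x: "vertex_chain n ?y \<in> tuple_cycles n"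
      using keys_vertex_chain[OF s] vertex_chain_boundary[OF s] \<open>sing_bd n ?y = 0\<close> by (simp add: twisted_cycles_def)
    \<comment> \<open>The two homotopies telescope to
      \<open>realize_chain n (vertex_chain n ?y) - y\<close>; the criterion asks for the negative of
      this.\<close>
    have "(?y - y) + (realize_chain n (vertex_chain n ?y) - ?y) \<in> sing_boundaries n"
      using subdivide_chain_homotopic[OF tame_polyhedron y] realize_vertex_homotopic[OF cyc s]
      by (rule frag_subgroup_closed(4)[OF frag_subgroup_twisted_boundaries])
    then have "- ((?y - y) + (realize_chain n (vertex_chain n ?y) - ?y)) \<in> sing_boundaries n"
      by (rule frag_subgroup_closed(3)[OF frag_subgroup_twisted_boundaries])
    then show ?thesis
      using x by (intro bexI[of _ "vertex_chain n ?y"]) simp_all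
  qed
qed

end

section \<open>Topological invariance\<close>

lemma group_twisted_homology:
  assumes "based_complex B a d"
  shows "group (twisted_homology B a d n)"
proof -
  interpret comm_group "frag_group (twisted_cycles B a d n)"
    by (rule comm_group_frag_group[OF frag_subgroup_twisted_cycles])
  show ?thesis
    unfolding twisted_homology_def
    by (intro normal.factorgroup_is_group subgroup_imp_normal subgroup_frag_group frag_subgroup_twisted_cycles
        frag_subgroup_twisted_boundaries twisted_boundaries_subset_cycles assms)
qed

lemma singular_weight_simplex_map:
  assumes f: "singular_simplex n X f" and lg: "\<And>x. x \<in> topspace X \<Longrightarrow> l' (g x) = l x"
  shows "singular_weight asc l' n (simplex_map n g f) = singular_weight asc l n f"
proof -
  have "l' ` simplex_map n g f ` standard_simplex n = l ` f ` standard_simplex n"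
    unfolding image_image
    using lg singular_simplex_image[OF f] by (intro image_cong refl) (auto simp: simplex_map_def)
  then show ?thesis
    by (simp add: singular_weight_def)
qed

lemma rescale_chain_map:
  assumes c: "singular_chain n X c" and lg: "\<And>x. x \<in> topspace X \<Longrightarrow> l' (g x) = l x"
  shows "rescale (singular_weight asc l' n) k (chain_map n g c) = chain_map n g (rescale (singular_weight asc l n) k c)"
  using c unfolding singular_chain_def
proof (induction c rule: frag_induction)
  case (one f)
  then show ?case
    using singular_weight_simplex_map[of n X f l' g l asc, OF _ lg] by simp
qed (simp_all add: chain_map_diff rescale_diff)

lemma twisted_boundary_chain_map:
  assumes c: "singular_chain n X c" and lg: "\<And>x. x \<in> topspace X \<Longrightarrow> l' (g x) = l x"
  shows "twisted_boundary (singular_weight asc l') singular_differential n (chain_map n g c)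
    = chain_map (n - 1) g (twisted_boundary (singular_weight asc l) singular_differential n c)"
  using c unfolding singular_chain_def
proof (induction c rule: frag_induction)
  case (one f)
  then have f: "singular_chain n X (frag_of f)"
    by (simp add: singular_chain_of)
  have "singular_differential n (simplex_map n g f) = chain_map (n - 1) g (singular_differential n f)"
    using chain_boundary_chain_map[OF f, of g] by (simp add: singular_differential_def)
  moreover have "singular_chain (n - 1) X (singular_differential n f)"
    using singular_chain_boundary[OF f] by (simp add: singular_differential_def)
  ultimately show ?case
    using one singular_weight_simplex_map[of n X f l' g l asc, OF _ lg]
      rescale_chain_map[where X = X and n = "n - 1" and asc = asc and l' = l' and g = g and l = l, OF _ lg]
    by (simp add: twisted_boundary_def)
qed (simp_all add: chain_map_diff twisted_boundary_diff)

lemma chain_map_inverse: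
  assumes c: "singular_chain n X c" and "\<And>x. x \<in> topspace X \<Longrightarrow> h (g x) = x"
  shows "chain_map n h (chain_map n g c) = c"
proof -
  have "chain_map n h (chain_map n g c) = chain_map n (h \<circ> g) c"
    by (simp add: chain_map_compose)
  also have "\<dots> = c"
    using assms by (intro chain_map_id_gen) auto
  finally show ?thesis .
qed

text \<open>Composition with \<open>g\<close> does not change the set of weight values on a simplex,
  so no rescaling intervenes: the chain maps of \<open>g\<close> and \<open>h\<close> are mutually
  inverse and commute with the twisted boundaries.\<close>

lemma singular_homology_weight_invariant:
  fixes X :: "'x topology" and Y :: "'y topology"
  assumes X: "tame X l" and Y: "tame Y l'" and gh: "homeomorphic_maps X Y g h"
    and lg: "\<And>x. x \<in> topspace X \<Longrightarrow> l' (g x) = l x"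
  shows "twisted_homology (singular_basis X) (singular_weight asc l) singular_differential n
    \<cong> twisted_homology (singular_basis Y) (singular_weight asc l') singular_differential n"
proof (rule twisted_homology_iso_criterion[OF based_complex_singular[OF X] based_complex_singular[OF Y]])
  let ?ZX = "twisted_cycles (singular_basis X) (singular_weight asc l) singular_differential n"
  let ?BX = "twisted_boundaries (singular_basis X) (singular_weight asc l) singular_differential n"
  let ?ZY = "twisted_cycles (singular_basis Y) (singular_weight asc l') singular_differential n"
  let ?BY = "twisted_boundaries (singular_basis Y) (singular_weight asc l') singular_differential n"
  have cont: "continuous_map X Y g" "continuous_map Y X h"
    and hg: "\<And>x. x \<in> topspace X \<Longrightarrow> h (g x) = x" and gh': "\<And>y. y \<in> topspace Y \<Longrightarrow> g (h y) = y"
    using gh by (auto simp: homeomorphic_maps_def)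
  have lh: "l (h y) = l' y" if "y \<in> topspace Y" for y
    using lg[of "h y"] gh'[OF that] continuous_map_image_subset_topspace[OF cont(2)] that by auto
  have keys: "Poly_Mapping.keys c \<subseteq> singular_basis Z m \<longleftrightarrow> singular_chain m Z c" for c m and Z :: "'z topology"
    by (simp add: singular_chain_def)
  show "chain_map n g (x + y) = chain_map n g x + chain_map n g y" for x y
    by (rule chain_map_add)
  show "chain_map n g x \<in> ?ZY" if "x \<in> ?ZX" for x
    using that singular_chain_chain_map[OF _ cont(1)] twisted_boundary_chain_map[of n X x l' g l, OF _ lg]
    unfolding twisted_cycles_def keys by simp
  show "chain_map n g x \<in> ?BY" if x: "x \<in> ?BX" for x
  proof -
    obtain b where b: "singular_chain (Suc n) X b"
      "x = twisted_boundary (singular_weight asc l) singular_differential (Suc n) b"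
      using x unfolding twisted_boundaries_def keys by blast
    then show ?thesis
      using singular_chain_chain_map[OF b(1) cont(1)] twisted_boundary_chain_map[of "Suc n" X b l' g l asc, OF b(1) lg]
      unfolding twisted_boundaries_def keys by (intro image_eqI[of _ _ "chain_map (Suc n) g b"]) simp_all
  qed
  show "x \<in> ?BX" if x: "x \<in> ?ZX" and gx: "chain_map n g x \<in> ?BY" for x
  proof -
    obtain b where b: "singular_chain (Suc n) Y b"
      "chain_map n g x = twisted_boundary (singular_weight asc l') singular_differential (Suc n) b"
      using gx unfolding twisted_boundaries_def keys by blast
    have "x = chain_map n h (chain_map n g x)"
      using x hg chain_map_inverse[of n X x h g] unfolding twisted_cycles_def keys by simp
    also have "\<dots> = twisted_boundary (singular_weight asc l) singular_differential (Suc n) (chain_map (Suc n) h b)"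
      using twisted_boundary_chain_map[of "Suc n" Y b l h l' asc, OF b(1) lh] b(2) by simp
    finally show ?thesis
      using singular_chain_chain_map[OF b(1) cont(2)] unfolding twisted_boundaries_def keys by blast
  qed
  show "\<exists>x\<in>?ZX. y - chain_map n g x \<in> ?BY" if y: "y \<in> ?ZY" for y
  proof
    have yc: "singular_chain n Y y"
      using y unfolding twisted_cycles_def keys by simp
    show "chain_map n h y \<in> ?ZX"
      using y singular_chain_chain_map[OF yc cont(2)] twisted_boundary_chain_map[of n Y y l h l', OF yc lh]
      unfolding twisted_cycles_def keys by simp
    have "y - chain_map n g (chain_map n h y) = 0"
      using chain_map_inverse[OF yc, of g h] gh' by simp
    then show "y - chain_map n g (chain_map n h y) \<in> ?BY"
      using frag_subgroup_closed(1)[OF frag_subgroup_twisted_boundaries] by simp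
  qed
qed

section \<open>Invariance of the type of the weight\<close>

context realized_complex
begin

text \<open>The neighbourhood is the open star of the carrier of \<open>x\<close>, cut out by
  finitely many positive coordinates. Carriers can grow but not shrink near a point.\<close>

lemma open_star:
  assumes x: "x \<in> underlying_set r K"
  obtains U where "openin ptop U" "x \<in> U" "\<And>y. y \<in> U \<Longrightarrow> carr x \<subseteq> carr y"
proof -
  define U where "U = (\<Inter>u\<in>carr x. {y \<in> topspace ptop. coord y u \<in> {0<..}})"
  have fin: "finite (carr x)" and ne: "carr x \<noteq> {}"
    using simplex_finite carr_in_complex[OF x] by auto
  have "openin ptop U"
    unfolding U_def using fin ne
    by (intro openin_INT2 openin_continuous_map_preimage[OF continuous_map_coord]) auto
  moreover have "x \<in> U"
    using x mem_carr_iff[OF x] by (auto simp: U_def topspace_polyhedron_topology)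
  moreover have "carr x \<subseteq> carr y" if "y \<in> U" for y
  proof
    fix u assume "u \<in> carr x"
    then show "u \<in> carr y"
      using that mem_carr_iff[of y u] by (auto simp: U_def topspace_polyhedron_topology)
  qed
  ultimately show thesis
    using that by blast
qed

lemma carrier_point:
  assumes s: "s \<in> K"
  obtains x where "x \<in> underlying_set r K" "carr x = s" "barycentric s (coord x) x" "\<And>u. u \<in> s \<Longrightarrow> 0 < coord x u"
proof -
  \<comment> \<open>The barycentre of \<open>s\<close>, with all coordinates equal, serves as the
    point.\<close>
  define c where "c = (\<lambda>u. if u \<in> s then 1 / real (card s) else 0)"
  define x where "x = (\<Sum>u\<in>s. c u *\<^sub>R r u)"
  have "0 < card s"
    using simplex_finite[OF s] by (simp add: card_gt_0_iff)
  then have b: "barycentric s c x"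
    by (simp add: barycentric_def c_def x_def)
  then have "coord x = c" "x \<in> cell s"
    using coord_eq[OF s] mem_cell_iff[OF s] by blast+
  moreover have "\<And>u. u \<in> s \<Longrightarrow> 0 < c u"
    using \<open>0 < card s\<close> by (simp add: c_def)
  moreover have "{u. c u \<noteq> 0} = s"
    using \<open>0 < card s\<close> by (auto simp: c_def)
  ultimately show thesis
    using that[of x] b carr_eq_support[of x] cell_subset_underlying[OF s] by auto
qed

text \<open>On the segment from an interior point of the face to an interior point of
  \<open>t\<close>, every point but the first has carrier \<open>t\<close>, because all its
  coordinates on \<open>t\<close> are positive.\<close>

lemma face_limit:
  assumes t: "t \<in> K" and "s \<subseteq> t" "s \<noteq> {}"
  obtains x where "x \<in> underlying_set r K" "carr x = s"
    "\<And>U. openin ptop U \<Longrightarrow> x \<in> U \<Longrightarrow> \<exists>y\<in>U. carr y = t"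
proof -
  have s: "s \<in> K"
    using face_closed assms by blast
  obtain x where x: "x \<in> underlying_set r K" "carr x = s" "barycentric s (coord x) x"
    using carrier_point[OF s] by blast
  obtain z where z: "barycentric t (coord z) z" "\<And>u. u \<in> t \<Longrightarrow> 0 < coord z u"
    using carrier_point[OF t] by blast
  have xt: "barycentric t (coord x) x"
    by (rule barycentric_mono[OF x(3) assms(2) simplex_finite(1)[OF t]])
  define path where "path = (\<lambda>a. (1 - a) *\<^sub>R x + a *\<^sub>R z)"
  have b: "barycentric t (\<lambda>u. (1 - a) * coord x u + a * coord z u) (path a)" if "a \<in> {0..1}" for a
  proof -
    have "(\<Sum>u\<in>t. ((1 - a) * coord x u + a * coord z u) *\<^sub>R r u)
        = (1 - a) *\<^sub>R (\<Sum>u\<in>t. coord x u *\<^sub>R r u) + a *\<^sub>R (\<Sum>u\<in>t. coord z u *\<^sub>R r u)"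
      by (simp add: scaleR_add_left sum.distrib scaleR_sum_right)
    moreover have "(\<Sum>u\<in>t. (1 - a) * coord x u + a * coord z u) = (1 - a) * sum (coord x) t + a * sum (coord z) t"
      by (simp add: sum.distrib sum_distrib_left)
    ultimately show ?thesis
      using xt z(1) that by (simp add: barycentric_def path_def)
  qed
  have pc: "path a \<in> cell t" if "a \<in> {0..1}" for a
    using b[OF that] mem_cell_iff[OF t] by blast
  have carr: "carr (path a) = t" if "a \<in> {0<..1}" for a
  proof -
    have a: "a \<in> {0..1}"
      using that by auto
    have "coord (path a) u \<noteq> 0 \<longleftrightarrow> u \<in> t" for u
    proof (cases "u \<in> t")
      case True
      then have "0 \<le> (1 - a) * coord x u" "0 < a * coord z u"
        using xt that z(2) by (simp_all add: barycentric_def)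
      then show ?thesis
        using True coord_eq[OF t b[OF a]] by simp
    next
      case False
      then show ?thesis
        using xt z(1) coord_eq[OF t b[OF a]] by (simp add: barycentric_def)
    qed
    then show ?thesis
      using carr_eq_support[of "path a"] cell_subset_underlying[OF t] pc[OF a] by auto
  qed
  have "continuous_map (top_of_set {0..1}) (top_of_set (cell t)) path"
    using pc by (auto simp: path_def intro!: continuous_intros)
  from continuous_map_compose[OF this continuous_map_cell_poly[OF t]]
  have cont: "continuous_map (top_of_set {0..1}) ptop path"
    by (simp add: o_def)
  show thesis
  proof (rule that[OF x(1,2)])
    fix U assume U: "openin ptop U" "x \<in> U"
    have "openin (top_of_set {0..1::real}) {a \<in> topspace (top_of_set {0..1}). path a \<in> U}"
      by (rule openin_continuous_map_preimage[OF cont U(1)])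
    moreover have "0 \<in> {a \<in> topspace (top_of_set {0..1::real}). path a \<in> U}"
      using U(2) by (simp add: path_def)
    ultimately obtain e where e: "0 < e" "ball 0 e \<inter> {0..1} \<subseteq> {a \<in> topspace (top_of_set {0..1::real}). path a \<in> U}"
      unfolding openin_contains_ball by blast
    define a where "a = min 1 (e / 2)"
    have "a \<in> {0<..1}" "a \<in> ball 0 e \<inter> {0..1}"
      using e(1) by (auto simp: a_def dist_real_def)
    then show "\<exists>y\<in>U. carr y = t"
      using e(2) carr by blast
  qed
qed

end

text \<open>Being ascending is a property of the weighted space. A point with carrier
  \<open>s\<close> is a limit of points with carrier \<open>t\<close>; their images under
  \<open>h\<close> eventually enter the open star around the image of the limit, where the carriers
  in \<open>K\<close> contain that of the limit. Divisibility in \<open>K\<close> then gives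
  divisibility of the same values in \<open>K'\<close>.\<close>

lemma ascending_weight_transfer:
  assumes K: "realized_complex r K" and K': "realized_complex r' K'"
    and h: "continuous_map (polyhedron_topology r' K') (polyhedron_topology r K) h"
    and lh: "\<And>y. y \<in> underlying_set r' K' \<Longrightarrow> point_weight r K \<mu> (h y) = point_weight r' K' \<mu>' y"
    and asc: "ascending_weight K \<mu>" and pos: "\<forall>s\<in>K'. 0 < \<mu>' s"
  shows "ascending_weight K' \<mu>'"
  unfolding ascending_weight_def
proof (intro conjI ballI impI)
  interpret K: realized_complex r K by (rule K)
  interpret K': realized_complex r' K' by (rule K')
  fix t s assume t: "t \<in> K'" and s: "s \<in> K'" and st: "s \<subseteq> t"
  have in_K: "h y \<in> underlying_set r K" if "y \<in> underlying_set r' K'" for y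
    using continuous_map_image_subset_topspace[OF h] that by (auto simp: topspace_polyhedron_topology)
  obtain x where x: "x \<in> underlying_set r' K'" "K'.carr x = s"
    "\<And>U. openin K'.ptop U \<Longrightarrow> x \<in> U \<Longrightarrow> \<exists>y\<in>U. K'.carr y = t"
    using K'.face_limit[OF t st K'.simplex_finite(2)[OF s]] by blast
  obtain U where U: "openin K.ptop U" "h x \<in> U" "\<And>y. y \<in> U \<Longrightarrow> K.carr (h x) \<subseteq> K.carr y"
    using K.open_star[OF in_K[OF x(1)]] by blast
  have "openin K'.ptop {y \<in> topspace K'.ptop. h y \<in> U}"
    by (rule openin_continuous_map_preimage[OF h U(1)])
  moreover have "x \<in> {y \<in> topspace K'.ptop. h y \<in> U}"
    using x(1) U(2) by (simp add: topspace_polyhedron_topology)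
  ultimately obtain y where y: "y \<in> {y \<in> topspace K'.ptop. h y \<in> U}" "K'.carr y = t"
    using x(3) by blast
  then have yK: "y \<in> underlying_set r' K'" "K.carr (h x) \<subseteq> K.carr (h y)"
    using U(3) by (auto simp: topspace_polyhedron_topology)
  then have "\<mu> (K.carr (h x)) dvd \<mu> (K.carr (h y))"
    using asc K.carr_in_complex[OF in_K] x(1) unfolding ascending_weight_def by blast
  then show "\<mu>' s dvd \<mu>' t"
    using lh[OF x(1)] lh[OF yK(1)] x(2) y(2) by (simp add: point_weight_def)
qed (use pos in blast)

lemma weighted_isomorphic_homeomorphism:
  assumes "weighted_isomorphic X l Y p" "weighted_isomorphic X l Z q"
  obtains g h where "homeomorphic_maps Y Z g h" "\<And>y. y \<in> topspace Y \<Longrightarrow> q (g y) = p y"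
proof -
  obtain f f' where f: "homeomorphic_map X Y f" "\<And>x. x \<in> topspace X \<Longrightarrow> p (f x) = l x"
    and f': "homeomorphic_map X Z f'" "\<And>x. x \<in> topspace X \<Longrightarrow> q (f' x) = l x"
    using assms unfolding weighted_isomorphic_def by blast
  obtain k where k: "homeomorphic_maps X Y f k"
    using f(1) homeomorphic_map_maps by blast
  obtain k' where k': "homeomorphic_maps X Z f' k'"
    using f'(1) homeomorphic_map_maps by blast
  have "homeomorphic_maps Y X k f"
    using k homeomorphic_maps_sym by blast
  then have "homeomorphic_maps Y Z (f' \<circ> k) (f \<circ> k')"
    using k' homeomorphic_maps_compose by blast
  moreover have "q ((f' \<circ> k) y) = p y" if y: "y \<in> topspace Y" for y
  proof -
    have "k y \<in> topspace X" "f (k y) = y"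
      using k y by (auto simp: homeomorphic_maps_def dest: continuous_map_image_subset_topspace)
    then show ?thesis
      using f(2)[of "k y"] f'(2)[of "k y"] by simp
  qed
  ultimately show thesis
    using that by blast
qed

theorem weighted_homology_weight_invariant:
  fixes r :: "'v \<Rightarrow> 'a::euclidean_space" and r' :: "'w \<Rightarrow> 'b::euclidean_space"
  assumes K: "weighted_complex K \<mu>" "geometric_realization r K"
    and K': "weighted_complex K' \<mu>'" "geometric_realization r' K'"
    and gh: "homeomorphic_maps (polyhedron_topology r K) (polyhedron_topology r' K') g h"
    and lg: "\<And>x. x \<in> underlying_set r K \<Longrightarrow> point_weight r' K' \<mu>' (g x) = point_weight r K \<mu> x"
  shows "weighted_homology K \<mu> n \<cong> weighted_homology K' \<mu>' n"
proof -
  \<comment> \<open>A weight of both types counts as ascending, in agreement with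
    \<open>weight_coeff\<close>.\<close>
  define asc where "asc = ascending_weight K \<mu>"
  have vc: "vertex_complex K" "vertex_complex K'"
    and pos: "\<forall>s\<in>K. 0 < \<mu> s" "\<forall>s\<in>K'. 0 < \<mu>' s"
    using K K' unfolding weighted_complex_def ascending_weight_def descending_weight_def by blast+
  have real: "realized_complex r K" "realized_complex r' K'"
    using vc K(2) K'(2) by (simp_all add: realized_complex_def)
  have cont: "continuous_map (polyhedron_topology r K) (polyhedron_topology r' K') g"
    "continuous_map (polyhedron_topology r' K') (polyhedron_topology r K) h"
    using gh by (auto simp: homeomorphic_maps_def)
  have lh: "point_weight r K \<mu> (h y) = point_weight r' K' \<mu>' y" if "y \<in> underlying_set r' K'" for y
  proof -
    have "h y \<in> underlying_set r K" "g (h y) = y"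
      using gh that continuous_map_image_subset_topspace[OF cont(2)]
      by (auto simp: homeomorphic_maps_def topspace_polyhedron_topology)
    then show ?thesis
      using lg[of "h y"] by simp
  qed
  \<comment> \<open>Each of the two continuous maps transfers the ascending condition to its domain;
    together they give the equivalence.\<close>
  have asc': "asc \<longleftrightarrow> ascending_weight K' \<mu>'"
    unfolding asc_def
    using ascending_weight_transfer[OF real cont(2) lh _ pos(2)]
      ascending_weight_transfer[OF real(2,1) cont(1) lg _ pos(1)] by blast
  have typed: "typed_weight asc K \<mu>" "typed_weight asc K' \<mu>'"
    using K K' asc' unfolding typed_weight_def weighted_complex_def by (auto simp: asc_def)
  interpret C: weighted_chain_complex asc K \<mu>
    using typed asc_def by unfold_locales
  interpret C': weighted_chain_complex asc K' \<mu>'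
    using typed asc' by unfold_locales
  interpret R: weighted_realization r K asc \<mu>
    using real typed by (simp add: weighted_realization_def weighted_realization_axioms_def)
  interpret R': weighted_realization r' K' asc \<mu>'
    using real typed by (simp add: weighted_realization_def weighted_realization_axioms_def)
  have S: "twisted_homology (singular_basis R.ptop) R.sing_weight singular_differential n
      \<cong> twisted_homology (singular_basis R'.ptop) R'.sing_weight singular_differential n"
    using lg by (intro singular_homology_weight_invariant[OF R.tame_polyhedron R'.tame_polyhedron gh])
      (simp add: topspace_polyhedron_topology)
  have R': "twisted_homology (singular_basis R'.ptop) R'.sing_weight singular_differential n
      \<cong> twisted_homology (tuples K') (\<lambda>n. R'.w) tuple_differential n"
    by (rule group.iso_sym[OF group_twisted_homology[OF R'.based_tuples] R'.tuple_homology_iso_singular])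
  show ?thesis
    \<comment> \<open>The chain of isomorphisms runs from oriented chains of \<open>K\<close>
      through tuples to singular chains, across the homeomorphism, and back down to
      \<open>K'\<close>.\<close>
    by (rule iso_trans[OF iso_trans[OF C.weighted_homology_iso_tuples R.tuple_homology_iso_singular]
          iso_trans[OF S iso_trans[OF R' C'.tuples_iso_weighted_homology]]])
qed

theorem theorem1p7:
  fixes X :: "'x topology" and l :: "'x \<Rightarrow> nat"
    and r :: "'v \<Rightarrow> 'a::euclidean_space" and K :: "'v set set" and \<mu> :: "'v set \<Rightarrow> nat"
    and r' :: "'w \<Rightarrow> 'b::euclidean_space" and K' :: "'w set set" and \<mu>' :: "'w set \<Rightarrow> nat"
    and n :: nat
  assumes "weighted_triangulation r K \<mu> X l" and "divisibly_weighted K \<mu>"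
    and "weighted_triangulation r' K' \<mu>' X l" and "divisibly_weighted K' \<mu>'"
  shows "weighted_homology K \<mu> n \<cong> weighted_homology K' \<mu>' n"
proof -
  have K: "weighted_complex K \<mu>" "geometric_realization r K"
    "weighted_isomorphic X l (polyhedron_topology r K) (point_weight r K \<mu>)"
    and K': "weighted_complex K' \<mu>'" "geometric_realization r' K'"
    "weighted_isomorphic X l (polyhedron_topology r' K') (point_weight r' K' \<mu>')"
    using assms(1,3) unfolding weighted_triangulation_def by blast+
  from weighted_isomorphic_homeomorphism[OF K(3) K'(3)]
  obtain g h where "homeomorphic_maps (polyhedron_topology r K) (polyhedron_topology r' K') g h"
    "\<And>y. y \<in> topspace (polyhedron_topology r K) \<Longrightarrow> point_weight r' K' \<mu>' (g y) = point_weight r K \<mu> y"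
    by blast
  then show ?thesis
    by (intro weighted_homology_weight_invariant[OF K(1,2) K'(1,2)]) (simp_all add: topspace_polyhedron_topology)
qed

end
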